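(* Let $n,r\ge 1$ be integers, let $L/L^{+}$ be a quadratic imaginary (totally imaginary quadratic) extension of a totally real number field $L^{+}$, and let $k_{1},\dots,k_{r},v$ be positive integers such that $k_{i}\geq n$ for each $i$ and such that $\frac{|\mu(L)|}{2}\,[\mathcal{O}_{L}^{\times}:\mu(L)\mathcal{O}_{L^{+}}^{\times}]$ divides $v$, where $\mu(L)$ is the set of roots of unity contained in $L$. Put $k=\sum_{i=1}^{r}k_{i}$. Let $\Gamma$ be a congruence subgroup of $U(n,n)(\mathcal{O}_L)$ and, for $j=1,\dots,r$, let $F_j$ be a scalar-valued Hermitian modular form of weight $k_j$ and level $\Gamma$. If $Q\in\mathcal{H}_{n,v}(k_{1},\dots,k_{r})$, then the function $$Z\longmapsto Q\left(\frac{\partial}{\partial Z_1},\dots,\frac{\partial}{\partial Z_r}\right)\big(F_1(Z_1)\cdots F_r(Z_r)\big)\Big|_{Z_1=\dots=Z_r=Z}$$ on $\mathbb{H}_n$ is a Hermitian modular form of weight $k+2v$ and level $\Gamma$.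
   Context: Hermitian upper half-space: $\mathbb{H}_{n}=\{Z\in M_{n,n}(\mathbb{C}) : \frac{1}{2i}(Z-Z^{\ast})>0\}$, where $Z^{\ast}$ is the conjugate transpose and $>0$ means positive definite. Let $J=\begin{pmatrix} 0 & -i1_{n}\\ i1_{n} & 0\end{pmatrix}$ and $U(n,n)=\{\gamma\in M_{2n,2n}(\mathbb{C}) : \gamma^{\ast}J\gamma=J\}$. The field $L$ is regarded as a subfield of $\mathbb{C}$, and $U(n,n)(\mathcal{O}_L)$ is the group of elements of $U(n,n)$ with entries in the ring of integers $\mathcal{O}_L$. The group $U(n,n)$ acts on $\mathbb{H}_n$ by $\gamma Z=(AZ+B)(CZ+D)^{-1}$ for $\gamma=\begin{pmatrix} A & B\\ C & D\end{pmatrix}$ with $n\times n$ blocks. A (scalar-valued) Hermitian modular form of level $\Gamma$ and weight $\kappa\in\mathbb{Z}$ is a holomorphic function $F:\mathbb{H}_n\to\mathbb{C}$ such that $F(Z)=\det(CZ+D)^{-\kappa}F(\gamma Z)$ for all $\gamma=\begin{pmatrix} A & B\\ C & D\end{pmatrix}\in\Gamma$ and all $Z\in\mathbb{H}_n$. For a matrix variable $Z=(z_{s,t})\in M_{n,n}$, $\frac{\partial}{\partial Z}$ is the $n\times n$ matrix of derivatives with $\left(\frac{\partial}{\partial Z}\right)_{s,t}=\frac{\partial}{\partial z_{t,s}}$. For a polynomial $Q(R_1,\dots,R_r)$ in the entries of $n\times n$ matrices, $Q(\frac{\partial}{\partial Z_1},\dots,\frac{\partial}{\partial Z_r})$ is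 the constant coefficient differential operator obtained by substitution. $\mathcal{Q}_{n,v}(r)$ is the space of complex polynomials $Q$ in the entries of $n\times n$ matrices $R_1,\dots,R_r$ such that $Q(AR_{1}{}^{t}B,\dots,AR_{r}{}^{t}B)=\det(A)^{v}\det(B)^{v}Q(R_{1},\dots,R_{r})$ for all $A,B\in\mathrm{GL}(n,\mathbb{C})$, where ${}^{t}B$ is the transpose. With $k=k_1+\dots+k_r$, a polynomial $P(X,Y)$ in the entries of $X=(x_{s,u}),Y=(y_{s,u})\in M_{n,k}(\mathbb{C})$ is pluriharmonic if $\sum_{u=1}^{k}\frac{\partial^{2}}{\partial x_{s,u}\partial y_{t,u}}P=0$ for all $1\le s,t\le n$. $\mathcal{H}_{n,v}(k_{1},\dots,k_{r})$ is the subspace of all $Q\in\mathcal{Q}_{n,v}(r)$ such that $Q(X_{1}{}^{t}Y_{1},\dots,X_{r}{}^{t}Y_{r})$ is pluriharmonic as a polynomial in the entries of $X=(X_{1},\dots,X_{r})$ and $Y=(Y_{1},\dots,Y_{r})$, where $X_{i},Y_{i}\in M_{n,k_{i}}$. *)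

theory Defs
  imports "HOL-Analysis.Analysis" "HOL-Algebra.Algebra" "HOL-Algebra.Algebraic_Closure_Type"
    "HOL-Library.Poly_Mapping"
begin

section \<open>Number fields inside the complex numbers\<close>

abbreviation complex_ring :: "complex ring" where
  "complex_ring \<equiv> ring_of_type_algebra"

definition number_field :: "complex set \<Rightarrow> bool" where
  "number_field K \<longleftrightarrow>
     subfield K complex_ring \<and> ring.finite_dimension complex_ring \<rat> K"

definition field_embeddings :: "complex set \<Rightarrow> (complex \<Rightarrow> complex) set" where
  "field_embeddings K = ring_hom (complex_ring\<lparr>carrier := K\<rparr>) complex_ring"

definition totally_real :: "complex set \<Rightarrow> bool" where
  "totally_real K \<longleftrightarrow> number_field K \<and> (\<forall>\<sigma>\<in>field_embeddings K. \<sigma> ` K \<subseteq> \<real>)"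

definition totally_imaginary :: "complex set \<Rightarrow> bool" where
  "totally_imaginary K \<longleftrightarrow> number_field K \<and> (\<forall>\<sigma>\<in>field_embeddings K. \<not> \<sigma> ` K \<subseteq> \<real>)"

definition totally_imaginary_quadratic_extension :: "complex set \<Rightarrow> complex set \<Rightarrow> bool" where
  "totally_imaginary_quadratic_extension L K \<longleftrightarrow>
     totally_real K \<and> totally_imaginary L \<and> K \<subseteq> L \<and> ring.dimension complex_ring 2 K L"

definition ring_of_integers :: "complex set \<Rightarrow> complex set" where
  "ring_of_integers K = {x \<in> K. algebraic_int x}"

definition integer_units :: "complex set \<Rightarrow> complex monoid" where
  "integer_units K = units_of (complex_ring\<lparr>carrier := ring_of_integers K\<rparr>)"

definition unity_roots :: "complex set \<Rightarrow> complex set" where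
  "unity_roots K = {x \<in> K. \<exists>m>0. x ^ m = 1}"

text \<open>The index of the subgroup generated by the roots of unity of \<open>L\<close> and the units of \<open>K\<close>
  in the units of \<open>L\<close>.\<close>

definition unit_index :: "complex set \<Rightarrow> complex set \<Rightarrow> nat" where
  "unit_index L K =
     card (rcosets\<^bsub>integer_units L\<^esub>
             (unity_roots L <#>\<^bsub>integer_units L\<^esub> carrier (integer_units K)))"


section \<open>The Hermitian upper half-space and the unitary group\<close>

definition conj_transpose :: "complex^'n^'m \<Rightarrow> complex^'m^'n" where
  "conj_transpose A = map_matrix cnj (transpose A)"

definition positive_definite :: "complex^'n^'n \<Rightarrow> bool" where
  "positive_definite M \<longleftrightarrow> conj_transpose M = M \<and>
     (\<forall>x. x \<noteq> 0 \<longrightarrow> 0 < Re (\<Sum>s\<in>UNIV. \<Sum>t\<in>UNIV. cnj (x $ s) * M $ s $ t * x $ t))"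

definition hermitian_half_space :: "(complex^'n^'n) set" where
  "hermitian_half_space =
     {Z. positive_definite (map_matrix (\<lambda>z. 1 / (2 * \<i>) * z) (Z - conj_transpose Z))}"

text \<open>Rows and columns of \<open>2n \<times> 2n\<close> matrices are indexed by the sum type \<open>'n + 'n\<close>, so that
  the four blocks are given by the constructors \<open>Inl\<close> and \<open>Inr\<close>.\<close>

definition block_A :: "complex^('n+'n)^('n+'n) \<Rightarrow> complex^'n^'n" where
  "block_A \<gamma> = (\<chi> s t. \<gamma> $ Inl s $ Inl t)"

definition block_B :: "complex^('n+'n)^('n+'n) \<Rightarrow> complex^'n^'n" where
  "block_B \<gamma> = (\<chi> s t. \<gamma> $ Inl s $ Inr t)"

definition block_C :: "complex^('n+'n)^('n+'n) \<Rightarrow> complex^'n^'n" where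
  "block_C \<gamma> = (\<chi> s t. \<gamma> $ Inr s $ Inl t)"

definition block_D :: "complex^('n+'n)^('n+'n) \<Rightarrow> complex^'n^'n" where
  "block_D \<gamma> = (\<chi> s t. \<gamma> $ Inr s $ Inr t)"

definition J_form :: "complex^('n::finite+'n)^('n+'n)" where
  "J_form = (\<chi> a b. case (a, b) of
       (Inl s, Inr t) \<Rightarrow> if s = t then - \<i> else 0
     | (Inr s, Inl t) \<Rightarrow> if s = t then \<i> else 0
     | _ \<Rightarrow> 0)"

definition unitary_nn :: "(complex^('n::finite+'n)^('n+'n)) set" where
  "unitary_nn = {\<gamma>. conj_transpose \<gamma> ** J_form ** \<gamma> = J_form}"

definition unitary_nn_integers :: "complex set \<Rightarrow> (complex^('n::finite+'n)^('n+'n)) monoid" where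
  "unitary_nn_integers L =
     \<lparr>carrier = {\<gamma> \<in> unitary_nn. \<forall>a b. \<gamma> $ a $ b \<in> ring_of_integers L},
      monoid.mult = (**), one = mat 1\<rparr>"

definition principal_congruence_subgroup ::
    "complex set \<Rightarrow> nat \<Rightarrow> (complex^('n::finite+'n)^('n+'n)) set" where
  "principal_congruence_subgroup L N =
     {\<gamma> \<in> carrier (unitary_nn_integers L).
        \<forall>a b. \<exists>x\<in>ring_of_integers L. \<gamma> $ a $ b - mat 1 $ a $ b = of_nat N * x}"

text \<open>Every nonzero ideal of the ring of integers contains a positive integer, so it is enough to
  allow principal congruence subgroups whose level is a positive integer.\<close>

definition congruence_subgroup ::
    "complex set \<Rightarrow> (complex^('n::finite+'n)^('n+'n)) set \<Rightarrow> bool" where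
  "congruence_subgroup L \<Gamma> \<longleftrightarrow> subgroup \<Gamma> (unitary_nn_integers L) \<and>
     (\<exists>N>0. principal_congruence_subgroup L N \<subseteq> \<Gamma>)"

definition moebius :: "complex^('n::finite+'n)^('n+'n) \<Rightarrow> complex^'n^'n \<Rightarrow> complex^'n^'n" where
  "moebius \<gamma> Z =
     (block_A \<gamma> ** Z + block_B \<gamma>) ** matrix_inv (block_C \<gamma> ** Z + block_D \<gamma>)"

text \<open>Holomorphy in several variables: the real Frechet derivative exists and is
  complex linear at every point.\<close>

definition holomorphic_matrix_fun ::
    "(complex^'n^'m) set \<Rightarrow> (complex^'n^'m \<Rightarrow> complex) \<Rightarrow> bool" where
  "holomorphic_matrix_fun S F \<longleftrightarrow>
     (\<forall>Z\<in>S. \<exists>D. (F has_derivative D) (at Z) \<and>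
        (\<forall>c W. D (map_matrix (\<lambda>w. c * w) W) = c * D W))"

definition hermitian_modular_form ::
    "(complex^('n::finite+'n)^('n+'n)) set \<Rightarrow> int \<Rightarrow> (complex^'n^'n \<Rightarrow> complex) \<Rightarrow> bool" where
  "hermitian_modular_form \<Gamma> \<kappa> F \<longleftrightarrow>
     holomorphic_matrix_fun hermitian_half_space F \<and>
     (\<forall>\<gamma>\<in>\<Gamma>. \<forall>Z\<in>hermitian_half_space.
        F Z = det (block_C \<gamma> ** Z + block_D \<gamma>) powi (- \<kappa>) * F (moebius \<gamma> Z))"


section \<open>Polynomials in matrix entries\<close>

text \<open>A polynomial is a finitely supported family of coefficients indexed by exponent vectors.\<close>

type_synonym 'x cpoly = "('x \<Rightarrow>\<^sub>0 nat) \<Rightarrow>\<^sub>0 complex"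

text \<open>Value of a polynomial at a point \<open>f\<close> of a commutative algebra with structure map \<open>c\<close>.\<close>

definition poly_subst :: "(complex \<Rightarrow> 'b) \<Rightarrow> ('x \<Rightarrow> 'b::comm_semiring_1) \<Rightarrow> 'x cpoly \<Rightarrow> 'b" where
  "poly_subst c f P =
     (\<Sum>m\<in>Poly_Mapping.keys P. c (Poly_Mapping.lookup P m) *
        (\<Prod>x\<in>Poly_Mapping.keys m. f x ^ Poly_Mapping.lookup m x))"

definition poly_const :: "complex \<Rightarrow> 'x cpoly" where
  "poly_const c = Poly_Mapping.single 0 c"

definition poly_var :: "'x \<Rightarrow> 'x cpoly" where
  "poly_var x = Poly_Mapping.single (Poly_Mapping.single x 1) 1"

definition poly_partial :: "'x \<Rightarrow> 'x cpoly \<Rightarrow> 'x cpoly" where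
  "poly_partial x P =
     (\<Sum>m\<in>Poly_Mapping.keys P.
        Poly_Mapping.single (m - Poly_Mapping.single x 1)
          (of_nat (Poly_Mapping.lookup m x) * Poly_Mapping.lookup P m))"

text \<open>The variable \<open>(j, s, t)\<close> is the \<open>(s, t)\<close> entry of the \<open>j\<close>-th matrix.\<close>

definition eval_matrices :: "('r \<times> 'n \<times> 'n) cpoly \<Rightarrow> ('r \<Rightarrow> complex^'n^'n) \<Rightarrow> complex" where
  "eval_matrices Q R = poly_subst (\<lambda>c. c) (\<lambda>(j, s, t). R j $ s $ t) Q"

definition Q_space :: "nat \<Rightarrow> ('r \<times> 'n::finite \<times> 'n) cpoly set" where
  "Q_space v = {Q. \<forall>A B R. invertible A \<longrightarrow> invertible B \<longrightarrow>
     eval_matrices Q (\<lambda>j. A ** R j ** transpose B) = det A ^ v * det B ^ v * eval_matrices Q R}"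

text \<open>Entries of \<open>X = (X\<^sub>1, \<dots>, X\<^sub>r)\<close> and \<open>Y = (Y\<^sub>1, \<dots>, Y\<^sub>r)\<close>: \<open>XVar s j u\<close> is the entry of \<open>X\<^sub>j\<close> in
  row \<open>s\<close> and column \<open>u\<close>, where \<open>u\<close> runs through \<open>0, \<dots>, k j - 1\<close>.\<close>

datatype ('n, 'r) xy_var = XVar 'n 'r nat | YVar 'n 'r nat

definition pluriharmonic :: "('r::finite \<Rightarrow> nat) \<Rightarrow> ('n, 'r) xy_var cpoly \<Rightarrow> bool" where
  "pluriharmonic k P \<longleftrightarrow>
     (\<forall>s t. (\<Sum>j\<in>UNIV. \<Sum>u<k j. poly_partial (XVar s j u) (poly_partial (YVar t j u) P)) = 0)"

definition subst_XY :: "('r \<Rightarrow> nat) \<Rightarrow> ('r \<times> 'n \<times> 'n) cpoly \<Rightarrow> ('n, 'r) xy_var cpoly" where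
  "subst_XY k Q = poly_subst poly_const
     (\<lambda>(j, s, t). \<Sum>u<k j. poly_var (XVar s j u) * poly_var (YVar t j u)) Q"

definition H_space :: "nat \<Rightarrow> ('r::finite \<Rightarrow> nat) \<Rightarrow> ('r \<times> 'n::finite \<times> 'n) cpoly set" where
  "H_space v k = {Q \<in> Q_space v. pluriharmonic k (subst_XY k Q)}"


section \<open>Constant coefficient differential operators\<close>

text \<open>The derivative with respect to the \<open>(s, t)\<close> entry of the \<open>j\<close>-th matrix; the nested
  \<open>axis\<close> term is the family of matrices with that single entry \<open>h\<close> and all others zero.\<close>

definition entry_deriv ::
    "'r \<Rightarrow> 'n \<Rightarrow> 'n \<Rightarrow> (complex^'n^'n^'r \<Rightarrow> complex) \<Rightarrow> complex^'n^'n^'r \<Rightarrow> complex" where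
  "entry_deriv j s t G Z = deriv (\<lambda>h. G (Z + axis j (axis s (axis t h)))) 0"

text \<open>The \<open>(s, t)\<close> entry of the matrix of derivatives is the derivative with respect to the
  \<open>(t, s)\<close> entry of the variable. The partial derivatives are applied in an arbitrary
  fixed order; the order is irrelevant at points near which the function is holomorphic.\<close>

definition monomial_deriv ::
    "('r \<times> 'n \<times> 'n \<Rightarrow>\<^sub>0 nat) \<Rightarrow> (complex^'n^'n^'r \<Rightarrow> complex)
       \<Rightarrow> complex^'n^'n^'r::finite \<Rightarrow> complex" where
  "monomial_deriv m G =
     foldr (\<lambda>(j, s, t). entry_deriv j t s ^^ Poly_Mapping.lookup m (j, s, t))
       (SOME xs. distinct xs \<and> set xs = UNIV) G"

definition poly_deriv ::
    "('r \<times> 'n \<times> 'n) cpoly \<Rightarrow> (complex^'n^'n^'r \<Rightarrow> complex)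
       \<Rightarrow> complex^'n^'n^'r::finite \<Rightarrow> complex" where
  "poly_deriv Q G Z =
     (\<Sum>m\<in>Poly_Mapping.keys Q. Poly_Mapping.lookup Q m * monomial_deriv m G Z)"

end

theory Submission
  imports Defs "HOL-Complex_Analysis.Cauchy_Integral_Formula" "HOL-Computational_Algebra.Squarefree"
begin

no_notation fps_nth (infixl "$" 75)

text \<open>
  Put \<open>M = C Z\<^sub>0 + D\<close> and \<open>N = A - \<gamma>(Z\<^sub>0) C\<close>. Then \<open>\<gamma>(Z\<^sub>0 + Z) = \<gamma>(Z\<^sub>0) + N Z (1 + C' Z)\<^sup>-\<^sup>1 M\<^sup>-\<^sup>1\<close> with
  \<open>C' = M\<^sup>-\<^sup>1 C\<close>, so near \<open>Z\<^sub>0\<close> the action is an affine map composed with a special conformal map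
  fixing \<open>0\<close>. The affine map contributes a power of determinants because \<open>Q\<close> is covariant. The
  conformal map is a composition of flows in which \<open>C'\<close> runs through multiples of elementary
  matrices; the generator of such a flow is dual to a second order operator on the symbols, which
  annihilates \<open>Q\<close> by pluriharmonicity since \<open>k j \<ge> n\<close>. Altogether this gives the factor
  \<open>det \<gamma>\<^sup>v det M\<^sup>-\<^sup>k\<^sup>-\<^sup>2\<^sup>v\<close>, and it remains to show that \<open>det \<gamma>\<^sup>v = 1\<close> unless all \<open>F j\<close> vanish.

  If \<open>K \<noteq> \<rat>\<close>, the forms are invariant under arbitrarily small translations in enough directions,
  so their derivatives vanish; they are constant, and zero because the weight is positive. If
  \<open>K = \<rat>\<close>, then \<open>det \<gamma>\<close> is a root of unity. Were \<open>det \<gamma>\<^sup>v \<noteq> 1\<close>, the determinant of some power of \<open>\<gamma>\<close>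
  would be \<open>l / cnj l\<close> for an element \<open>l\<close> whose norm has valuation one at a ramified prime \<open>p\<close>; but
  it also equals \<open>u / cnj u\<close> for a unit \<open>u\<close> at \<open>p\<close>, so \<open>u / l\<close> would be rational and the norm of \<open>u\<close>
  would have odd valuation.\<close>

section \<open>Polynomials\<close>

text \<open>The base point is moved to the origin because there a coordinate factor acts on a symbol
  as differentiation, and a partial derivative as multiplication by a variable. Under this duality
  the generator \<open>Z E Z\<close> of a conformal flow, with its weight term, becomes the operator
  obtained by rewriting pluriharmonicity of \<open>Q(X Y\<^sup>t)\<close> in the entries of
  \<open>X Y\<^sup>t\<close>. Elementary \<open>E\<close> are used since rank one makes the flow
  explicit, with one scalar denominator for each matrix. The obstacle is the determinant. The affine
  part contributes \<open>(det N / det M)\<^sup>v\<close>, while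
  \<open>det \<gamma> = det N * det M\<close>, so \<open>det \<gamma>\<^sup>v\<close> is left over.
  Over an imaginary quadratic field with \<open>c\<close> roots of unity,
  \<open>det \<gamma>\<close> is one of them, so its order divides \<open>c\<close>; but
  \<open>v\<close> is only known to be divisible by \<open>c / 2\<close>. The ramification argument
  supplies the missing factor two: \<open>l\<close> is the square root of \<open>- D\<close>, with
  quotient \<open>- 1\<close> by its conjugate, or, for \<open>D = 1\<close>, one of
  \<open>1 + \<i>\<close> and \<open>1 - \<i>\<close> at the ramified prime 2.\<close>

abbreviation keys :: "('a \<Rightarrow>\<^sub>0 'b::zero) \<Rightarrow> 'a set" where
  "keys \<equiv> Poly_Mapping.keys"

abbreviation lookup :: "('a \<Rightarrow>\<^sub>0 'b::zero) \<Rightarrow> 'a \<Rightarrow> 'b" where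
  "lookup \<equiv> Poly_Mapping.lookup"

lemma poly_const_0: "poly_const 0 = 0"
  by (simp add: poly_const_def)

lemma poly_const_1: "poly_const 1 = 1"
  by (simp add: poly_const_def)

lemma poly_const_add: "poly_const (a + b) = poly_const a + poly_const b"
  by (simp add: poly_const_def single_add)

lemma poly_const_mult: "poly_const (a * b) = poly_const a * poly_const b"
  by (simp add: poly_const_def mult_single)

lemma lookup_const_mult: "lookup (poly_const c * P) m = c * lookup P m"
proof -
  have "poly_const c * P = Poly_Mapping.map ((*) c) P"
    unfolding poly_const_def
    by (metis mult_map_scale_conv_mult)
  then show ?thesis
    by (simp add: Poly_Mapping.map.rep_eq when_def)
qed

lemma poly_mapping_sum_single: "(\<Sum>m\<in>keys P. Poly_Mapping.single m (lookup P m)) = P"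
  by (intro poly_mapping_eqI)
    (simp add: lookup_sum lookup_single when_def sum.delta' in_keys_iff)

lemma poly_var_mult_single:
  "poly_var x * Poly_Mapping.single m c = Poly_Mapping.single (m + Poly_Mapping.single x 1) c"
  by (simp add: poly_var_def mult_single add.commute)

text \<open>Induction on the total degree: a nonzero exponent vector is a smaller one plus a unit
  vector.\<close>

lemma exponent_induct [case_names zero single]:
  fixes m :: "'x \<Rightarrow>\<^sub>0 nat"
  assumes "Pr 0" and "\<And>m x. Pr m \<Longrightarrow> Pr (m + Poly_Mapping.single x 1)"
  shows "Pr m"
proof (induction "\<Sum>x\<in>keys m. lookup m x" arbitrary: m)
  case 0
  then have "\<forall>x\<in>keys m. lookup m x = 0" by simp
  then have "m = 0"
    by (metis in_keys_iff keys_eq_empty all_not_in_conv)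
  with assms(1) show ?case by simp
next
  case (Suc d)
  then obtain x where x: "x \<in> keys m" by fastforce
  define m' where "m' = m - Poly_Mapping.single x 1"
  have m: "m = m' + Poly_Mapping.single x 1"
    using x by (intro poly_mapping_eqI) (auto simp: m'_def lookup_add lookup_minus lookup_single when_def in_keys_iff)
  have "(\<Sum>y\<in>keys m'. lookup m' y) = (\<Sum>y\<in>keys m. lookup m' y)"
    by (rule sum.mono_neutral_left)
    (auto simp: m'_def lookup_minus in_keys_iff)
  also have "\<dots> = (\<Sum>y\<in>keys m. lookup m y - (if y = x then 1 else 0))"
    by (intro sum.cong) (auto simp: m'_def lookup_minus lookup_single when_def)
  also have "\<dots> = (\<Sum>y\<in>keys m. lookup m y) - (\<Sum>y\<in>keys m. if y = x then 1 else 0)"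
    by (intro sum_subtractf_nat) (use x in \<open>auto simp: in_keys_iff\<close>)
  also have "(\<Sum>y\<in>keys m. if y = x then 1 else (0::nat)) = 1"
    using x by simp
  finally have "d = (\<Sum>y\<in>keys m'. lookup m' y)"
    using Suc.hyps(2) by simp
  from assms(2)[OF Suc.hyps(1)[OF this], of x] show ?case
    by (simp add: m)
qed

text \<open>Constants, sums and multiplication by a variable generate all polynomials; later
  identities between operators attached to symbols are checked on these three constructions.\<close>

lemma cpoly_induct [case_names const add var]:
  fixes P :: "'x cpoly"
  assumes const: "\<And>c. Pr (poly_const c)"
    and add: "\<And>p q. Pr p \<Longrightarrow> Pr q \<Longrightarrow> Pr (p + q)"
    and var: "\<And>x p. Pr p \<Longrightarrow> Pr (poly_var x * p)"
  shows "Pr P"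
proof -
  have single: "Pr (Poly_Mapping.single m c)" for m :: "'x \<Rightarrow>\<^sub>0 nat" and c
  proof (induction m rule: exponent_induct)
    case zero
    with const[of c] show ?case by (simp add: poly_const_def)
  next
    case (single m x)
    from var[OF this, of x] show ?case
      by (simp only: poly_var_mult_single)
  qed
  have "Pr (\<Sum>m\<in>A. Poly_Mapping.single m (lookup P m))" if "finite A" for A
    using that
  proof (induction A rule: finite_induct)
    case empty
    then show ?case using single[of 0 0] by simp
  next
    case (insert a A)
    then show ?case by (simp add: add single)
  qed
  from this[of "keys P"] show ?thesis
    by (simp add: poly_mapping_sum_single)
qed

text \<open>Shifting exponents by a unit vector is injective, so no two terms merge and coefficients
  are simply transported.\<close>

lemma keys_var_mult: "keys (poly_var x * P) = (\<lambda>m. m + Poly_Mapping.single x 1) ` keys P"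
  and lookup_var_mult: "lookup (poly_var x * P) (m + Poly_Mapping.single x 1) = lookup P m"
proof -
  let ?s = "Poly_Mapping.single x (1::nat)"
  have lk: "lookup (poly_var x * P) n = (\<Sum>m\<in>keys P. if m + ?s = n then lookup P m else 0)" for n
  proof -
    have "poly_var x * P = (\<Sum>m\<in>keys P. Poly_Mapping.single (m + ?s) (lookup P m))"
      unfolding poly_var_mult_single[symmetric] sum_distrib_left[symmetric] poly_mapping_sum_single ..
    then show ?thesis
      by (simp add: lookup_sum lookup_single when_def)
  qed
  have A: "lookup (poly_var x * P) (m + ?s) = lookup P m" for m
    unfolding lk add_right_cancel by (simp add: sum.delta in_keys_iff)
  show "lookup (poly_var x * P) (m + ?s) = lookup P m" by (rule A)
  show "keys (poly_var x * P) = (\<lambda>m. m + ?s) ` keys P"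
  proof (intro equalityI subsetI)
    fix n assume "n \<in> keys (poly_var x * P)"
    then have "(\<Sum>m\<in>keys P. if m + ?s = n then lookup P m else 0) \<noteq> 0"
      by (simp add: in_keys_iff lk)
    then obtain m where "m \<in> keys P" "m + ?s = n"
      by (auto elim!: sum.not_neutral_contains_not_neutral split: if_splits)
    then show "n \<in> (\<lambda>m. m + ?s) ` keys P" by blast
  qed (auto simp: in_keys_iff A[simplified])
qed

lemma sum_var_mult:
  assumes "\<And>m. h (m + Poly_Mapping.single x 1) = g m"
  shows "(\<Sum>m\<in>keys (poly_var x * P). lookup (poly_var x * P) m * h m) =
    (\<Sum>m\<in>keys P. lookup P m * (g m :: complex))"
proof -
  have "inj_on (\<lambda>m. m + Poly_Mapping.single x (1::nat)) (keys P)"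
    by (simp add: inj_on_def)
  then show ?thesis
    unfolding keys_var_mult
    by (simp only: sum.reindex o_def lookup_var_mult assms)
qed

text \<open>Cancellation can make the support of the sum smaller than the union of the supports;
  because \<open>c 0 = 0\<close>, all three sums may be extended to that union.\<close>

lemma sum_keys_add:
  fixes h :: "('x \<Rightarrow>\<^sub>0 nat) \<Rightarrow> 'b::comm_semiring_1"
  assumes c: "c 0 = 0" "\<And>a b. c (a + b) = c a + c b"
  shows "(\<Sum>m\<in>keys (P + Q). c (lookup (P + Q) m) * h m) =
    (\<Sum>m\<in>keys P. c (lookup P m) * h m) + (\<Sum>m\<in>keys Q. c (lookup Q m) * h m)"
    (is "?S (P + Q) = ?S P + ?S Q")
proof -
  have S: "?S R = (\<Sum>m\<in>keys P \<union> keys Q. c (lookup R m) * h m)"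
    if "keys R \<subseteq> keys P \<union> keys Q" for R
    using that by (intro sum.mono_neutral_left) (auto simp: in_keys_iff c)
  show ?thesis
    unfolding S[OF keys_add] S[of P, OF Un_upper1] S[of Q, OF Un_upper2]
    by (simp only: lookup_add c distrib_right sum.distrib)
qed

lemma poly_subst_add:
  assumes "c 0 = 0" "\<And>a b. c (a + b) = c a + c b"
  shows "poly_subst c f (P + Q) = poly_subst c f P + poly_subst c f Q"
  unfolding poly_subst_def by (rule sum_keys_add[OF assms])

lemma poly_subst_const:
  assumes "c 0 = 0"
  shows "poly_subst c f (poly_const a) = c a"
  using assms by (simp add: poly_subst_def poly_const_def)

lemma poly_subst_var_mult:
  "poly_subst c f (poly_var x * P) = f x * poly_subst c f P"
proof -
  let ?s = "Poly_Mapping.single x (1::nat)"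
  let ?h = "\<lambda>m. \<Prod>x\<in>keys m. f x ^ lookup m x"
  have h: "?h (m + ?s) = f x * ?h m" for m
  proof -
    have ext: "?h n = (\<Prod>y\<in>insert x (keys m). f y ^ lookup n y)" if "keys n \<subseteq> insert x (keys m)" for n
      using that by (intro prod.mono_neutral_left) (auto simp: in_keys_iff)
    have "keys (m + ?s) \<subseteq> insert x (keys m)"
      using keys_add[of m ?s] by (auto simp: keys_single split: if_splits)
    then have "?h (m + ?s) = (\<Prod>y\<in>insert x (keys m). f y ^ lookup (m + ?s) y)"
      by (rule ext)
    also have "\<dots> = (\<Prod>y\<in>insert x (keys m). f y ^ lookup m y * (if y = x then f x else 1))"
      by (intro prod.cong) (auto simp: lookup_add lookup_single when_def mult.commute)
    also have "\<dots> = f x * (\<Prod>y\<in>insert x (keys m). f y ^ lookup m y)"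
      by (simp add: prod.distrib prod.delta mult.commute)
    also have "(\<Prod>y\<in>insert x (keys m). f y ^ lookup m y) = ?h m"
      by (rule ext[symmetric]) auto
    finally show ?thesis .
  qed
  have "inj_on (\<lambda>m. m + ?s) (keys P)"
    by (simp add: inj_on_def)
  then show ?thesis
    unfolding poly_subst_def keys_var_mult
    by (simp only: sum.reindex o_def lookup_var_mult h sum_distrib_left mult.left_commute)
qed

lemma poly_subst_mult:
  assumes c: "c 0 = 0" "c 1 = 1" "\<And>a b. c (a + b) = c a + c b" "\<And>a b. c (a * b) = c a * c b"
  shows "poly_subst c f (P * Q) = poly_subst c f P * poly_subst c f Q"
proof (induction P rule: cpoly_induct)
  case (const a)
  show ?case
  proof (induction Q rule: cpoly_induct)
    case (const b)
    then show ?case by (simp add: poly_const_mult[symmetric] poly_subst_const c)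
  next
    case (add p q)
    then show ?case by (simp add: distrib_left poly_subst_add c)
  next
    case (var x p)
    have "poly_const a * (poly_var x * p) = poly_var x * (poly_const a * p)"
      by (rule mult.left_commute)
    then have "poly_subst c f (poly_const a * (poly_var x * p)) =
        f x * (poly_subst c f (poly_const a) * poly_subst c f p)"
      by (simp only: poly_subst_var_mult var)
    also have "\<dots> = poly_subst c f (poly_const a) * poly_subst c f (poly_var x * p)"
      by (simp only: poly_subst_var_mult mult.left_commute)
    finally show ?case .
  qed
next
  case (add p q)
  then show ?case by (simp add: distrib_right poly_subst_add c)
next
  case (var x p)
  then show ?case by (simp add: poly_subst_var_mult mult.assoc)
qed

section \<open>Evaluation and substitution homomorphisms\<close>

abbreviation ev :: "('x \<Rightarrow> complex) \<Rightarrow> 'x cpoly \<Rightarrow> complex" where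
  "ev \<equiv> poly_subst (\<lambda>c. c)"

lemma ev_add [simp]: "ev f (P + Q) = ev f P + ev f Q"
  by (simp add: poly_subst_add)

lemma ev_const [simp]: "ev f (poly_const c) = c"
  by (simp add: poly_subst_const)

lemma ev_mult [simp]: "ev f (P * Q) = ev f P * ev f Q"
  by (simp add: poly_subst_mult)

lemma ev_0 [simp]: "ev f 0 = 0"
  by (simp add: poly_subst_def)

lemma ev_var [simp]: "ev f (poly_var x) = f x"
  using poly_subst_var_mult[of "\<lambda>c. c" f x 1] by (simp flip: poly_const_1)

lemma ev_sum [simp]: "ev f (sum g A) = (\<Sum>a\<in>A. ev f (g a))"
  by (induction A rule: infinite_finite_induct) auto

abbreviation psubst :: "('x \<Rightarrow> 'y cpoly) \<Rightarrow> 'x cpoly \<Rightarrow> 'y cpoly" where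
  "psubst \<equiv> poly_subst poly_const"

lemma psubst_add: "psubst f (P + Q) = psubst f P + psubst f Q"
  by (simp add: poly_subst_add poly_const_0 poly_const_add)

lemma psubst_const: "psubst f (poly_const c) = poly_const c"
  by (simp add: poly_subst_const poly_const_0)

lemma psubst_0: "psubst f 0 = 0"
  by (simp add: poly_subst_def)

lemma psubst_mult: "psubst f (P * Q) = psubst f P * psubst f Q"
  by (simp add: poly_subst_mult poly_const_0 poly_const_1 poly_const_add poly_const_mult)

lemma psubst_sum: "psubst f (sum g A) = (\<Sum>a\<in>A. psubst f (g a))"
  by (induction A rule: infinite_finite_induct) (auto simp: psubst_0 psubst_add)

lemma psubst_var: "psubst f (poly_var x) = f x"
  using poly_subst_var_mult[of poly_const f x "poly_const 1"]
  unfolding psubst_const by (simp add: poly_const_1)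

lemma ev_psubst: "ev g (psubst f P) = ev (\<lambda>x. ev g (f x)) P"
  by (induction P rule: cpoly_induct) (simp_all add: psubst_const psubst_add poly_subst_var_mult)

section \<open>Formal partial derivatives\<close>

lemma lookup_partial:
  "lookup (poly_partial x P) m =
     of_nat (lookup m x + 1) * lookup P (m + Poly_Mapping.single x 1)"
proof -
  let ?s = "Poly_Mapping.single x (1::nat)"
  \<comment> \<open>Subtraction of exponents is truncated, so an \<open>n\<close> without the
    variable \<open>x\<close> also satisfies \<open>n - ?s = n\<close>; the factor
    \<open>lookup n x\<close> removes these spurious terms.\<close>
  have eq: "n - ?s = m \<and> lookup n x \<noteq> 0 \<longleftrightarrow> n = m + ?s" for n
  proof
    assume *: "n - ?s = m \<and> lookup n x \<noteq> 0"
    then show "n = m + ?s"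
      by (intro poly_mapping_eqI) (auto simp: lookup_add lookup_minus lookup_single when_def)
  qed (auto simp: lookup_add)
  have "lookup (poly_partial x P) m =
      (\<Sum>n\<in>keys P. if n = m + ?s then of_nat (lookup n x) * lookup P n else 0)"
    unfolding poly_partial_def lookup_sum lookup_single when_def
  proof (intro sum.cong refl)
    fix n
    show "(if n - ?s = m then of_nat (lookup n x) * lookup P n else 0) =
        (if n = m + ?s then of_nat (lookup n x) * lookup P n else 0)"
      by (cases "lookup n x = 0") (simp, simp only: eq[symmetric] simp_thms not_False_eq_True)
  qed
  also have "\<dots> = of_nat (lookup m x + 1) * lookup P (m + ?s)"
    by (simp add: sum.delta' lookup_add in_keys_iff)
  finally show ?thesis .
qed

lemma partial_add: "poly_partial x (P + Q) = poly_partial x P + poly_partial x Q"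
  by (intro poly_mapping_eqI) (simp only: lookup_add lookup_partial distrib_left)

lemma partial_0: "poly_partial x 0 = 0"
  by (simp add: poly_partial_def)

lemma partial_sum: "poly_partial x (sum g A) = (\<Sum>a\<in>A. poly_partial x (g a))"
  by (induction A rule: infinite_finite_induct) (auto simp: partial_0 partial_add)

lemma partial_const: "poly_partial x (poly_const c) = 0"
  by (simp add: poly_partial_def poly_const_def)

lemma partial_const_mult: "poly_partial x (poly_const c * P) = poly_const c * poly_partial x P"
  by (intro poly_mapping_eqI) (simp only: lookup_partial lookup_const_mult mult.left_commute)

lemma minus_single_add:
  fixes m :: "'x \<Rightarrow>\<^sub>0 nat"
  assumes "lookup m x \<noteq> 0"
  shows "m - Poly_Mapping.single x 1 + Poly_Mapping.single x 1 = m"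
  using assms
  by (intro poly_mapping_eqI) (auto simp: lookup_add lookup_minus lookup_single when_def)

lemma lookup_var_mult_if:
  "lookup (poly_var x * P) m =
    (if lookup m x = 0 then 0 else lookup P (m - Poly_Mapping.single x 1))"
proof (cases "lookup m x = 0")
  case True
  have "m \<noteq> n + Poly_Mapping.single x 1" for n
  proof
    assume "m = n + Poly_Mapping.single x 1"
    with True show False by (simp add: lookup_add)
  qed
  then have "m \<notin> keys (poly_var x * P)" by (auto simp: keys_var_mult)
  then show ?thesis using True by (simp add: in_keys_iff)
next
  case False
  then show ?thesis
    using lookup_var_mult[of x P "m - Poly_Mapping.single x 1", unfolded minus_single_add[OF False]]
    by simp
qed

lemma partial_var_mult:
  "poly_partial x (poly_var y * P) = (if x = y then P else 0) + poly_var y * poly_partial x P"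
proof (intro poly_mapping_eqI)
  fix m
  have s: "m - Poly_Mapping.single y (Suc 0) + Poly_Mapping.single x (Suc 0) =
      m + Poly_Mapping.single x (Suc 0) - Poly_Mapping.single y (Suc 0)" if "lookup m y \<noteq> 0"
    using that
    by (intro poly_mapping_eqI) (auto simp: lookup_add lookup_minus lookup_single when_def)
  show "lookup (poly_partial x (poly_var y * P)) m =
      lookup ((if x = y then P else 0) + poly_var y * poly_partial x P) m"
    by (cases "x = y"; cases "lookup m y = 0")
      (auto simp: lookup_partial lookup_add lookup_var_mult_if lookup_minus lookup_single s
        distrib_right of_nat_diff minus_single_add[of m y, simplified])
qed

lemma partial_var: "poly_partial x (poly_var y) = (if x = y then 1 else 0)"
  using partial_var_mult[of x y "poly_const 1"]
  unfolding partial_const by (simp add: poly_const_1)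

lemma partial_mult:
  "poly_partial x (P * Q) = poly_partial x P * Q + P * poly_partial x Q"
proof (induction P rule: cpoly_induct)
  case (const c)
  then show ?case by (simp add: partial_const partial_const_mult)
next
  case (add p q)
  then show ?case by (simp add: distrib_right partial_add)
next
  case (var y p)
  then show ?case
    by (simp add: mult.assoc partial_var_mult distrib_left distrib_right)
qed

text \<open>The chain rule for formal derivatives; it drives the rewriting of pluriharmonicity in
  \<open>subst_XY_Lap\<close>.\<close>

lemma partial_psubst:
  fixes P :: "('x::finite) cpoly"
  shows "poly_partial y (psubst f P) =
    (\<Sum>x\<in>UNIV. psubst f (poly_partial x P) * poly_partial y (f x))"
proof (induction P rule: cpoly_induct)
  case (const c)
  then show ?case by (simp add: psubst_const partial_const psubst_0)
next
  case (add p q)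
  then show ?case by (simp add: psubst_add partial_add distrib_right sum.distrib)
next
  case (var z p)
  have "(\<Sum>x\<in>UNIV. psubst f (poly_partial x (poly_var z * p)) * poly_partial y (f x)) =
     (\<Sum>x\<in>UNIV. (if x = z then psubst f p * poly_partial y (f z) else 0) +
         f z * (psubst f (poly_partial x p) * poly_partial y (f x)))"
    by (intro sum.cong)
      (auto simp: partial_var_mult psubst_add psubst_0 poly_subst_var_mult distrib_right mult.assoc)
  also have "\<dots> = psubst f p * poly_partial y (f z) + f z * poly_partial y (psubst f p)"
    by (simp add: sum.distrib var sum_distrib_left)
  also have "\<dots> = poly_partial y (psubst f (poly_var z * p))"
    unfolding poly_subst_var_mult partial_mult by (simp only: mult.commute)
  finally show ?case ..
qed

lemma ev_partial:
  fixes P :: "'x cpoly"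
  shows "((\<lambda>h. ev (f(x := h)) P) has_field_derivative ev f (poly_partial x P)) (at (f x))"
proof (induction P rule: cpoly_induct)
  case (const c)
  then show ?case by (simp add: partial_const)
next
  case (add p q)
  then show ?case by (auto simp: partial_add intro: DERIV_add)
next
  case (var y p)
  have "((\<lambda>h. (f(x := h)) y) has_field_derivative (if x = y then 1 else 0)) (at (f x))"
    by (cases "x = y") auto
  note DERIV_mult[OF this var]
  moreover have "ev f (poly_partial x (poly_var y * p)) =
      (if x = y then 1 else 0) * ev (f(x := f x)) p + ev f (poly_partial x p) * (f(x := f x)) y"
    unfolding partial_var_mult by (simp add: mult.commute[of _ "ev f p"] mult.commute[of "f y"])
  ultimately show ?case
    by (simp only: poly_subst_var_mult)
qed

lemma lookup_0_ev: "lookup P 0 = ev (\<lambda>_. 0) P"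
proof (induction P rule: cpoly_induct)
  case (var x p)
  have "0 \<notin> keys (poly_var x * p)"
    unfolding lookup_var_mult_if by (simp add: in_keys_iff lookup_var_mult_if)
  then show ?case by (simp add: in_keys_iff)
next
  case (const c)
  show ?case by (simp only: ev_const) (simp add: poly_const_def)
qed (simp add: lookup_add)

text \<open>Vanishing as a function passes to formal derivatives by \<open>ev_partial\<close>. The
  coefficient at \<open>m + Poly_Mapping.single x 1\<close> is, up to a nonzero integer factor, the
  coefficient of \<open>poly_partial x P\<close> at \<open>m\<close>, so the induction descends to
  the value at the origin.\<close>

lemma poly_zeroI:
  fixes P :: "'x cpoly"
  assumes "\<And>f. ev f P = 0"
  shows "P = 0"
proof (rule poly_mapping_eqI)
  fix m
  have "lookup P m = 0"
    using assms
  proof (induction m arbitrary: P rule: exponent_induct)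
    case zero
    then show ?case by (simp add: lookup_0_ev)
  next
    case (single m' x)
    have "ev f (poly_partial x P) = 0" for f
      using DERIV_unique[OF ev_partial[of f x P], of 0] unfolding single.prems by simp
    then have "lookup (poly_partial x P) m' = 0"
      by (rule single.IH)
    moreover have "of_nat (lookup m' x + 1) \<noteq> (0::complex)"
      by (simp only: of_nat_eq_0_iff)
    ultimately show ?case unfolding lookup_partial mult_eq_0_iff by blast
  qed
  then show "lookup P m = lookup 0 m" by simp
qed

lemma poly_eqI:
  fixes P Q :: "'x cpoly"
  assumes "\<And>f. ev f P = ev f Q"
  shows "P = Q"
proof -
  have "ev f (P + poly_const (-1) * Q) = 0" for f
    by (simp only: ev_add ev_mult ev_const assms) simp
  then have *: "P + poly_const (-1) * Q = 0"
    by (rule poly_zeroI)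
  show ?thesis
  proof (rule poly_mapping_eqI)
    fix m
    have "lookup (P + poly_const (-1) * Q) m = 0"
      unfolding * by simp
    then have "lookup P m + (-1) * lookup Q m = 0"
      by (simp only: lookup_add lookup_const_mult)
    then show "lookup P m = lookup Q m" by simp
  qed
qed

section \<open>Holomorphic functions of several variables\<close>

text \<open>The derivative is an explicit argument, so that derivatives along a vector field, as in
  \<open>flow_pde\<close>, can be read off from it.\<close>

definition cder :: "(complex^'i \<Rightarrow> complex) \<Rightarrow> (complex^'i \<Rightarrow> complex) \<Rightarrow> complex^'i \<Rightarrow> bool" where
  "cder f D z \<longleftrightarrow> (f has_derivative D) (at z) \<and> (\<forall>c w. D (c *s w) = c * D w)"

definition holo :: "(complex^'i) set \<Rightarrow> (complex^'i \<Rightarrow> complex) \<Rightarrow> bool" where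
  "holo S f \<longleftrightarrow> (\<forall>z\<in>S. \<exists>D. cder f D z)"

definition pd :: "'i \<Rightarrow> (complex^'i \<Rightarrow> complex) \<Rightarrow> complex^'i \<Rightarrow> complex" where
  "pd i f z = deriv (\<lambda>h. f (z + axis i h)) 0"

lemma bounded_linear_axis: "bounded_linear (\<lambda>h::complex. axis i h :: complex^'i)"
proof -
  have "linear (\<lambda>h::complex. axis i h :: complex^'i)"
    by (rule linearI) (auto simp: vec_eq_iff axis_def)
  then show ?thesis by (simp add: linear_conv_bounded_linear)
qed

lemma axis_zero [simp]: "axis i (0::complex) = 0"
  by (simp add: vec_eq_iff axis_def)

lemma axis_eq_scale: "axis i h = h *s (axis i 1 :: complex^'i)"
  by (auto simp: vec_eq_iff axis_def)

lemma cder_axis: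
  assumes "cder f D z"
  shows "((\<lambda>h. f (z + axis i h)) has_field_derivative D (axis i 1)) (at 0)"
proof -
  have "((\<lambda>h::complex. z + axis i h) has_derivative (\<lambda>h. axis i h)) (at 0)"
    by (auto intro!: derivative_eq_intros bounded_linear.has_derivative[OF bounded_linear_axis])
  moreover have "(f has_derivative D) (at (z + axis i 0))"
    using assms by (simp add: cder_def)
  ultimately have "((\<lambda>h. f (z + axis i h)) has_derivative (\<lambda>h. D (axis i h))) (at 0)"
    by (rule has_derivative_compose)
  moreover have "D (axis i h) = D (axis i 1) * h" for h
  proof -
    have "D (h *s axis i 1) = h * D (axis i 1)"
      using assms unfolding cder_def by blast
    then show ?thesis
      unfolding axis_eq_scale[of i h, symmetric] by (simp only: mult.commute)
  qed
  then have "(\<lambda>h. D (axis i h)) = (*) (D (axis i 1))"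
    by (intro ext)
  ultimately show ?thesis
    unfolding has_field_derivative_def by (simp only:)
qed

lemma cder_pd: "cder f D z \<Longrightarrow> pd i f z = D (axis i 1)"
  unfolding pd_def by (rule DERIV_imp_deriv) (rule cder_axis)

lemma cder_eq:
  fixes f :: "complex^'i::finite \<Rightarrow> complex"
  assumes "cder f D z"
  shows "D w = (\<Sum>i\<in>UNIV. w $ i * pd i f z)"
proof -
  have lin: "linear D"
    using assms has_derivative_linear by (auto simp: cder_def)
  have "D w = D (\<Sum>i\<in>UNIV. w $ i *s axis i 1)"
    by (simp add: basis_expansion)
  also have "\<dots> = (\<Sum>i\<in>UNIV. D (w $ i *s axis i 1))"
    by (rule linear_sum[OF lin])
  also have "\<dots> = (\<Sum>i\<in>UNIV. w $ i * pd i f z)"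
    using assms by (intro sum.cong) (simp_all add: cder_pd[OF assms] cder_def)
  finally show ?thesis .
qed

lemma holo_cderI: "holo S f \<Longrightarrow> z \<in> S \<Longrightarrow> cder f (\<lambda>w. \<Sum>i\<in>UNIV. w $ i * pd i f z) z"
  for f :: "complex^'i::finite \<Rightarrow> complex"
proof -
  assume "holo S f" "z \<in> S"
  then obtain D where D: "cder f D z" by (auto simp: holo_def)
  have "D = (\<lambda>w. \<Sum>i\<in>UNIV. w $ i * pd i f z)"
    by (rule ext) (rule cder_eq[OF D])
  with D show ?thesis by simp
qed

lemma cder_const: "cder (\<lambda>z. c) (\<lambda>w. 0) z"
  by (simp add: cder_def)

lemma cder_nth: "cder (\<lambda>z. z $ i) (\<lambda>w. w $ i) z"
  by (auto simp: cder_def intro!: bounded_linear.has_derivative[OF bounded_linear_vec_nth] derivative_intros)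

lemma cder_add: "cder f D z \<Longrightarrow> cder g E z \<Longrightarrow> cder (\<lambda>z. f z + g z) (\<lambda>w. D w + E w) z"
  by (auto simp: cder_def algebra_simps intro!: derivative_intros)

lemma cder_diff: "cder f D z \<Longrightarrow> cder g E z \<Longrightarrow> cder (\<lambda>z. f z - g z) (\<lambda>w. D w - E w) z"
  by (auto simp: cder_def algebra_simps intro!: derivative_intros)

lemma cder_mult:
  "cder f D z \<Longrightarrow> cder g E z \<Longrightarrow> cder (\<lambda>z. f z * g z) (\<lambda>w. f z * E w + D w * g z) z"
  by (auto simp: cder_def algebra_simps intro!: derivative_eq_intros)

lemma cder_field_comp:
  assumes "cder f D z" and "(g has_field_derivative g') (at (f z))"
  shows "cder (\<lambda>z. g (f z)) (\<lambda>w. g' * D w) z"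
proof -
  have "((\<lambda>z. g (f z)) has_derivative (\<lambda>w. g' * D w)) (at z)"
    using assms has_derivative_compose[of f D z UNIV g "(*) g'"]
    by (simp add: cder_def has_field_derivative_def)
  then show ?thesis using assms(1) by (simp add: cder_def)
qed

lemma cder_sum:
  "(\<And>a. a \<in> A \<Longrightarrow> cder (f a) (D a) z) \<Longrightarrow> cder (\<lambda>z. \<Sum>a\<in>A. f a z) (\<lambda>w. \<Sum>a\<in>A. D a w) z"
  by (auto simp: cder_def sum_distrib_left intro!: derivative_intros)

lemma cder_compose:
  fixes f :: "complex^'j::finite \<Rightarrow> complex" and m :: "complex^'i \<Rightarrow> complex^'j"
  assumes f: "cder f D (m z)" and m: "\<And>j. cder (\<lambda>z. m z $ j) (M j) z"
  shows "cder (\<lambda>z. f (m z)) (\<lambda>w. D (\<chi> j. M j w)) z"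
proof -
  have ax: "(\<Sum>j\<in>UNIV. axis j (x j)) = (\<chi> j. x j)" for x :: "'j \<Rightarrow> complex"
    by (simp add: vec_eq_iff axis_def sum.delta)
  have "((\<lambda>z. \<Sum>j\<in>UNIV. axis j (m z $ j)) has_derivative (\<lambda>w. \<Sum>j\<in>UNIV. axis j (M j w))) (at z)"
    using m by (auto simp: cder_def
      intro!: has_derivative_sum bounded_linear.has_derivative[OF bounded_linear_axis])
  then have "(m has_derivative (\<lambda>w. \<chi> j. M j w)) (at z)"
    by (simp add: ax)
  then have "((\<lambda>z. f (m z)) has_derivative (\<lambda>w. D (\<chi> j. M j w))) (at z)"
    using f by (intro has_derivative_compose[of m _ z UNIV f D]) (auto simp: cder_def)
  moreover have "(\<chi> j. M j (c *s w)) = c *s (\<chi> j. M j w)" for c w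
    using m by (simp add: cder_def vec_eq_iff)
  ultimately show ?thesis
    using f by (simp add: cder_def)
qed

lemma holo_const: "holo S (\<lambda>z. c)"
  unfolding holo_def using cder_const by blast

lemma holo_nth: "holo S (\<lambda>z. z $ i)"
  unfolding holo_def using cder_nth by blast

lemma holo_add: "holo S f \<Longrightarrow> holo S g \<Longrightarrow> holo S (\<lambda>z. f z + g z)"
  unfolding holo_def using cder_add by blast

lemma holo_mult: "holo S f \<Longrightarrow> holo S g \<Longrightarrow> holo S (\<lambda>z. f z * g z)"
  unfolding holo_def using cder_mult by blast

lemma holo_sum: "(\<And>a. a \<in> A \<Longrightarrow> holo S (f a)) \<Longrightarrow> holo S (\<lambda>z. \<Sum>a\<in>A. f a z)"
  by (induction A rule: infinite_finite_induct) (auto intro: holo_const holo_add)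

lemma holo_prod: "(\<And>a. a \<in> A \<Longrightarrow> holo S (f a)) \<Longrightarrow> holo S (\<lambda>z. \<Prod>a\<in>A. f a z)"
  by (induction A rule: infinite_finite_induct) (auto intro: holo_const holo_mult)

lemma holo_compose:
  fixes f :: "complex^'j::finite \<Rightarrow> complex" and m :: "complex^'i \<Rightarrow> complex^'j"
  assumes "holo T f" "\<And>j. holo S (\<lambda>z. m z $ j)" "\<And>z. z \<in> S \<Longrightarrow> m z \<in> T"
  shows "holo S (\<lambda>z. f (m z))"
  unfolding holo_def
proof
  fix z assume z: "z \<in> S"
  obtain D where D: "cder f D (m z)" using assms(1,3) z by (auto simp: holo_def)
  have "\<forall>j. \<exists>M. cder (\<lambda>z. m z $ j) M z" using assms(2) z by (auto simp: holo_def)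
  then obtain M where "\<And>j. cder (\<lambda>z. m z $ j) (M j) z" by metis
  from cder_compose[OF D this] show "\<exists>D. cder (\<lambda>z. f (m z)) D z" by blast
qed

lemma pd_cong_open:
  assumes S: "open S" "z \<in> S" and eq: "\<And>x. x \<in> S \<Longrightarrow> f x = g x"
  shows "pd i f z = pd i g z"
proof -
  let ?l = "\<lambda>h::complex. z + axis i h"
  have "open (?l -` S)"
    by (intro open_vimage S continuous_intros linear_continuous_on bounded_linear_axis)
  moreover have "0 \<in> ?l -` S"
    using S by simp
  ultimately have "\<forall>\<^sub>F h in nhds 0. ?l h \<in> S"
    using eventually_nhds_in_open by fastforce
  then have "\<forall>\<^sub>F h in nhds 0. f (z + axis i h) = g (z + axis i h)"
    by (rule eventually_mono) (rule eq)
  then show ?thesis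
    unfolding pd_def by (intro deriv_cong_ev) auto
qed

lemma holo_continuous_on: "holo S f \<Longrightarrow> continuous_on S f"
  unfolding holo_def cder_def
  by (intro continuous_at_imp_continuous_on ballI) (auto dest: has_derivative_continuous)

text \<open>Cauchy's formula on a circle in one coordinate direction; the factor
  \<open>2 * pi * \<i>\<close> cancels against the velocity of the circle. With one radius for all
  nearby centres the right side is a parameter integral in \<open>z\<close>, open to continuity
  arguments and to differentiation under the integral.\<close>

lemma cauchy_pd:
  fixes f :: "complex^'i::finite \<Rightarrow> complex"
  assumes S: "open S" and f: "holo S f" and r: "0 < r"
    and disc: "\<And>\<zeta>. norm \<zeta> \<le> r \<Longrightarrow> z + axis i \<zeta> \<in> S"
  shows "pd i f z = integral (cbox 0 1) (\<lambda>t::real. f (z + axis i (of_real r * exp (2 * of_real pi * \<i> * of_real t)))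
     * inverse (of_real r * exp (2 * of_real pi * \<i> * of_real t)))"
proof -
  define g where "g = (\<lambda>\<zeta>. f (z + axis i \<zeta>))"
  have g_deriv: "g field_differentiable at \<zeta>" if norm: "norm \<zeta> \<le> r" for \<zeta>
  proof -
    obtain D where D: "cder f D (z + axis i \<zeta>)"
      using f disc[OF norm] by (auto simp: holo_def)
    have "((\<lambda>h. g (\<zeta> + h)) has_field_derivative D (axis i 1)) (at 0)"
    proof -
      have "axis i (\<zeta> + h) = (axis i \<zeta> + axis i h :: complex^'i)" for h
        by (auto simp: vec_eq_iff axis_def)
      then show ?thesis
        using cder_axis[OF D, of i] by (simp add: g_def add.assoc)
    qed
    then have "(g has_field_derivative D (axis i 1)) (at \<zeta>)"
      using DERIV_shift[of g "D (axis i 1)" 0 \<zeta>] by (simp add: add.commute)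
    then show ?thesis by (auto simp: field_differentiable_def)
  qed
  have "continuous_on (cball 0 r) g"
    using g_deriv by (intro continuous_at_imp_continuous_on)
      (auto intro: field_differentiable_imp_continuous_at)
  moreover have "g holomorphic_on ball 0 r"
    unfolding holomorphic_on_def
    using g_deriv by (auto intro: field_differentiable_at_within)
  ultimately have "(g has_field_derivative (1 / (2 * of_real pi * \<i>) *
      contour_integral (circlepath 0 r) (\<lambda>u. g u / (u - 0)\<^sup>2))) (at 0)"
    using r by (intro Cauchy_derivative_integral_circlepath) auto
  then have "pd i f z = 1 / (2 * of_real pi * \<i>) *
      contour_integral (circlepath 0 r) (\<lambda>u. g u / (u - 0)\<^sup>2)"
    unfolding pd_def g_def by (rule DERIV_imp_deriv)
  also have "contour_integral (circlepath 0 r) (\<lambda>u. g u / (u - 0)\<^sup>2) =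
     integral {0..1} (\<lambda>t. 2 * of_real pi * \<i> * (g (of_real r * exp (2 * of_real pi * \<i> * of_real t))
       * inverse (of_real r * exp (2 * of_real pi * \<i> * of_real t))))"
    unfolding contour_integral_integral
  proof (rule integral_cong)
    fix t :: real assume "t \<in> {0..1}"
    show "g (circlepath 0 r t) / (circlepath 0 r t - 0)\<^sup>2 * vector_derivative (circlepath 0 r) (at t) =
      2 * of_real pi * \<i> * (g (of_real r * exp (2 * of_real pi * \<i> * of_real t))
       * inverse (of_real r * exp (2 * of_real pi * \<i> * of_real t)))"
    proof -
      define u where "u = of_real r * exp (2 * of_real pi * \<i> * of_real t)"
      have "u \<noteq> 0" using r by (simp add: u_def)
      moreover have "circlepath 0 r t = u"
        by (simp add: circlepath u_def)
      moreover have "vector_derivative (circlepath 0 r) (at t) = 2 * of_real pi * \<i> * u"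
        unfolding vector_derivative_circlepath u_def by simp
      ultimately show ?thesis
        unfolding u_def[symmetric] by (simp add: field_simps power2_eq_square)
    qed
  qed
  also have "\<dots> = 2 * of_real pi * \<i> * integral {0..1} (\<lambda>t. g (of_real r * exp (2 * of_real pi * \<i> * of_real t))
       * inverse (of_real r * exp (2 * of_real pi * \<i> * of_real t)))"
    by (rule integral_mult_right)
  finally show ?thesis by (simp add: g_def)
qed

lemma norm_axis_eq: "norm (axis i h :: complex^'i::finite) = norm h"
proof -
  have "(\<Sum>j\<in>UNIV. (norm ((axis i h :: complex^'i) $ j))\<^sup>2) = (\<Sum>j\<in>UNIV. if j = i then (norm h)\<^sup>2 else 0)"
    by (intro sum.cong) (auto simp: axis_def)
  then show ?thesis by (simp add: norm_vec_def L2_set_def)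
qed

lemma open_contains_discs:
  fixes S :: "(complex^'i::finite) set"
  assumes "open S" "z0 \<in> S"
  obtains r where "r > 0" "\<And>z \<zeta>. z \<in> ball z0 r \<Longrightarrow> norm \<zeta> \<le> r \<Longrightarrow> z + axis i \<zeta> \<in> S"
proof -
  obtain e where e: "e > 0" "ball z0 e \<subseteq> S" using assms openE by blast
  have "z + axis i \<zeta> \<in> S" if "z \<in> ball z0 (e / 2)" "norm \<zeta> \<le> e / 2" for z \<zeta>
  proof -
    have "dist z0 (z + axis i \<zeta>) \<le> dist z0 z + norm (axis i \<zeta> :: complex^'i)"
      by norm
    also have "\<dots> < e" using that by (simp add: norm_axis_eq)
    finally show ?thesis using e(2) by auto
  qed
  with e(1) show ?thesis by (intro that[of "e / 2"]) auto
qed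

text \<open>The Leibniz rule in \<open>cder_pd_integral\<close> asks for joint continuity of the
  derivative of the integrand, so continuity of partial derivatives precedes their
  differentiability.\<close>

lemma holo_pd_continuous:
  fixes f :: "complex^'i::finite \<Rightarrow> complex"
  assumes S: "open S" and f: "holo S f"
  shows "continuous_on S (pd i f)"
proof (rule continuous_at_imp_continuous_on, rule ballI)
  fix z0 assume "z0 \<in> S"
  then obtain r where r: "r > 0"
    and disc: "\<And>z \<zeta>. z \<in> ball z0 r \<Longrightarrow> norm \<zeta> \<le> r \<Longrightarrow> z + axis i \<zeta> \<in> S"
    using open_contains_discs[OF S] by metis
  have "continuous_on (ball z0 r) (\<lambda>z. integral (cbox 0 1) (\<lambda>t::real.
      f (z + axis i (of_real r * exp (2 * of_real pi * \<i> * of_real t)))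
     * inverse (of_real r * exp (2 * of_real pi * \<i> * of_real t))))"
    unfolding split_def
  proof (rule integral_continuous_on_param, unfold split_def, rule continuous_on_mult)
    show "continuous_on (ball z0 r \<times> cbox 0 1) (\<lambda>x. f (fst x + axis i
        (of_real r * exp (2 * of_real pi * \<i> * of_real (snd x)))))"
      using r
      by (intro continuous_on_compose2[OF holo_continuous_on[OF f]] continuous_intros
          bounded_linear.continuous_on[OF bounded_linear_axis])
        (auto simp: norm_mult intro!: disc)
    show "continuous_on (ball z0 r \<times> cbox 0 1)
        (\<lambda>x. inverse (of_real r * exp (2 * of_real pi * \<i> * of_real (snd x))))"
      using r by (intro continuous_intros) auto
  qed
  then have "continuous_on (ball z0 r) (pd i f)"
  proof (rule continuous_on_eq)
    fix z assume z: "z \<in> ball z0 r"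
    show "integral (cbox 0 1) (\<lambda>t::real.
      f (z + axis i (of_real r * exp (2 * of_real pi * \<i> * of_real t)))
     * inverse (of_real r * exp (2 * of_real pi * \<i> * of_real t))) = pd i f z"
      by (rule cauchy_pd[OF S f r disc[OF z], symmetric])
  qed
  then show "isCont (pd i f) z0"
    using r by (simp add: continuous_on_eq_continuous_at)
qed

text \<open>Cauchy's formula is differentiated under the integral sign. On a coordinate vector the
  result is Cauchy's integral for \<open>pd j f\<close>, which gives the symmetry of mixed
  derivatives. The second claim is conditional because holomorphy of \<open>pd j f\<close> is itself
  a consequence of the first, drawn in \<open>holo_pd\<close>.\<close>

lemma cder_pd_integral:
  fixes f :: "complex^'i::finite \<Rightarrow> complex"
  assumes S: "open S" and f: "holo S f" and z0: "z0 \<in> S"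
  obtains D where "cder (pd i f) D z0"
    and "\<And>j. holo S (pd j f) \<Longrightarrow> D (axis j 1) = pd i (pd j f) z0"
proof -
  obtain r where r: "r > 0"
    and disc: "\<And>z \<zeta>. z \<in> ball z0 r \<Longrightarrow> norm \<zeta> \<le> r \<Longrightarrow> z + axis i \<zeta> \<in> S"
    using open_contains_discs[OF S z0] by metis
  define c :: "real \<Rightarrow> complex" where "c = (\<lambda>t. of_real r * exp (2 * of_real pi * \<i> * of_real t))"
  have c0: "c t \<noteq> 0" for t using r by (simp add: c_def)
  have cr: "norm (c t) = r" for t using r by (simp add: c_def norm_mult)
  have cont_c: "continuous_on A c" for A
    unfolding c_def by (intro continuous_intros)
  have cont_comp: "continuous_on (ball z0 r \<times> cbox 0 1) (\<lambda>x. h (fst x + axis i (c (snd x))))"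
    if h: "continuous_on S h" for h :: "complex^'i \<Rightarrow> complex"
    by (intro continuous_on_compose2[OF h] continuous_intros
          bounded_linear.continuous_on[OF bounded_linear_axis] continuous_on_compose2[OF cont_c])
      (auto simp: cr intro!: disc)
  \<comment> \<open>\<open>L z t\<close> is the derivative of the integrand at \<open>z\<close>; the
    Leibniz rule integrates it as an element of the space of bounded linear maps, whence the
    \<open>Blinfun\<close> below.\<close>
  define L where "L = (\<lambda>z t w. (\<Sum>j\<in>UNIV. w $ j * pd j f (z + axis i (c t))) * inverse (c t))"
  have L_bl: "bounded_linear (L z t)" for z t
    unfolding L_def
    by (intro bounded_linear_intros bounded_linear_compose[OF bounded_linear_mult_left]
      bounded_linear_sum bounded_linear_vec_nth)
  have Bl: "blinfun_apply (Blinfun (L z t)) = L z t" for z t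
    by (rule bounded_linear_Blinfun_apply[OF L_bl])
  have cont_L: "continuous_on (ball z0 r \<times> cbox 0 1) (\<lambda>x. Blinfun (L (fst x) (snd x)))"
  proof (rule continuous_on_blinfun_componentwise)
    fix w :: "complex^'i"
    show "continuous_on (ball z0 r \<times> cbox 0 1) (\<lambda>x. blinfun_apply (Blinfun (L (fst x) (snd x))) w)"
      unfolding Bl unfolding L_def
      by (intro continuous_intros cont_comp holo_pd_continuous S f
          continuous_on_compose2[OF cont_c]) (auto simp: c0)
  qed
  have der: "((\<lambda>z. integral (cbox 0 1) (\<lambda>t. f (z + axis i (c t)) * inverse (c t)))
      has_derivative blinfun_apply (integral (cbox 0 1) (\<lambda>t. Blinfun (L z0 t)))) (at z0 within ball z0 r)"
  proof (rule leibniz_rule)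
    fix z t assume z: "z \<in> ball z0 r" "t \<in> cbox 0 (1::real)"
    have "cder f (\<lambda>w. \<Sum>j\<in>UNIV. w $ j * pd j f (z + axis i (c t))) (z + axis i (c t))"
      using disc[of z "c t"] z cr by (intro holo_cderI[OF f]) auto
    then have "((\<lambda>z. f (z + axis i (c t))) has_derivative
        (\<lambda>w. \<Sum>j\<in>UNIV. w $ j * pd j f (z + axis i (c t)))) (at z)"
      unfolding cder_def
      by (intro has_derivative_compose[of "\<lambda>z. z + axis i (c t)" "\<lambda>w. w" z UNIV f])
        (auto intro!: derivative_eq_intros)
    then have "((\<lambda>z. f (z + axis i (c t)) * inverse (c t)) has_derivative L z t) (at z)"
      unfolding L_def by (rule has_derivative_mult_left)
    then show "((\<lambda>z. f (z + axis i (c t)) * inverse (c t)) has_derivative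
        blinfun_apply (Blinfun (L z t))) (at z within ball z0 r)"
      unfolding Bl by (rule has_derivative_at_withinI)
  next
    fix z assume z: "z \<in> ball z0 r"
    show "(\<lambda>t. f (z + axis i (c t)) * inverse (c t)) integrable_on cbox 0 1"
      using z
      by (intro integrable_continuous continuous_intros continuous_on_compose2[OF holo_continuous_on[OF f]]
          bounded_linear.continuous_on[OF bounded_linear_axis] cont_c)
        (auto simp: c0 cr intro!: disc)
  qed (use cont_L r in \<open>auto simp: split_def\<close>)
  define D where "D = blinfun_apply (integral (cbox 0 1) (\<lambda>t. Blinfun (L z0 t)))"
  have "continuous_on (cbox 0 1) (\<lambda>t. Blinfun (L z0 t))"
  proof -
    have "continuous_on (cbox 0 (1::real)) (\<lambda>t. (z0, t))"
      by (intro continuous_intros)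
    from continuous_on_compose2[OF cont_L this] r show ?thesis by fastforce
  qed
  then have "(\<lambda>t. Blinfun (L z0 t)) integrable_on cbox 0 1"
    by (rule integrable_continuous)
  from blinfun_apply_integral[OF this]
  have D: "D w = integral (cbox 0 1) (\<lambda>t. L z0 t w)" for w
    unfolding D_def Bl .
  have "((\<lambda>z. integral (cbox 0 1) (\<lambda>t. f (z + axis i (c t)) * inverse (c t))) has_derivative D) (at z0)"
    using der unfolding D_def at_within_open[OF centre_in_ball[THEN iffD2, OF r] open_ball] .
  then have "(pd i f has_derivative D) (at z0)"
  proof (rule has_derivative_transform_within_open[of _ _ _ _ "ball z0 r"])
    fix z assume z: "z \<in> ball z0 r"
    show "integral (cbox 0 1) (\<lambda>t. f (z + axis i (c t)) * inverse (c t)) = pd i f z"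
      unfolding c_def by (rule cauchy_pd[OF S f r disc[OF z], symmetric])
  qed (use r in auto)
  moreover have "L z0 t (a *s w) = a * L z0 t w" for t a w
    unfolding L_def by (simp add: sum_distrib_left mult.assoc)
  then have "D (a *s w) = a * D w" for a w
    unfolding D by simp
  ultimately have "cder (pd i f) D z0"
    by (simp add: cder_def)
  moreover have "D (axis j 1) = pd i (pd j f) z0" if j: "holo S (pd j f)" for j
  proof -
    have "L z0 t (axis j 1) = pd j f (z0 + axis i (c t)) * inverse (c t)" for t
    proof -
      have "(\<Sum>k\<in>UNIV. (axis j 1 :: complex^'i) $ k * pd k f (z0 + axis i (c t))) =
        (\<Sum>k\<in>UNIV. if k = j then pd k f (z0 + axis i (c t)) else 0)"
        by (intro sum.cong) (auto simp: axis_def)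
      then show ?thesis by (simp add: L_def)
    qed
    then show ?thesis
      unfolding D using cauchy_pd[OF S j r disc, of z0] r by (simp add: c_def)
  qed
  ultimately show ?thesis by (rule that)
qed

lemma holo_pd:
  fixes f :: "complex^'i::finite \<Rightarrow> complex"
  assumes "open S" "holo S f"
  shows "holo S (pd i f)"
  unfolding holo_def using cder_pd_integral[OF assms] by metis

lemma pd_commute:
  fixes f :: "complex^'i::finite \<Rightarrow> complex"
  assumes "open S" "holo S f" "z \<in> S"
  shows "pd j (pd i f) z = pd i (pd j f) z"
  using cder_pd_integral[OF assms, of i] cder_pd holo_pd[OF assms(1,2)] by metis

section \<open>Constant coefficient differential operators\<close>

lemma pd_add: "holo S f \<Longrightarrow> holo S g \<Longrightarrow> z \<in> S \<Longrightarrow> pd i (\<lambda>z. f z + g z) z = pd i f z + pd i g z"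
  for f :: "complex^'i::finite \<Rightarrow> complex"
  by (simp add: cder_pd[OF cder_add[OF holo_cderI holo_cderI]])
    (simp add: cder_pd[OF holo_cderI, symmetric])

lemma pd_mult:
  "holo S f \<Longrightarrow> holo S g \<Longrightarrow> z \<in> S \<Longrightarrow> pd i (\<lambda>z. f z * g z) z = f z * pd i g z + pd i f z * g z"
  for f :: "complex^'i::finite \<Rightarrow> complex"
  by (simp add: cder_pd[OF cder_mult[OF holo_cderI holo_cderI]])
    (simp add: cder_pd[OF holo_cderI, symmetric])

lemma pd_const [simp]: "pd i (\<lambda>z. c) z = 0"
  by (simp add: cder_pd[OF cder_const])

lemma pd_nth: "pd i (\<lambda>z. z $ j) z = (if i = j then 1 else 0)"
  by (simp add: cder_pd[OF cder_nth] axis_def)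

lemma pd_cmult: "holo S f \<Longrightarrow> z \<in> S \<Longrightarrow> pd i (\<lambda>z. c * f z) z = c * pd i f z"
  for f :: "complex^'i::finite \<Rightarrow> complex"
  by (simp add: pd_mult[OF holo_const])

lemma pd_sum:
  fixes f :: "'a \<Rightarrow> complex^'i::finite \<Rightarrow> complex"
  assumes "\<And>a. a \<in> A \<Longrightarrow> holo S (f a)" "z \<in> S"
  shows "pd i (\<lambda>z. \<Sum>a\<in>A. f a z) z = (\<Sum>a\<in>A. pd i (f a) z)"
  using assms(1)
proof (induction A rule: infinite_finite_induct)
  case (insert a A)
  then show ?case
    using assms(2) by (simp add: pd_add[of S "f a" "\<lambda>z. \<Sum>a\<in>A. f a z"] holo_sum)
qed auto

lemma holo_pd_funpow:
  fixes f :: "complex^'i::finite \<Rightarrow> complex"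
  assumes "open S" "holo S f"
  shows "holo S ((pd i ^^ n) f)"
  by (induction n) (simp_all add: assms holo_pd)

lemma pd_funpow_cong:
  fixes f :: "complex^'i::finite \<Rightarrow> complex"
  assumes "open S" "\<And>z. z \<in> S \<Longrightarrow> f z = g z" "z \<in> S"
  shows "(pd i ^^ n) f z = (pd i ^^ n) g z"
  using assms(3)
proof (induction n arbitrary: z)
  case (Suc n)
  then show ?case
    using pd_cong_open[OF assms(1), of z "(pd i ^^ n) f" "(pd i ^^ n) g" i] by simp
qed (simp add: assms)

lemma pd_funpow_commute:
  fixes f :: "complex^'i::finite \<Rightarrow> complex"
  assumes S: "open S" and f: "holo S f" and z: "z \<in> S"
  shows "pd i ((pd j ^^ n) f) z = (pd j ^^ n) (pd i f) z"
  using z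
proof (induction n arbitrary: z)
  case (Suc n)
  have "pd i ((pd j ^^ Suc n) f) z = pd j (pd i ((pd j ^^ n) f)) z"
    using pd_commute[OF S holo_pd_funpow[OF S f]] Suc.prems by simp
  also have "\<dots> = pd j ((pd j ^^ n) (pd i f)) z"
    by (rule pd_cong_open[OF S Suc.prems Suc.IH])
  finally show ?case by simp
qed simp

text \<open>The map \<open>e\<close> assigns a coordinate to each variable of the symbol: it is
  \<open>id\<close> for the matrix coordinates alone, and \<open>Some\<close> when a time coordinate
  is adjoined in which the operator does not differentiate.\<close>

definition pdf :: "('x \<Rightarrow> 'i) \<Rightarrow> 'x list \<Rightarrow> ('x \<Rightarrow>\<^sub>0 nat) \<Rightarrow>
    (complex^'i \<Rightarrow> complex) \<Rightarrow> complex^'i \<Rightarrow> complex" where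
  "pdf e xs m = foldr (\<lambda>x. pd (e x) ^^ lookup m x) xs"

lemma pdf_Nil [simp]: "pdf e [] m F = F"
  and pdf_Cons [simp]: "pdf e (x # xs) m F = (pd (e x) ^^ lookup m x) (pdf e xs m F)"
  by (simp_all add: pdf_def)

lemma holo_pdf:
  fixes F :: "complex^'i::finite \<Rightarrow> complex"
  assumes "open S" "holo S F"
  shows "holo S (pdf e xs m F)"
  by (induction xs) (simp_all add: assms holo_pd_funpow)

lemma pdf_cong:
  fixes F :: "complex^'i::finite \<Rightarrow> complex"
  assumes S: "open S" and eq: "\<And>z. z \<in> S \<Longrightarrow> F z = G z" and z: "z \<in> S"
  shows "pdf e xs m F z = pdf e xs m G z"
  using z
proof (induction xs arbitrary: z)
  case (Cons x xs)
  then show ?case using pd_funpow_cong[OF S Cons.IH] by simp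
qed (simp add: eq)

text \<open>Raising an exponent inserts a derivative somewhere inside the composition; symmetry of
  mixed derivatives moves it to the front.\<close>

lemma pdf_add_single:
  fixes F :: "complex^'i::finite \<Rightarrow> complex"
  assumes S: "open S" and F: "holo S F" and "distinct xs" "z \<in> S"
  shows "pdf e xs (m + Poly_Mapping.single x 1) F z =
    (if x \<in> set xs then pd (e x) (pdf e xs m F) z else pdf e xs m F z)"
  using assms(3,4)
proof (induction xs arbitrary: z)
  case (Cons y ys)
  let ?m = "m + Poly_Mapping.single x (1::nat)"
  let ?G = "pdf e ys m F"
  have IH: "pdf e ys ?m F w = (if x \<in> set ys then pd (e x) ?G w else ?G w)" if "w \<in> S" for w
    using Cons that by simp
  have holoG: "holo S ?G" by (rule holo_pdf[OF S F])
  show ?case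
  proof (cases "y = x")
    case True
    then have x: "x \<notin> set ys" using Cons.prems by simp
    have "pdf e (y # ys) ?m F z = (pd (e x) ^^ Suc (lookup m x)) (pdf e ys ?m F) z"
      by (simp add: True lookup_add)
    also have "\<dots> = (pd (e x) ^^ Suc (lookup m x)) ?G z"
      by (rule pd_funpow_cong[OF S IH[unfolded if_not_P[OF x]] Cons.prems(2)])
    finally show ?thesis by (simp add: True)
  next
    case False
    have "pdf e (y # ys) ?m F z = (pd (e y) ^^ lookup m y) (pdf e ys ?m F) z"
      using False by (simp add: lookup_add lookup_single)
    also have "\<dots> = (pd (e y) ^^ lookup m y) (if x \<in> set ys then pd (e x) ?G else ?G) z"
      by (rule pd_funpow_cong[OF S]) (use IH Cons.prems in auto)
    also have "\<dots> = (if x \<in> set ys then pd (e x) ((pd (e y) ^^ lookup m y) ?G) z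
        else (pd (e y) ^^ lookup m y) ?G z)"
      using pd_funpow_commute[OF S holoG] Cons.prems by simp
    finally show ?thesis using False by simp
  qed
qed simp

section \<open>The operator attached to a polynomial symbol\<close>

definition pdl :: "('x \<Rightarrow> 'i) \<Rightarrow> 'x cpoly \<Rightarrow> (complex^'i \<Rightarrow> complex) \<Rightarrow> complex^'i \<Rightarrow> complex" where
  "pdl e Q F z = (\<Sum>m\<in>keys Q. lookup Q m * pdf e (SOME xs. distinct xs \<and> set xs = UNIV) m F z)"

lemma distinct_enumeration:
  "distinct (SOME xs. distinct xs \<and> set xs = (UNIV :: 'x::finite set)) \<and>
   set (SOME xs. distinct xs \<and> set xs = (UNIV :: 'x set)) = UNIV"
proof (rule someI_ex)
  show "\<exists>xs. distinct xs \<and> set xs = (UNIV :: 'x set)"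
    using finite_distinct_list[of "UNIV :: 'x set"] by auto
qed

lemma pdf_zero: "pdf e xs 0 F = F"
  by (induction xs) simp_all

lemma pdl_const: "pdl e (poly_const c) F z = c * F z"
  by (simp add: pdl_def poly_const_def pdf_zero)

lemma pdl_add: "pdl e (P + Q) F z = pdl e P F z + pdl e Q F z"
  unfolding pdl_def by (rule sum_keys_add) auto

lemma pdl_0: "pdl e 0 F z = 0"
  by (simp add: pdl_def)

lemma pdl_sum: "pdl e (sum g A) F z = (\<Sum>a\<in>A. pdl e (g a) F z)"
  by (induction A rule: infinite_finite_induct) (simp_all add: pdl_0 pdl_add)

lemma pdl_cong:
  fixes F :: "complex^'i::finite \<Rightarrow> complex"
  assumes "open S" "\<And>z. z \<in> S \<Longrightarrow> F z = G z" "z \<in> S"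
  shows "pdl e Q F z = pdl e Q G z"
proof -
  have "pdf e xs m F z = pdf e xs m G z" for xs m
    by (rule pdf_cong[OF assms])
  then show ?thesis by (simp only: pdl_def)
qed

context
  fixes S :: "(complex^'i::finite) set" and e :: "'x::finite \<Rightarrow> 'i"
  assumes S: "open S"
begin

lemma holo_pdl: "holo S F \<Longrightarrow> holo S (pdl e Q F)"
  unfolding pdl_def[abs_def] by (intro holo_sum holo_mult holo_const holo_pdf S)

text \<open>With \<open>pdl_const\<close> and \<open>pdl_add\<close> this describes
  \<open>pdl\<close> recursively, so that the inductions over symbols never meet the chosen
  enumeration of the variables.\<close>

lemma pdl_var_mult:
  assumes F: "holo S F" and z: "z \<in> S"
  shows "pdl e (poly_var x * P) F z = pd (e x) (pdl e P F) z"
proof -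
  let ?xs = "SOME xs. distinct xs \<and> set xs = (UNIV :: 'x set)"
  have "pdl e (poly_var x * P) F z = (\<Sum>m\<in>keys P. lookup P m * pd (e x) (pdf e ?xs m F) z)"
    unfolding pdl_def
    by (rule sum_var_mult) (subst pdf_add_single[OF S F _ z], use distinct_enumeration in auto)
  also have "\<dots> = pd (e x) (pdl e P F) z"
    unfolding pdl_def[abs_def]
    by (subst pd_sum[OF _ z])
      (auto intro!: sum.cong holo_mult holo_const holo_pdf S F simp: pd_cmult[OF holo_pdf[OF S F] z])
  finally show ?thesis .
qed

lemma pdl_const_mult:
  assumes F: "holo S F"
  shows "z \<in> S \<Longrightarrow> pdl e (poly_const c * P) F z = c * pdl e P F z"
proof (induction P arbitrary: z rule: cpoly_induct)
  case (const d)
  then show ?case by (simp add: pdl_const flip: poly_const_mult)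
next
  case (add p q)
  then show ?case by (simp add: pdl_add distrib_left)
next
  case (var x p)
  have "poly_const c * (poly_var x * p) = poly_var x * (poly_const c * p)"
    by (rule mult.left_commute)
  then have "pdl e (poly_const c * (poly_var x * p)) F z = pd (e x) (pdl e (poly_const c * p) F) z"
    by (simp only: pdl_var_mult[OF F var.prems])
  also have "\<dots> = pd (e x) (\<lambda>z. c * pdl e p F z) z"
    by (rule pd_cong_open[OF S var.prems var.IH])
  also have "\<dots> = c * pd (e x) (pdl e p F) z"
    by (rule pd_cmult[OF holo_pdl[OF F] var.prems])
  finally show ?case by (simp only: pdl_var_mult[OF F var.prems])
qed

lemma pdl_pd:
  assumes F: "holo S F"
  shows "z \<in> S \<Longrightarrow> pdl e Q (pd i F) z = pd i (pdl e Q F) z"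
proof (induction Q arbitrary: z rule: cpoly_induct)
  case (const d)
  then show ?case using pd_cmult[OF F] by (simp add: pdl_const pdl_const[abs_def])
next
  case (add p q)
  then show ?case
    by (simp add: pdl_add pdl_add[abs_def] pd_add[OF holo_pdl[OF F] holo_pdl[OF F]])
next
  case (var x p)
  have "pdl e (poly_var x * p) (pd i F) z = pd (e x) (pdl e p (pd i F)) z"
    by (rule pdl_var_mult[OF holo_pd[OF S F] var.prems])
  also have "\<dots> = pd (e x) (pd i (pdl e p F)) z"
    by (rule pd_cong_open[OF S var.prems var.IH])
  also have "\<dots> = pd i (pd (e x) (pdl e p F)) z"
    by (rule pd_commute[OF S holo_pdl[OF F] var.prems])
  also have "\<dots> = pd i (pdl e (poly_var x * p) F) z"
    by (rule pd_cong_open[OF S var.prems]) (simp only: pdl_var_mult[OF F])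
  finally show ?case .
qed

lemma pdl_fun_add:
  assumes F: "holo S F" and G: "holo S G"
  shows "z \<in> S \<Longrightarrow> pdl e Q (\<lambda>z. F z + G z) z = pdl e Q F z + pdl e Q G z"
proof (induction Q arbitrary: z rule: cpoly_induct)
  case (const d)
  then show ?case by (simp add: pdl_const distrib_left)
next
  case (add p q)
  then show ?case by (simp add: pdl_add)
next
  case (var x p)
  have "pd (e x) (pdl e p (\<lambda>z. F z + G z)) z = pd (e x) (\<lambda>z. pdl e p F z + pdl e p G z) z"
    by (rule pd_cong_open[OF S var.prems var.IH])
  also have "\<dots> = pd (e x) (pdl e p F) z + pd (e x) (pdl e p G) z"
    by (rule pd_add[OF holo_pdl[OF F] holo_pdl[OF G] var.prems])
  finally show ?case
    by (simp only: pdl_var_mult[OF F var.prems] pdl_var_mult[OF G var.prems]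
        pdl_var_mult[OF holo_add[OF F G] var.prems])
qed

lemma pdl_fun_cmult:
  assumes F: "holo S F"
  shows "z \<in> S \<Longrightarrow> pdl e Q (\<lambda>z. c * F z) z = c * pdl e Q F z"
proof (induction Q arbitrary: z rule: cpoly_induct)
  case (const d)
  then show ?case by (simp add: pdl_const)
next
  case (add p q)
  then show ?case by (simp add: pdl_add distrib_left)
next
  case (var x p)
  have "pd (e x) (pdl e p (\<lambda>z. c * F z)) z = pd (e x) (\<lambda>z. c * pdl e p F z) z"
    by (rule pd_cong_open[OF S var.prems var.IH])
  also have "\<dots> = c * pd (e x) (pdl e p F) z"
    by (rule pd_cmult[OF holo_pdl[OF F] var.prems])
  finally show ?case
    by (simp only: pdl_var_mult[OF F var.prems] pdl_var_mult[OF holo_mult[OF holo_const F] var.prems])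
qed

lemma pdl_fun_zero: "z \<in> S \<Longrightarrow> pdl e Q (\<lambda>z. 0) z = 0"
  using pdl_fun_cmult[OF holo_const, of z Q 0 0] by simp

lemma pdl_fun_sum:
  assumes F: "\<And>a. a \<in> A \<Longrightarrow> holo S (F a)" and z: "z \<in> S"
  shows "pdl e Q (\<lambda>z. \<Sum>a\<in>A. F a z) z = (\<Sum>a\<in>A. pdl e Q (F a) z)"
  using F
proof (induction A rule: infinite_finite_induct)
  case (insert a A)
  then show ?case
    using z by (simp add: pdl_fun_add[of "F a" "\<lambda>z. \<Sum>a\<in>A. F a z"] holo_sum)
qed (simp_all add: pdl_fun_zero[OF z])

text \<open>The Heisenberg commutation relation: the commutator with multiplication by a coordinate
  is the operator of the formal derivative of the symbol. Where the coordinate vanishes,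
  multiplication by it therefore acts on symbols as differentiation. Injectivity of \<open>e\<close>
  keeps two variables from sharing the coordinate.\<close>

lemma pdl_coordinate_mult:
  assumes F: "holo S F" and e: "inj e"
  shows "z \<in> S \<Longrightarrow> pdl e Q (\<lambda>z. z $ e i * F z) z = z $ e i * pdl e Q F z + pdl e (poly_partial i Q) F z"
proof (induction Q arbitrary: z rule: cpoly_induct)
  case (const d)
  then show ?case by (simp add: pdl_const partial_const pdl_0)
next
  case (add p q)
  then show ?case by (simp add: pdl_add partial_add distrib_left)
next
  case (var x p)
  let ?P = "pdl e p F"
  have "pdl e (poly_var x * p) (\<lambda>z. z $ e i * F z) z = pd (e x) (pdl e p (\<lambda>z. z $ e i * F z)) z"
    by (rule pdl_var_mult[OF holo_mult[OF holo_nth F] var.prems])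
  also have "\<dots> = pd (e x) (\<lambda>z. z $ e i * ?P z + pdl e (poly_partial i p) F z) z"
    by (rule pd_cong_open[OF S var.prems var.IH])
  also have "\<dots> = z $ e i * pd (e x) ?P z + (if i = x then ?P z else 0)
      + pd (e x) (pdl e (poly_partial i p) F) z"
    using var.prems inj_eq[OF e]
    by (simp add: pd_add[OF holo_mult[OF holo_nth holo_pdl[OF F]] holo_pdl[OF F]]
        pd_mult[OF holo_nth holo_pdl[OF F]] pd_nth)
  also have "\<dots> = z $ e i * pdl e (poly_var x * p) F z + pdl e (poly_partial i (poly_var x * p)) F z"
    using var.prems by (simp add: partial_var_mult pdl_add pdl_var_mult[OF F] pdl_0)
  finally show ?case .
qed

end

section \<open>Affine changes of variables\<close>

lemma pd_affine:
  fixes g :: "complex^'j::finite \<Rightarrow> complex" and y :: "complex^'j"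
    and A :: "'j \<Rightarrow> 'i::finite \<Rightarrow> complex"
  defines "l \<equiv> \<lambda>w::complex^'i. \<chi> j. y $ j + (\<Sum>i\<in>UNIV. A j i * w $ i)"
  assumes g: "holo T g" and w: "l w \<in> T"
  shows "pd i (\<lambda>w. g (l w)) w = (\<Sum>j\<in>UNIV. A j i * pd j g (l w))"
proof -
  have l: "cder (\<lambda>w. l w $ j) (\<lambda>u. 0 + (\<Sum>i\<in>UNIV. A j i * u $ i + 0 * w $ i)) w" for j
    unfolding l_def vec_lambda_beta by (intro cder_add cder_sum cder_mult cder_const cder_nth)
  have A: "(\<Sum>i'\<in>UNIV. A j i' * axis i 1 $ i' + 0 * w $ i') = A j i" for j
  proof -
    have "(\<Sum>i'\<in>UNIV. A j i' * axis i 1 $ i' + 0 * w $ i') = (\<Sum>i'\<in>UNIV. if i' = i then A j i' else 0)"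
      by (intro sum.cong) (auto simp: axis_def)
    then show ?thesis by simp
  qed
  have "pd i (\<lambda>w. g (l w)) w =
      (\<Sum>j\<in>UNIV. (\<chi> j. 0 + (\<Sum>i'\<in>UNIV. A j i' * axis i 1 $ i' + 0 * w $ i')) $ j * pd j g (l w))"
    by (rule cder_pd[OF cder_compose[OF holo_cderI[OF g w] l]])
  then show ?thesis unfolding A by simp
qed

lemma open_affine_vimage:
  fixes A :: "'j::finite \<Rightarrow> 'i::finite \<Rightarrow> complex" and y :: "complex^'j"
  assumes "open T"
  shows "open {w. (\<chi> j. y $ j + (\<Sum>i\<in>UNIV. A j i * w $ i)) \<in> T}"
proof -
  have "continuous_on UNIV (\<lambda>w::complex^'i. (\<chi> j. y $ j + (\<Sum>i\<in>UNIV. A j i * w $ i)) :: complex^'j)"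
    by (intro continuous_intros continuous_on_vec_lambda)
  from open_vimage[OF assms this] show ?thesis by (simp add: vimage_def)
qed

lemma holo_affine:
  fixes g :: "complex^'j::finite \<Rightarrow> complex" and y :: "complex^'j"
    and A :: "'j \<Rightarrow> 'i::finite \<Rightarrow> complex"
  defines "l \<equiv> \<lambda>w::complex^'i. \<chi> j. y $ j + (\<Sum>i\<in>UNIV. A j i * w $ i)"
  assumes g: "holo T g"
  shows "holo {w. l w \<in> T} (\<lambda>w. g (l w))"
  by (rule holo_compose[OF g])
    (auto simp: l_def intro!: holo_add holo_const holo_sum holo_mult holo_nth)

text \<open>By the chain rule a linear map of the points acts on symbols through its transpose, and
  the translation part leaves the symbol alone.\<close>

lemma pdl_affine:
  fixes g :: "complex^'x::finite \<Rightarrow> complex" and y :: "complex^'x"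
    and A :: "'x \<Rightarrow> 'x \<Rightarrow> complex"
  defines "l \<equiv> \<lambda>w::complex^'x. \<chi> j. y $ j + (\<Sum>i\<in>UNIV. A j i * w $ i)"
  assumes T: "open T" and g: "holo T g"
  shows "l w \<in> T \<Longrightarrow> pdl id Q (\<lambda>w. g (l w)) w =
    pdl id (psubst (\<lambda>i. \<Sum>j\<in>UNIV. poly_const (A j i) * poly_var j) Q) g (l w)"
proof (induction Q arbitrary: w rule: cpoly_induct)
  case (const d)
  then show ?case by (simp add: psubst_const pdl_const)
next
  case (add p q)
  then show ?case by (simp add: pdl_add psubst_add)
next
  case (var x p)
  let ?s = "psubst (\<lambda>i. \<Sum>j\<in>UNIV. poly_const (A j i) * poly_var j)"
  let ?S = "{w. l w \<in> T}"
  have S: "open ?S" unfolding l_def by (rule open_affine_vimage[OF T])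
  have holoS: "holo ?S (\<lambda>w. g (l w))"
    unfolding l_def by (rule holo_affine[OF g])
  have w: "w \<in> ?S" using var.prems by simp
  have "pdl id (poly_var x * p) (\<lambda>w. g (l w)) w = pd x (pdl id p (\<lambda>w. g (l w))) w"
    using pdl_var_mult[OF S holoS w, of id x p] by simp
  also have "\<dots> = pd x (\<lambda>w. pdl id (?s p) g (l w)) w"
    by (rule pd_cong_open[OF S w]) (rule var.IH, simp)
  also have "\<dots> = (\<Sum>j\<in>UNIV. A j x * pd j (pdl id (?s p) g) (l w))"
    using pd_affine[where y = y and A = A and w = w and i = x,
        OF holo_pdl[OF T g, of id "?s p"]] var.prems
    unfolding l_def by simp
  also have "\<dots> = (\<Sum>j\<in>UNIV. pdl id (poly_const (A j x) * (poly_var j * ?s p)) g (l w))"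
    using pdl_const_mult[OF T g var.prems, of id] pdl_var_mult[OF T g var.prems, of id] by simp
  also have "\<dots> = pdl id (?s (poly_var x * p)) g (l w)"
    by (simp only: poly_subst_var_mult sum_distrib_right pdl_sum mult.assoc)
  finally show ?case .
qed

text \<open>Time is adjoined as the coordinate \<open>None\<close>, so that a flow is a single
  holomorphic function of time and position; \<open>slice\<close> freezes the time.\<close>

definition slice :: "complex \<Rightarrow> complex^'x \<Rightarrow> complex^('x option)" where
  "slice t w = (\<chi> i. case i of None \<Rightarrow> t | Some x \<Rightarrow> w $ x)"

lemma slice_nth [simp]: "slice t w $ None = t" "slice t w $ Some x = w $ x"
  by (simp_all add: slice_def)

lemma slice_add_axis:
  "slice t w + axis (Some x) h = slice t (w + axis x h)"
  "slice t w + axis None h = slice (t + h) w"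
  by (auto simp: vec_eq_iff slice_def axis_def split: option.split)

lemma pd_slice: "(\<lambda>w. pd (Some x) F (slice t w)) = pd x (\<lambda>w. F (slice t w))"
  by (simp add: pd_def fun_eq_iff slice_add_axis)

lemma pdf_slice: "(\<lambda>w. pdf Some xs m F (slice t w)) = pdf id xs m (\<lambda>w. F (slice t w))"
proof (induction xs)
  case (Cons x xs)
  have "(\<lambda>w. (pd (Some x) ^^ n) G (slice t w)) = (pd x ^^ n) (\<lambda>w. G (slice t w))" for n G
    by (induction n) (simp_all add: pd_slice)
  with Cons show ?case by simp
qed simp

lemma pdl_slice: "pdl Some Q F (slice t w) = pdl id Q (\<lambda>w. F (slice t w)) w"
  unfolding pdl_def pdf_slice[symmetric] ..

section \<open>Pluriharmonic polynomials and the special conformal flow\<close>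

lemma poly_const_of_nat: "poly_const (of_nat i) = of_nat i"
  by (induction i) (simp_all add: poly_const_0 poly_const_1 poly_const_add)

text \<open>This is the pluriharmonicity operator for row \<open>s\<close> of \<open>X\<close> and
  row \<open>t\<close> of \<open>Y\<close>, rewritten in the entries of the products
  \<open>X\<^sub>j Y\<^sub>j\<^sup>t\<close>; see \<open>subst_XY_Lap\<close>.\<close>

definition Lap :: "('r::finite \<Rightarrow> nat) \<Rightarrow> 'n::finite \<Rightarrow> 'n \<Rightarrow> ('r \<times> 'n \<times> 'n) cpoly \<Rightarrow> ('r \<times> 'n \<times> 'n) cpoly" where
  "Lap k s t Q = (\<Sum>j\<in>UNIV. poly_const (of_nat (k j)) * poly_partial (j, s, t) Q +
     (\<Sum>a\<in>UNIV. \<Sum>b\<in>UNIV. poly_var (j, a, b) * poly_partial (j, s, b) (poly_partial (j, a, t) Q)))"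

definition XY_entry :: "('r \<Rightarrow> nat) \<Rightarrow> 'r \<times> 'n \<times> 'n \<Rightarrow> ('n, 'r) xy_var cpoly" where
  "XY_entry k = (\<lambda>(j, s, t). \<Sum>u<k j. poly_var (XVar s j u) * poly_var (YVar t j u))"

lemma subst_XY_eq: "subst_XY k Q = psubst (XY_entry k) Q"
  by (simp add: subst_XY_def XY_entry_def)

lemma partial_YVar_subst:
  fixes P :: "('r::finite \<times> 'n::finite \<times> 'n) cpoly"
  assumes "u < k j"
  shows "poly_partial (YVar t j u) (psubst (XY_entry k) P) =
    (\<Sum>a\<in>UNIV. psubst (XY_entry k) (poly_partial (j, a, t) P) * poly_var (XVar a j u))"
proof -
  have entry: "poly_partial (YVar t j u) (XY_entry k x) =
      (if fst x = j \<and> snd (snd x) = t then poly_var (XVar (fst (snd x)) j u) else 0)" for x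
  proof -
    obtain i s' t' where x: "x = (i, s', t')" by (cases x) auto
    have "poly_partial (YVar t j u) (XY_entry k x) =
       (\<Sum>u'<k i. if i = j \<and> t' = t \<and> u' = u then poly_var (XVar s' j u) else 0)"
      unfolding x XY_entry_def prod.case partial_sum partial_mult
      by (intro sum.cong) (auto simp: partial_var)
    also have "\<dots> = (if i = j \<and> t' = t then poly_var (XVar s' j u) else 0)"
      using assms by (auto simp: sum.delta)
    finally show ?thesis by (simp add: x)
  qed
  have "poly_partial (YVar t j u) (psubst (XY_entry k) P) =
    (\<Sum>x\<in>UNIV. psubst (XY_entry k) (poly_partial x P) *
      (if fst x = j \<and> snd (snd x) = t then poly_var (XVar (fst (snd x)) j u) else 0))"
    by (simp only: partial_psubst entry)
  also have "\<dots> = (\<Sum>x\<in>range (\<lambda>a. (j, a, t)). psubst (XY_entry k) (poly_partial x P) *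
      (if fst x = j \<and> snd (snd x) = t then poly_var (XVar (fst (snd x)) j u) else 0))"
    by (rule sum.mono_neutral_right) auto
  also have "\<dots> = (\<Sum>a\<in>UNIV. psubst (XY_entry k) (poly_partial (j, a, t) P) * poly_var (XVar a j u))"
    by (subst sum.reindex) (auto simp: inj_on_def)
  finally show ?thesis .
qed

lemma partial_XVar_subst:
  fixes P :: "('r::finite \<times> 'n::finite \<times> 'n) cpoly"
  assumes "u < k j"
  shows "poly_partial (XVar s j u) (psubst (XY_entry k) P) =
    (\<Sum>b\<in>UNIV. psubst (XY_entry k) (poly_partial (j, s, b) P) * poly_var (YVar b j u))"
proof -
  have entry: "poly_partial (XVar s j u) (XY_entry k x) =
      (if fst x = j \<and> fst (snd x) = s then poly_var (YVar (snd (snd x)) j u) else 0)" for x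
  proof -
    obtain i s' t' where x: "x = (i, s', t')" by (cases x) auto
    have "poly_partial (XVar s j u) (XY_entry k x) =
       (\<Sum>u'<k i. if i = j \<and> s' = s \<and> u' = u then poly_var (YVar t' j u) else 0)"
      unfolding x XY_entry_def prod.case partial_sum partial_mult
      by (intro sum.cong) (auto simp: partial_var)
    also have "\<dots> = (if i = j \<and> s' = s then poly_var (YVar t' j u) else 0)"
      using assms by (auto simp: sum.delta)
    finally show ?thesis by (simp add: x)
  qed
  have "poly_partial (XVar s j u) (psubst (XY_entry k) P) =
    (\<Sum>x\<in>UNIV. psubst (XY_entry k) (poly_partial x P) *
      (if fst x = j \<and> fst (snd x) = s then poly_var (YVar (snd (snd x)) j u) else 0))"
    by (simp only: partial_psubst entry)
  also have "\<dots> = (\<Sum>x\<in>range (\<lambda>b. (j, s, b)). psubst (XY_entry k) (poly_partial x P) *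
      (if fst x = j \<and> fst (snd x) = s then poly_var (YVar (snd (snd x)) j u) else 0))"
    by (rule sum.mono_neutral_right) auto
  also have "\<dots> = (\<Sum>b\<in>UNIV. psubst (XY_entry k) (poly_partial (j, s, b) P) * poly_var (YVar b j u))"
    by (subst sum.reindex) (auto simp: inj_on_def)
  finally show ?thesis .
qed

lemma subst_XY_Lap:
  fixes Q :: "('r::finite \<times> 'n::finite \<times> 'n) cpoly"
  shows "(\<Sum>j\<in>UNIV. \<Sum>u<k j. poly_partial (XVar s j u) (poly_partial (YVar t j u) (psubst (XY_entry k) Q))) =
    psubst (XY_entry k) (Lap k s t Q)"
proof -
  let ?f = "psubst (XY_entry k)"
  have "(\<Sum>u<k j. poly_partial (XVar s j u) (poly_partial (YVar t j u) (?f Q))) =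
     ?f (poly_const (of_nat (k j)) * poly_partial (j, s, t) Q +
     (\<Sum>a\<in>UNIV. \<Sum>b\<in>UNIV. poly_var (j, a, b) * poly_partial (j, s, b) (poly_partial (j, a, t) Q)))"
    for j
  proof -
    have "(\<Sum>u<k j. poly_partial (XVar s j u) (poly_partial (YVar t j u) (?f Q))) =
      (\<Sum>u<k j. ?f (poly_partial (j, s, t) Q) +
        (\<Sum>a\<in>UNIV. \<Sum>b\<in>UNIV. (poly_var (XVar a j u) * poly_var (YVar b j u)) *
           ?f (poly_partial (j, s, b) (poly_partial (j, a, t) Q))))"
    proof (intro sum.cong refl)
      fix u assume "u \<in> {..<k j}"
      then have u: "u < k j" by simp
      \<comment> \<open>The derivative in \<open>Y\<close> produces a factor
        \<open>XVar a j u\<close> by the chain rule. For \<open>a = s\<close> the derivative in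
        \<open>X\<close> also hits this factor, which gives the first order term once for each
        \<open>u\<close> and hence the coefficient \<open>k j\<close>.\<close>
      have "poly_partial (XVar s j u) (poly_partial (YVar t j u) (?f Q)) =
        (\<Sum>a\<in>UNIV. (\<Sum>b\<in>UNIV. (poly_var (XVar a j u) * poly_var (YVar b j u)) *
           ?f (poly_partial (j, s, b) (poly_partial (j, a, t) Q))) +
           (if a = s then ?f (poly_partial (j, a, t) Q) else 0))"
        unfolding partial_YVar_subst[of u k j t, OF u] partial_sum partial_mult
          partial_XVar_subst[of u k j s, OF u]
        by (intro sum.cong arg_cong2[of _ _ _ _ "(+)"])
          (auto simp: partial_var sum_distrib_right sum_distrib_left mult_ac)
      then show "poly_partial (XVar s j u) (poly_partial (YVar t j u) (?f Q)) =
        ?f (poly_partial (j, s, t) Q) +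
        (\<Sum>a\<in>UNIV. \<Sum>b\<in>UNIV. (poly_var (XVar a j u) * poly_var (YVar b j u)) *
           ?f (poly_partial (j, s, b) (poly_partial (j, a, t) Q)))"
        by (simp add: sum.distrib add.commute)
    qed
    also have "\<dots> = of_nat (k j) * ?f (poly_partial (j, s, t) Q) +
       (\<Sum>a\<in>UNIV. \<Sum>b\<in>UNIV. (\<Sum>u<k j. poly_var (XVar a j u) * poly_var (YVar b j u)) *
           ?f (poly_partial (j, s, b) (poly_partial (j, a, t) Q)))"
      unfolding sum.distrib sum_distrib_right
      by (subst sum.swap, subst (2) sum.swap) simp
    also have "of_nat (k j) = (?f (poly_const (of_nat (k j))))"
      by (simp only: psubst_const) (simp only: poly_const_of_nat)
    finally show ?thesis
      by (simp only: psubst_add psubst_sum psubst_mult psubst_var) (simp only: XY_entry_def prod.case)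
  qed
  then show ?thesis by (simp only: Lap_def psubst_sum)
qed

text \<open>Since \<open>k j \<ge> n\<close>, every matrix \<open>R\<^sub>j\<close> is of the form \<open>X\<^sub>j Y\<^sub>j\<^sup>t\<close>, namely with \<open>Y\<^sub>j\<close> a truncated
  identity matrix; so no information is lost by the substitution.\<close>

lemma subst_XY_inject:
  fixes P :: "('r::finite \<times> 'n::finite \<times> 'n) cpoly"
  assumes k: "\<And>j. CARD('n) \<le> k j" and P: "psubst (XY_entry k) P = 0"
  shows "P = 0"
proof (rule poly_zeroI)
  fix R :: "'r \<times> 'n \<times> 'n \<Rightarrow> complex"
  obtain idx :: "'n \<Rightarrow> nat" where "bij_betw idx UNIV {0..<CARD('n)}"
    using ex_bij_betw_finite_nat[of "UNIV :: 'n set"] by auto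
  then have inj: "inj idx" and less: "idx s < CARD('n)" for s
    by (auto simp: bij_betw_def)
  define g :: "('n, 'r) xy_var \<Rightarrow> complex" where
    "g = (\<lambda>x. case x of XVar s j u \<Rightarrow> R (j, s, inv_into UNIV idx u) | YVar t j u \<Rightarrow> if u = idx t then 1 else 0)"
  have "ev g (XY_entry k x) = R x" for x
  proof -
    obtain j s t where x: "x = (j, s, t)" by (cases x) auto
    have "ev g (XY_entry k x) = (\<Sum>u<k j. if u = idx t then R (j, s, inv_into UNIV idx u) else 0)"
      unfolding x XY_entry_def prod.case ev_sum by (intro sum.cong) (auto simp: g_def)
    also have "\<dots> = R x"
      using less[of t] k[of j] inj by (simp add: x sum.delta)
    finally show ?thesis .
  qed
  then have "ev R P = ev g (psubst (XY_entry k) P)"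
    by (simp add: ev_psubst)
  then show "ev R P = 0" by (simp add: P)
qed

lemma Lap_H_space:
  assumes "\<And>j. CARD('n) \<le> k j" and "Q \<in> H_space v k"
  shows "Lap k s t (Q :: ('r::finite \<times> 'n::finite \<times> 'n) cpoly) = 0"
  using assms by (intro subst_XY_inject[where k = k])
    (simp_all add: H_space_def pluriharmonic_def subst_XY_eq flip: subst_XY_Lap)

text \<open>At vanishing matrix coordinates each coordinate factor becomes a formal derivative of
  the symbol (\<open>pdl_coordinate_mult\<close>), and each partial derivative becomes a variable
  (\<open>pdl_pd\<close>, \<open>pdl_var_mult\<close>). This Fourier-type duality carries the
  generator of the flow to \<open>Lap\<close>.\<close>

lemma pdl_Lap:
  fixes F :: "complex^('r::finite \<times> 'n::finite \<times> 'n) option \<Rightarrow> complex"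
  assumes S: "open S" and F: "holo S F" and z: "z \<in> S" and z0: "\<And>x. z $ Some x = 0"
  shows "pdl Some Q (\<lambda>v. \<Sum>j\<in>UNIV. v $ Some (j, a, b) * (of_nat (k j) * F v) +
      (\<Sum>q\<in>UNIV. \<Sum>p\<in>UNIV. v $ Some (j, q, b) * (v $ Some (j, a, p) * pd (Some (j, q, p)) F v))) z =
    pdl Some (Lap k a b Q) F z"
proof -
  note hp = holo_pd[OF S F]
  have coord: "pdl Some P (\<lambda>v. v $ Some x * G v) z = pdl Some (poly_partial x P) G z"
    if "holo S G" for P G x
    using pdl_coordinate_mult[OF S that, of Some z P x] z z0 by simp
  have 1: "pdl Some Q (\<lambda>v. v $ Some (j, a, b) * (of_nat (k j) * F v)) z =
      pdl Some (poly_const (of_nat (k j)) * poly_partial (j, a, b) Q) F z" for j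
    by (subst coord) (simp_all add: holo_mult holo_const F pdl_fun_cmult[OF S F z] pdl_const_mult[OF S F z])
  have 2: "pdl Some Q (\<lambda>v. v $ Some (j, q, b) * (v $ Some (j, a, p) * pd (Some (j, q, p)) F v)) z =
      pdl Some (poly_var (j, q, p) * poly_partial (j, a, p) (poly_partial (j, q, b) Q)) F z" for j q p
    by (simp add: coord holo_mult holo_nth hp pdl_pd[OF S F z] pdl_var_mult[OF S F z])
  show ?thesis
    unfolding Lap_def pdl_sum pdl_add 1[symmetric] 2[symmetric]
    by (subst pdl_fun_sum[OF S _ z] pdl_fun_add[OF S _ _ z],
      (intro holo_add holo_sum holo_mult holo_nth holo_const F hp)+)+ simp
qed

text \<open>The vector \<open>v\<close> consists of a time coordinate \<open>t\<close> and matrices \<open>Z\<^sub>j\<close>, the \<open>(p, q)\<close> entry of \<open>Z\<^sub>j\<close> being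
  the coordinate \<open>(j, q, p)\<close>. The flow is \<open>Z \<mapsto> Z (1 + t E Z)\<^sup>-\<^sup>1\<close> for the elementary matrix \<open>E\<close>
  with entry \<open>1\<close> in position \<open>(a, b)\<close>.\<close>

definition flow_den :: "'n \<Rightarrow> 'n \<Rightarrow> 'r \<Rightarrow> (complex, ('r::finite \<times> 'n::finite \<times> 'n) option) vec \<Rightarrow> complex" where
  "flow_den a b j v = 1 + v $ None * v $ Some (j, a, b)"

text \<open>As the elementary matrix \<open>E\<close> has rank one, the Sherman-Morrison formula
  inverts \<open>1 + t E Z\<close> with the single denominator \<open>flow_den\<close>, which is
  also its determinant.\<close>

definition flow :: "'n \<Rightarrow> 'n \<Rightarrow> (complex, ('r::finite \<times> 'n::finite \<times> 'n) option) vec \<Rightarrow> (complex, 'r::finite \<times> 'n::finite \<times> 'n) vec" where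
  "flow a b v = (\<chi> x. case x of (j, q, p) \<Rightarrow> v $ Some (j, q, p) -
     (v $ None * (v $ Some (j, a, p) * v $ Some (j, q, b))) * inverse (flow_den a b j v))"

definition flow_fun :: "('r::finite \<Rightarrow> nat) \<Rightarrow> 'n \<Rightarrow> 'n \<Rightarrow> ((complex, 'r::finite \<times> 'n::finite \<times> 'n) vec \<Rightarrow> complex) \<Rightarrow>
    (complex, ('r::finite \<times> 'n::finite \<times> 'n) option) vec \<Rightarrow> complex" where
  "flow_fun k a b f v = (\<Prod>j\<in>UNIV. inverse (flow_den a b j v) ^ k j) * f (flow a b v)"

text \<open>In matrix notation the field is \<open>(1, Z E Z)\<close>. For invertible
  \<open>Z\<close> the matrix \<open>Z\<^sup>-\<^sup>1 + t E\<close> is constant along it, hence so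
  is its inverse \<open>Z (1 + t E Z)\<^sup>-\<^sup>1\<close>, the value of
  \<open>flow\<close>.\<close>

definition flow_field :: "'n \<Rightarrow> 'n \<Rightarrow> (complex, ('r::finite \<times> 'n::finite \<times> 'n) option) vec \<Rightarrow> (complex, ('r::finite \<times> 'n::finite \<times> 'n) option) vec" where
  "flow_field a b v = (\<chi> i. case i of None \<Rightarrow> 1
     | Some (j, q, p) \<Rightarrow> v $ Some (j, q, b) * v $ Some (j, a, p))"

definition flow_dom :: "'n \<Rightarrow> 'n \<Rightarrow> (complex, 'r::finite \<times> 'n::finite \<times> 'n) vec set \<Rightarrow> (complex, ('r::finite \<times> 'n::finite \<times> 'n) option) vec set" where
  "flow_dom a b S = {v. (\<forall>j. flow_den a b j v \<noteq> 0) \<and> flow a b v \<in> S}"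

lemma sum_UNIV_triple:
  fixes g :: "'a::finite \<times> 'b::finite \<times> 'c::finite \<Rightarrow> 'd::comm_monoid_add"
  shows "(\<Sum>x\<in>UNIV. g x) = (\<Sum>i\<in>UNIV. \<Sum>j\<in>UNIV. \<Sum>l\<in>UNIV. g (i, j, l))"
  by (simp add: sum.cartesian_product split_def)

context
  fixes a b :: "'n::finite"
begin

lemma cder_flow_den:
  fixes v :: "(complex, ('r::finite \<times> 'n \<times> 'n) option) vec"
  obtains D where "cder (flow_den a b j) D v"
    and "D (flow_field a b v) = v $ Some (j, a, b) * flow_den a b j v"
proof
  show "cder (flow_den a b j)
     (\<lambda>w. 0 + (v $ None * w $ Some (j, a, b) + w $ None * v $ Some (j, a, b))) v"
    unfolding flow_den_def[abs_def] by (intro cder_add cder_const cder_mult cder_nth)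
qed (simp add: flow_field_def flow_den_def algebra_simps)

lemma cder_inverse_flow_den:
  fixes v :: "(complex, ('r::finite \<times> 'n \<times> 'n) option) vec"
  assumes v: "flow_den a b j v \<noteq> 0"
  obtains D where "cder (\<lambda>v. inverse (flow_den a b j v)) D v"
    and "D (flow_field a b v) = - v $ Some (j, a, b) * inverse (flow_den a b j v)"
proof -
  obtain D where D: "cder (flow_den a b j) D v"
    "D (flow_field a b v) = v $ Some (j, a, b) * flow_den a b j v"
    by (rule cder_flow_den)
  from cder_field_comp[OF D(1) DERIV_inverse[OF v]] show ?thesis
    by (rule that) (use v in \<open>simp add: D(2) power2_eq_square\<close>)
qed

lemma cder_flow:
  fixes v :: "(complex, ('r::finite \<times> 'n \<times> 'n) option) vec"
  assumes v: "\<And>j. flow_den a b j v \<noteq> 0"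
  obtains D where "cder (\<lambda>v. flow a b v $ x) D v" and "D (flow_field a b v) = 0"
proof -
  obtain j q p where x: "x = (j, q, p)" by (cases x) auto
  obtain D where D: "cder (\<lambda>v. inverse (flow_den a b j v)) D v"
    "D (flow_field a b v) = - v $ Some (j, a, b) * inverse (flow_den a b j v)"
    using v by (rule cder_inverse_flow_den)
  let ?D' = "\<lambda>w. w $ Some (j, q, p) -
    ((v $ None * (v $ Some (j, a, p) * v $ Some (j, q, b))) * D w +
     (v $ None * (v $ Some (j, a, p) * w $ Some (j, q, b) + w $ Some (j, a, p) * v $ Some (j, q, b)) +
      w $ None * (v $ Some (j, a, p) * v $ Some (j, q, b))) * inverse (flow_den a b j v))"
  have "cder (\<lambda>v. flow a b v $ x) ?D' v"
    unfolding flow_def x vec_lambda_beta prod.case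
    by (intro cder_diff cder_mult cder_nth D(1))
  moreover have "?D' (flow_field a b v) = 0"
  proof -
    have "y1 * y2 - (t * (y2 * y1) * (- y * inverse u) +
        (t * (y2 * (y1 * y) + (y * y2) * y1) + 1 * (y2 * y1)) * inverse u) = 0"
      if u: "u = 1 + t * y" "u \<noteq> 0" for y1 y2 y t u :: complex
    proof -
      have "t * (y2 * y1) * (- y * w) + (t * (y2 * (y1 * y) + (y * y2) * y1) + 1 * (y2 * y1)) * w =
          y1 * y2 * ((1 + t * y) * w)" for w
        by (simp add: algebra_simps)
      then show ?thesis using u by simp
    qed
    moreover have "flow_field a b v $ Some (j, q, p) = v $ Some (j, q, b) * v $ Some (j, a, p)"
      "flow_field a b v $ Some (j, q, b) = v $ Some (j, q, b) * v $ Some (j, a, b)"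
      "flow_field a b v $ Some (j, a, p) = v $ Some (j, a, b) * v $ Some (j, a, p)"
      "flow_field a b v $ None = 1"
      by (simp_all add: flow_field_def)
    ultimately show ?thesis
      using v unfolding D(2) flow_den_def by (simp only: not_False_eq_True)
  qed
  ultimately show ?thesis by (rule that)
qed

lemma cder_flow_factor:
  fixes v :: "(complex, ('r::finite \<times> 'n \<times> 'n) option) vec"
  assumes v: "\<And>j. flow_den a b j v \<noteq> 0"
  obtains D where "cder (\<lambda>v. \<Prod>j\<in>UNIV. inverse (flow_den a b j v) ^ k j) D v"
    and "D (flow_field a b v) =
      - (\<Sum>j\<in>UNIV. of_nat (k j) * v $ Some (j, a, b)) * (\<Prod>j\<in>UNIV. inverse (flow_den a b j v) ^ k j)"
proof -
  have pow: "\<exists>D. cder (\<lambda>v. inverse (flow_den a b j v) ^ n) D v \<and>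
    D (flow_field a b v) = - (of_nat n * v $ Some (j, a, b)) * inverse (flow_den a b j v) ^ n" for j n
  proof (induction n)
    case 0
    then show ?case using cder_const[of 1 v] by auto
  next
    case (Suc n)
    then obtain E where E: "cder (\<lambda>v. inverse (flow_den a b j v) ^ n) E v"
      "E (flow_field a b v) = - (of_nat n * v $ Some (j, a, b)) * inverse (flow_den a b j v) ^ n"
      by blast
    obtain D where D: "cder (\<lambda>v. inverse (flow_den a b j v)) D v"
      "D (flow_field a b v) = - v $ Some (j, a, b) * inverse (flow_den a b j v)"
      using v by (rule cder_inverse_flow_den)
    from cder_mult[OF D(1) E(1)] show ?case
      by (intro exI conjI) (simp, simp add: D(2) E(2) algebra_simps)
  qed
  have "\<exists>D. cder (\<lambda>v. \<Prod>j\<in>A. inverse (flow_den a b j v) ^ k j) D v \<and> D (flow_field a b v) =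
      - (\<Sum>j\<in>A. of_nat (k j) * v $ Some (j, a, b)) * (\<Prod>j\<in>A. inverse (flow_den a b j v) ^ k j)"
    if "finite A" for A
    using that
  proof (induction A rule: finite_induct)
    case empty
    then show ?case using cder_const[of 1 v] by auto
  next
    case (insert j A)
    then obtain E where E: "cder (\<lambda>v. \<Prod>j\<in>A. inverse (flow_den a b j v) ^ k j) E v"
      "E (flow_field a b v) = - (\<Sum>j\<in>A. of_nat (k j) * v $ Some (j, a, b)) *
        (\<Prod>j\<in>A. inverse (flow_den a b j v) ^ k j)"
      by blast
    obtain D where D: "cder (\<lambda>v. inverse (flow_den a b j v) ^ k j) D v"
      "D (flow_field a b v) = - (of_nat (k j) * v $ Some (j, a, b)) * inverse (flow_den a b j v) ^ k j"
      using pow by blast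
    from cder_mult[OF D(1) E(1)] insert.hyps show ?case
      by (intro exI conjI) (simp, simp add: D(2) E(2) algebra_simps)
  qed
  from this[of UNIV] that show ?thesis by auto
qed

lemma open_flow_dom:
  fixes S :: "(complex^('r::finite \<times> 'n \<times> 'n)) set"
  assumes S: "open S"
  shows "open (flow_dom a b S)"
proof -
  let ?U = "\<Inter>j. {v. flow_den a b j v \<noteq> 0}"
  have U: "open ?U"
    unfolding flow_den_def by (intro open_INT ballI open_Collect_neq continuous_intros) auto
  have "continuous_on ?U (flow a b)"
    unfolding flow_def
    by (intro continuous_on_vec_lambda)
      (auto intro!: continuous_intros simp: flow_den_def split: prod.split)
  then have "open (?U \<inter> flow a b -` S)"
    by (rule continuous_open_preimage[OF _ U S])
  also have "?U \<inter> flow a b -` S = flow_dom a b S"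
    by (auto simp: flow_dom_def)
  finally show ?thesis .
qed

text \<open>\<open>flow\<close> is constant along the field, so only the automorphy factor is
  differentiated, and its logarithmic derivative is linear in the coordinates.\<close>

lemma flow_pde:
  fixes f :: "complex^('r::finite \<times> 'n \<times> 'n) \<Rightarrow> complex"
  assumes f: "holo S f" and v: "v \<in> flow_dom a b S"
  obtains D where "cder (flow_fun k a b f) D v"
    and "D (flow_field a b v) = - (\<Sum>j\<in>UNIV. of_nat (k j) * v $ Some (j, a, b)) * flow_fun k a b f v"
proof -
  have den: "flow_den a b j v \<noteq> 0" for j using v by (simp add: flow_dom_def)
  obtain Df where Df: "cder f Df (flow a b v)"
    using f v by (auto simp: holo_def flow_dom_def)
  have "\<forall>x. \<exists>D. cder (\<lambda>v. flow a b v $ x) D v \<and> D (flow_field a b v) = 0"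
  proof
    fix x show "\<exists>D. cder (\<lambda>v. flow a b v $ x) D v \<and> D (flow_field a b v) = 0"
      by (rule cder_flow[OF den]) (intro exI conjI)
  qed
  from choice[OF this]
  obtain M where M: "\<And>x. cder (\<lambda>v. flow a b v $ x) (M x) v" "\<And>x. M x (flow_field a b v) = 0"
    by auto
  obtain E where E: "cder (\<lambda>v. \<Prod>j\<in>UNIV. inverse (flow_den a b j v) ^ k j) E v"
    "E (flow_field a b v) =
      - (\<Sum>j\<in>UNIV. of_nat (k j) * v $ Some (j, a, b)) * (\<Prod>j\<in>UNIV. inverse (flow_den a b j v) ^ k j)"
    by (rule cder_flow_factor[OF den])
  have "Df (\<chi> x. M x (flow_field a b v)) = 0"
    by (simp add: M(2) cder_eq[OF Df])
  then have "(\<Prod>j\<in>UNIV. inverse (flow_den a b j v) ^ k j) * Df (\<chi> x. M x (flow_field a b v)) +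
      E (flow_field a b v) * f (flow a b v) =
      - (\<Sum>j\<in>UNIV. of_nat (k j) * v $ Some (j, a, b)) * flow_fun k a b f v"
    unfolding E(2) flow_fun_def by (simp only: mult_zero_right add_0 mult.assoc)
  moreover have "cder (flow_fun k a b f) (\<lambda>w. (\<Prod>j\<in>UNIV. inverse (flow_den a b j v) ^ k j) * Df (\<chi> x. M x w)
      + E w * f (flow a b v)) v"
    unfolding flow_fun_def[abs_def] by (intro cder_mult E(1) cder_compose[OF Df M(1)])
  ultimately show ?thesis
    by (intro that)
qed

lemma holo_flow_fun:
  assumes "holo S f"
  shows "holo (flow_dom a b S) (flow_fun k a b f)"
  unfolding holo_def by (blast elim: flow_pde[OF assms])

text \<open>The transport equation is solved for the time derivative; what appears is minus the
  generator that \<open>pdl_Lap\<close> dualises.\<close>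

lemma flow_pde_explicit:
  fixes f :: "complex^('r::finite \<times> 'n \<times> 'n) \<Rightarrow> complex"
  assumes f: "holo S f" and v: "v \<in> flow_dom a b S"
  shows "pd None (flow_fun k a b f) v = (- 1) * (\<Sum>j\<in>UNIV. v $ Some (j, a, b) * (of_nat (k j) * flow_fun k a b f v) +
      (\<Sum>q\<in>UNIV. \<Sum>p\<in>UNIV. v $ Some (j, q, b) * (v $ Some (j, a, p) * pd (Some (j, q, p)) (flow_fun k a b f) v)))"
proof -
  let ?F = "flow_fun k a b f"
  obtain D where D: "cder ?F D v"
    "D (flow_field a b v) = - (\<Sum>j\<in>UNIV. of_nat (k j) * v $ Some (j, a, b)) * ?F v"
    by (rule flow_pde[OF assms])
  have "D (flow_field a b v) = pd None ?F v +
      (\<Sum>x\<in>UNIV. flow_field a b v $ Some x * pd (Some x) ?F v)"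
    by (simp add: cder_eq[OF D(1)] UNIV_option_conv sum.reindex flow_field_def)
  also have "(\<Sum>x\<in>UNIV. flow_field a b v $ Some x * pd (Some x) ?F v) =
      (\<Sum>j\<in>UNIV. \<Sum>q\<in>UNIV. \<Sum>p\<in>UNIV. v $ Some (j, q, b) * (v $ Some (j, a, p) * pd (Some (j, q, p)) ?F v))"
    unfolding sum_UNIV_triple by (simp add: flow_field_def mult.assoc)
  finally have "pd None ?F v = - (\<Sum>j\<in>UNIV. of_nat (k j) * v $ Some (j, a, b)) * ?F v -
      (\<Sum>j\<in>UNIV. \<Sum>q\<in>UNIV. \<Sum>p\<in>UNIV. v $ Some (j, q, b) * (v $ Some (j, a, p) * pd (Some (j, q, p)) ?F v))"
    unfolding D(2) by (simp only: eq_diff_eq)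
  moreover have "(\<Sum>j\<in>UNIV. of_nat (k j) * v $ Some (j, a, b)) * ?F v =
      (\<Sum>j\<in>UNIV. v $ Some (j, a, b) * (of_nat (k j) * ?F v))"
    unfolding sum_distrib_right by (simp only: mult.assoc mult.left_commute)
  ultimately show ?thesis
    by (simp add: sum.distrib)
qed

lemma flow_slice_0: "flow a b (slice t 0) = 0" "flow_den a b j (slice t 0) = 1"
  by (auto simp: flow_def flow_den_def vec_eq_iff)

lemma slice_0_in_flow_dom: "0 \<in> S \<Longrightarrow> slice t 0 \<in> flow_dom a b S"
  by (simp add: flow_dom_def flow_slice_0)

text \<open>Differentiation in time commutes with the operator of \<open>Q\<close>, and at the
  origin it dualises to \<open>Lap k a b Q\<close>, which vanishes; so the value is constant in
  time, and at time 0 the flow is the identity. The origin is fixed with denominator 1 at every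
  complex time, which is why \<open>c\<close> is arbitrary.\<close>

lemma pdl_flow:
  fixes f :: "complex^('r::finite \<times> 'n \<times> 'n) \<Rightarrow> complex"
  assumes S: "open S" "0 \<in> S" and f: "holo S f" and Lap: "Lap k a b Q = 0"
  shows "pdl id Q (\<lambda>w. flow_fun k a b f (slice c w)) 0 = pdl id Q f 0"
proof -
  let ?F = "flow_fun k a b f" and ?\<Omega> = "flow_dom a b S"
  have \<Omega>: "open ?\<Omega>" by (rule open_flow_dom[OF S(1)])
  have F: "holo ?\<Omega> ?F" by (rule holo_flow_fun[OF f])
  have in\<Omega>: "slice t 0 \<in> ?\<Omega>" for t by (rule slice_0_in_flow_dom[OF S(2)])
  define \<phi> where "\<phi> = (\<lambda>t. pdl Some Q ?F (slice t 0))"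
  have "(\<phi> has_field_derivative 0) (at t)" for t
  proof -
    let ?L = "\<lambda>v. \<Sum>j\<in>UNIV. v $ Some (j, a, b) * (of_nat (k j) * ?F v) +
      (\<Sum>q\<in>UNIV. \<Sum>p\<in>UNIV. v $ Some (j, q, b) * (v $ Some (j, a, p) * pd (Some (j, q, p)) ?F v))"
    have L: "holo ?\<Omega> ?L"
      by (intro holo_add holo_sum holo_mult holo_nth holo_const F holo_pd[OF \<Omega> F])
    have "pd None (pdl Some Q ?F) (slice t 0) = pdl Some Q (pd None ?F) (slice t 0)"
      by (rule pdl_pd[OF \<Omega> F in\<Omega>, symmetric])
    also have "\<dots> = pdl Some Q (\<lambda>v. (- 1) * ?L v) (slice t 0)"
      by (rule pdl_cong[OF \<Omega> _ in\<Omega>]) (rule flow_pde_explicit[OF f])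
    also have "\<dots> = (- 1) * pdl Some Q ?L (slice t 0)"
      by (rule pdl_fun_cmult[OF \<Omega> L in\<Omega>])
    also have "pdl Some Q ?L (slice t 0) = pdl Some (Lap k a b Q) ?F (slice t 0)"
      by (rule pdl_Lap[OF \<Omega> F in\<Omega>]) simp
    finally have "pd None (pdl Some Q ?F) (slice t 0) = 0"
      by (simp add: Lap pdl_0)
    moreover note D = holo_cderI[OF holo_pdl[OF \<Omega> F, of Some Q] in\<Omega>[of t]]
    ultimately have "((\<lambda>h. \<phi> (t + h)) has_field_derivative 0) (at 0)"
      using cder_axis[OF D, of None, folded cder_pd[OF D]]
      by (simp only: \<phi>_def slice_add_axis)
    then show ?thesis using DERIV_shift[of \<phi> 0 0 t] by (simp add: add.commute)
  qed
  then have "\<exists>d. \<forall>t\<in>UNIV. \<phi> t = d"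
    by (intro has_field_derivative_zero_constant convex_UNIV)
  then obtain d where d: "\<And>t. \<phi> t = d" by blast
  have \<phi>: "pdl id Q (\<lambda>w. ?F (slice t w)) 0 = \<phi> t" for t
    by (simp add: \<phi>_def pdl_slice)
  have "(\<lambda>w. ?F (slice 0 w)) = f"
  proof
    fix w :: "complex^('r \<times> 'n \<times> 'n)"
    have "flow a b (slice 0 w) = w"
      by (auto simp: flow_def vec_eq_iff)
    then show "?F (slice 0 w) = f w"
      by (simp add: flow_fun_def flow_den_def)
  qed
  then show ?thesis
    using \<phi>[of c] \<phi>[of 0] d[of c] d[of 0] by simp
qed

text \<open>The neighbourhood of the origin may shrink with each flow, but some neighbourhood always
  remains, so that a further flow can be applied.\<close>

lemma holo_flow_slice:
  fixes f :: "complex^('r::finite \<times> 'n \<times> 'n) \<Rightarrow> complex"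
  assumes S: "open S" "0 \<in> S" and f: "holo S f"
  obtains T where "open T" "0 \<in> T" "holo T (\<lambda>w. flow_fun k a b f (slice c w))"
proof
  let ?T = "{w. slice c w \<in> flow_dom a b S}"
  have nth: "holo A (\<lambda>w. slice c w $ i)" for A :: "(complex^('r \<times> 'n \<times> 'n)) set" and i
    by (cases i) (simp_all add: holo_const holo_nth)
  then have "continuous_on UNIV (\<lambda>w :: complex^('r \<times> 'n \<times> 'n). slice c w $ i)" for i
    by (rule holo_continuous_on)
  then have "continuous_on UNIV (\<lambda>w :: complex^('r \<times> 'n \<times> 'n). slice c w)"
    unfolding continuous_on_def by (intro ballI vec_tendstoI) auto
  from open_vimage[OF open_flow_dom[OF S(1)] this] show "open ?T"
    by (simp add: vimage_def)
  show "0 \<in> ?T" using slice_0_in_flow_dom[OF S(2)] by simp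
  show "holo ?T (\<lambda>w. flow_fun k a b f (slice c w))"
    by (rule holo_compose[OF holo_flow_fun[OF f] nth]) simp
qed

end

text \<open>The indices are transposed as in \<open>\<partial>/\<partial>Z\<close>, so that the variables of \<open>Q\<close> act as plain partial
  derivatives with respect to the coordinates.\<close>

definition mt :: "complex^('r::finite \<times> 'n::finite \<times> 'n) \<Rightarrow> 'r \<Rightarrow> complex^'n^'n" where
  "mt w j = (\<chi> p q. w $ (j, q, p))"

definition coords :: "('r::finite \<Rightarrow> complex^'n^'n) \<Rightarrow> complex^('r \<times> 'n::finite \<times> 'n)" where
  "coords R = (\<chi> x. case x of (j, q, p) \<Rightarrow> R j $ p $ q)"

lemma mt_nth [simp]: "mt w j $ p $ q = w $ (j, q, p)"
  and coords_nth [simp]: "coords R $ (j, q, p) = R j $ p $ q"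
  by (simp_all add: mt_def coords_def)

lemma mt_coords [simp]: "mt (coords R) j = R j" and coords_mt [simp]: "coords (mt w) = w"
  by (auto simp: vec_eq_iff)

lemma mt_add [simp]: "mt (w + w') j = mt w j + mt w' j" and mt_0 [simp]: "mt 0 j = 0"
  by (auto simp: vec_eq_iff)

lemma continuous_on_mt: "continuous_on S (\<lambda>w. mt w j)"
  unfolding mt_def by (intro continuous_on_vec_lambda continuous_intros)

lemma open_mt_Collect: "open H \<Longrightarrow> open {w :: complex^('r::finite \<times> 'n::finite \<times> 'n). \<forall>j. mt w j \<in> H}"
proof -
  assume H: "open H"
  have "open (\<Inter>j. (\<lambda>w :: complex^('r \<times> 'n \<times> 'n). mt w j) -` H)"
    by (intro open_INT ballI open_vimage H continuous_on_mt) auto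
  then show ?thesis by (simp add: vimage_def Collect_all_eq)
qed

text \<open>The action of the lower unipotent block matrix with entry \<open>C\<close>, in weight
  \<open>k j\<close> in the \<open>j\<close>-th variable and in all variables at once.\<close>

definition conf :: "('r::finite \<Rightarrow> nat) \<Rightarrow> complex^'n^'n \<Rightarrow> (complex^('r \<times> 'n::finite \<times> 'n) \<Rightarrow> complex) \<Rightarrow>
    complex^('r \<times> 'n \<times> 'n) \<Rightarrow> complex" where
  "conf k C f w = (\<Prod>j\<in>UNIV. inverse (det (mat 1 + C ** mt w j)) ^ k j) *
     f (coords (\<lambda>j. mt w j ** matrix_inv (mat 1 + C ** mt w j)))"

definition elem :: "'n \<Rightarrow> 'n \<Rightarrow> complex \<Rightarrow> complex^'n^'n" where
  "elem a b c = (\<chi> s t. if s = a \<and> t = b then c else 0)"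

lemma elem_mult_nth: "(elem a b c ** Z) $ s $ t = (if s = a then c * Z $ b $ t else 0)"
  for Z :: "complex^'n^'n::finite"
proof -
  have "elem a b c $ s $ i * Z $ i $ t = (if i = b then (if s = a then c * Z $ i $ t else 0) else 0)" for i
    by (simp add: elem_def)
  then show ?thesis by (simp add: matrix_matrix_mult_def)
qed

text \<open>Only row \<open>a\<close> differs from the identity, so Cramer's lemma reads the
  determinant off the diagonal entry of that row.\<close>

lemma det_1_plus_elem: "det (mat 1 + elem a b c ** Z) = 1 + c * Z $ b $ a"
  for Z :: "complex^'n^'n::finite"
proof -
  define x where "x = (\<chi> t. (mat 1 + elem a b c ** Z) $ a $ t)"
  have "row i (mat 1) = (axis i 1 :: complex^'n)" for i
    by (auto simp: row_def mat_def axis_def vec_eq_iff)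
  then have rows: "(\<Sum>i\<in>UNIV. x $ i *s row i (mat 1)) = x"
    using basis_expansion[of x] by simp
  have "(\<chi> i. if i = a then x else row i (mat 1)) = mat 1 + elem a b c ** Z"
    by (auto simp: vec_eq_iff elem_mult_nth row_def x_def)
  then have "det (mat 1 + elem a b c ** Z) = x $ a * det (mat 1 :: complex^'n^'n)"
    using cramer_lemma_transpose[of a x "mat 1"] unfolding rows by simp
  then show ?thesis by (simp add: elem_mult_nth x_def) (simp add: mat_def)
qed

lemma elem_flow_inverse:
  fixes Z :: "complex^'n^'n::finite"
  assumes u: "1 + c * Z $ b $ a \<noteq> 0"
  defines "Y \<equiv> \<chi> p q. Z $ p $ q - c * (Z $ p $ a * Z $ b $ q) * inverse (1 + c * Z $ b $ a)"
  shows "Y ** (mat 1 + elem a b c ** Z) = Z"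
proof -
  have "(Y ** (mat 1 + elem a b c ** Z)) $ p $ t = Z $ p $ t" for p t
  proof -
    have "(Y ** (mat 1 + elem a b c ** Z)) $ p $ t =
      (\<Sum>i\<in>UNIV. (if i = t then Y $ p $ i else 0) + (if i = a then Y $ p $ i * (c * Z $ b $ t) else 0))"
      unfolding matrix_matrix_mult_def vec_lambda_beta
      by (intro sum.cong) (auto simp: elem_mult_nth[unfolded matrix_matrix_mult_def vec_lambda_beta] mat_def distrib_left)
    also have "\<dots> = Y $ p $ t + Y $ p $ a * (c * Z $ b $ t)"
      by (simp add: sum.distrib)
    also have "Y $ p $ a = Z $ p $ a * inverse (1 + c * Z $ b $ a)"
      using u by (simp add: Y_def field_simps)
    finally show ?thesis by (simp add: Y_def)
  qed
  then show ?thesis by (simp add: vec_eq_iff)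
qed

lemma matrix_add_rdistrib: "(A + B) ** C = A ** C + B ** C"
  for A B :: "complex^'n::finite^'m" and C :: "complex^'l^'n"
  by (simp add: vec_eq_iff matrix_matrix_mult_def distrib_right sum.distrib)

lemma matrix_inv_mult:
  fixes M :: "complex^'n^'n::finite"
  assumes "det M \<noteq> 0"
  shows "M ** matrix_inv M = mat 1" "matrix_inv M ** M = mat 1"
proof -
  have "\<exists>M'. M ** M' = mat 1 \<and> M' ** M = mat 1"
    using assms by (simp add: invertible_det_nz[symmetric] invertible_def)
  from someI_ex[OF this] show "M ** matrix_inv M = mat 1" "matrix_inv M ** M = mat 1"
    by (simp_all add: matrix_inv_def)
qed

lemma matrix_mult_inv_unique:
  fixes M Y W :: "complex^'n^'n::finite"
  assumes "det M \<noteq> 0" "Y ** M = W"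
  shows "Y = W ** matrix_inv M"
  by (simp only: assms(2)[symmetric] matrix_mul_assoc[symmetric] matrix_inv_mult(1)[OF assms(1)]
      matrix_mul_rid)

lemma det_matrix_inv: "det M \<noteq> 0 \<Longrightarrow> det (matrix_inv M) = inverse (det M)"
  for M :: "complex^'n^'n::finite"
proof -
  assume d: "det M \<noteq> 0"
  have "det M * det (matrix_inv M) = 1"
    using det_mul[of M "matrix_inv M"] unfolding matrix_inv_mult(1)[OF d] det_I by (rule sym)
  then show ?thesis by (rule inverse_unique[symmetric])
qed

text \<open>Lower unipotent block matrices multiply by adding their entries: with
  \<open>E = elem a b c\<close> and \<open>Z = W (1 + C W)\<^sup>-\<^sup>1\<close> one has
  \<open>1 + (C + E) W = (1 + E Z) (1 + C W)\<close>, and the automorphy factors multiply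
  accordingly. Both denominators must be invertible, as they are near the origin.\<close>

lemma conf_add_elem:
  fixes w :: "complex^('r::finite \<times> 'n::finite \<times> 'n)"
  assumes 1: "\<And>j. det (mat 1 + C ** mt w j) \<noteq> 0"
    and 2: "\<And>j. det (mat 1 + (C + elem a b c) ** mt w j) \<noteq> 0"
  shows "conf k C (\<lambda>w. flow_fun k a b f (slice c w)) w = conf k (C + elem a b c) f w"
proof -
  define M where "M = (\<lambda>j. mat 1 + C ** mt w j)"
  define N where "N = (\<lambda>j. mat 1 + (C + elem a b c) ** mt w j)"
  define Z where "Z = (\<lambda>j. mt w j ** matrix_inv (M j))"
  have dM: "det (M j) \<noteq> 0" and dN: "det (N j) \<noteq> 0" for j
    using 1 2 by (simp_all add: M_def N_def)
  have ZM: "Z j ** M j = mt w j" for j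
    unfolding Z_def matrix_mul_assoc[symmetric] matrix_inv_mult(2)[OF dM] by simp
  have N: "(mat 1 + elem a b c ** Z j) ** M j = N j" for j
    unfolding matrix_add_rdistrib matrix_mul_assoc[symmetric] ZM
    by (simp add: M_def N_def matrix_add_rdistrib add.assoc)
  have dN': "det (N j) = (1 + c * Z j $ b $ a) * det (M j)" for j
    using arg_cong[OF N, of det j] by (simp only: det_mul det_1_plus_elem)
  have u: "1 + c * Z j $ b $ a \<noteq> 0" for j using dN[of j] unfolding dN' by simp
  have den: "flow_den a b j (slice c (coords Z)) = 1 + c * Z j $ b $ a" for j
    by (simp add: flow_den_def)
  let ?X = "\<lambda>j. \<chi> p q. Z j $ p $ q - c * (Z j $ p $ a * Z j $ b $ q) * inverse (1 + c * Z j $ b $ a)"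
  have flow: "flow a b (slice c (coords Z)) = coords ?X"
    by (auto simp: flow_def den vec_eq_iff split: prod.split)
  have Y: "?X j = mt w j ** matrix_inv (N j)" for j
    by (rule matrix_mult_inv_unique[OF dN])
      (simp only: N[symmetric] matrix_mul_assoc elem_flow_inverse[of c "Z j" b a, OF u] ZM)
  have "conf k C (\<lambda>w. flow_fun k a b f (slice c w)) w =
      (\<Prod>j\<in>UNIV. inverse (det (M j)) ^ k j) * flow_fun k a b f (slice c (coords Z))"
    by (simp add: conf_def Z_def M_def)
  also have "\<dots> = (\<Prod>j\<in>UNIV. inverse (det (M j)) ^ k j * inverse (1 + c * Z j $ b $ a) ^ k j) * f (coords ?X)"
    by (simp only: flow_fun_def den flow prod.distrib mult.assoc)
  also have "\<dots> = (\<Prod>j\<in>UNIV. inverse (det (N j)) ^ k j) * f (coords (\<lambda>j. mt w j ** matrix_inv (N j)))"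
    by (simp only: dN' Y) (simp add: power_mult_distrib mult.commute)
  finally show ?thesis by (simp add: conf_def N_def)
qed

lemma continuous_on_det:
  fixes f :: "'a::topological_space \<Rightarrow> complex^'n^'n::finite"
  assumes "continuous_on S f"
  shows "continuous_on S (\<lambda>x. det (f x))"
  unfolding det_def by (intro continuous_intros assms)

lemma conf_dom:
  fixes C :: "complex^'n^'n::finite"
  defines "U \<equiv> {w :: complex^('r::finite \<times> 'n \<times> 'n). \<forall>j. det (mat 1 + C ** mt w j) \<noteq> 0}"
  shows "open U" "0 \<in> U"
proof -
  have "continuous_on UNIV (\<lambda>w :: complex^('r \<times> 'n \<times> 'n). det (mat 1 + C ** mt w j))" for j
    unfolding matrix_matrix_mult_def mt_def
    by (intro continuous_on_det continuous_intros continuous_on_vec_lambda)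
  then have "open (\<Inter>j. {w :: complex^('r \<times> 'n \<times> 'n). det (mat 1 + C ** mt w j) \<noteq> 0})"
    by (intro open_INT ballI open_Collect_neq continuous_intros) auto
  also have "(\<Inter>j. {w :: complex^('r \<times> 'n \<times> 'n). det (mat 1 + C ** mt w j) \<noteq> 0}) = U"
    by (auto simp: U_def)
  finally show "open U" .
  show "0 \<in> U" by (simp add: U_def)
qed

text \<open>The entries of \<open>C\<close> are added one at a time. Each addition replaces
  \<open>f\<close> by its image under a flow, so the induction runs over all functions holomorphic
  near the origin.\<close>

lemma pdl_conf:
  fixes f :: "complex^('r::finite \<times> 'n::finite \<times> 'n) \<Rightarrow> complex"
  assumes Lap: "\<And>a b. Lap k a b Q = 0" and "open S" "0 \<in> S" "holo S f"
  shows "pdl id Q (conf k C f) 0 = pdl id Q f 0"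
proof -
  define D where "D = (\<lambda>A. \<chi> s t. if (s, t) \<in> A then C $ s $ t else 0)"
  have "pdl id Q (conf k (D A) f) 0 = pdl id Q f 0" if "finite A" for A
    using that assms(2-)
  proof (induction A arbitrary: f S rule: finite_induct)
    case empty
    have "D {} = 0" by (simp add: D_def vec_eq_iff)
    moreover have "matrix_inv (mat 1 :: complex^'n^'n) = mat 1"
      using matrix_inv_mult(1)[of "mat 1 :: complex^'n^'n"] by simp
    ultimately have "conf k (D {}) f = f"
      by (simp add: conf_def fun_eq_iff)
    then show ?case by simp
  next
    case (insert x A)
    obtain a b where x: "x = (a, b)" by (cases x) auto
    define c where "c = C $ a $ b"
    have D: "D (insert x A) = D A + elem a b c"
      using insert.hyps(2) by (auto simp: x D_def elem_def c_def vec_eq_iff)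
    let ?g = "\<lambda>w. flow_fun k a b f (slice c w)"
    obtain T where T: "open T" "0 \<in> T" "holo T ?g"
      using holo_flow_slice[OF insert.prems] by blast
    let ?U = "\<lambda>C. {w :: complex^('r \<times> 'n \<times> 'n). \<forall>j. det (mat 1 + C ** mt w j) \<noteq> 0}"
    have "pdl id Q (conf k (D (insert x A)) f) 0 = pdl id Q (conf k (D A) ?g) 0"
    proof (rule pdl_cong[of "?U (D A) \<inter> ?U (D A + elem a b c)"])
      show "open (?U (D A) \<inter> ?U (D A + elem a b c))"
        "0 \<in> ?U (D A) \<inter> ?U (D A + elem a b c)"
        using conf_dom[of "D A"] conf_dom[of "D A + elem a b c"] by auto
    qed (simp add: D conf_add_elem)
    also have "\<dots> = pdl id Q ?g 0"
      by (rule insert.IH[OF T])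
    also have "\<dots> = pdl id Q f 0"
      by (rule pdl_flow[OF insert.prems Lap])
    finally show ?case .
  qed
  from this[of UNIV] show ?thesis by (simp add: D_def)
qed

section \<open>Behaviour of the operator under fractional linear maps\<close>

lemma pd_shift: "(\<lambda>w. pd i g (y + w)) = pd i (\<lambda>w. g (y + w))"
  by (simp add: pd_def fun_eq_iff add.assoc)

lemma pdf_shift: "(\<lambda>w. pdf e xs m g (y + w)) = pdf e xs m (\<lambda>w. g (y + w))"
proof (induction xs)
  case (Cons x xs)
  have "(\<lambda>w. (pd (e x) ^^ n) G (y + w)) = (pd (e x) ^^ n) (\<lambda>w. G (y + w))" for n G
    by (induction n) (simp_all add: pd_shift)
  with Cons show ?case by simp
qed simp

lemma pdl_shift: "pdl e Q g (y + w) = pdl e Q (\<lambda>w. g (y + w)) w"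
  unfolding pdl_def pdf_shift[symmetric] ..

lemma eval_matrices_ev: "eval_matrices Q R = ev (\<lambda>(j, s, t). R j $ s $ t) Q"
  by (simp add: eval_matrices_def)

text \<open>In the coordinates of \<open>coords\<close> the substitution \<open>Z\<^sub>j \<mapsto> N Z\<^sub>j M\<close> acts on symbols by \<open>R\<^sub>j \<mapsto> M R\<^sub>j N\<close>.\<close>

lemma psubst_Q_space:
  fixes Q :: "('r::finite \<times> 'n::finite \<times> 'n) cpoly" and N M :: "complex^'n^'n"
  assumes Q: "Q \<in> Q_space v" and N: "det N \<noteq> 0" and M: "det M \<noteq> 0"
  defines "A \<equiv> \<lambda>(j', q', p') (j, q, p). if j' = j then N $ p' $ p * M $ q $ q' else 0"
  shows "psubst (\<lambda>i. \<Sum>x\<in>UNIV. poly_const (A x i) * poly_var x) Q = poly_const ((det N * det M) ^ v) * Q"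
proof (rule poly_eqI)
  fix R :: "'r \<times> 'n \<times> 'n \<Rightarrow> complex"
  define R' :: "'r \<Rightarrow> complex^'n^'n" where "R' = (\<lambda>j. \<chi> s t. R (j, s, t))"
  have entry: "(\<Sum>x\<in>UNIV. A x (j, q, p) * R x) = (M ** R' j ** N) $ q $ p" for j q p
  proof -
    have "(\<Sum>x\<in>UNIV. A x (j, q, p) * R x) =
      (\<Sum>j'\<in>UNIV. if j' = j then \<Sum>q'\<in>UNIV. \<Sum>p'\<in>UNIV. N $ p' $ p * M $ q $ q' * R (j', q', p') else 0)"
      unfolding sum_UNIV_triple by (intro sum.cong) (auto simp: A_def)
    also have "\<dots> = (\<Sum>q'\<in>UNIV. \<Sum>p'\<in>UNIV. N $ p' $ p * M $ q $ q' * R (j, q', p'))"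
      by simp
    also have "\<dots> = (M ** R' j ** N) $ q $ p"
      by (subst sum.swap) (simp add: matrix_matrix_mult_def R'_def sum_distrib_left mult_ac)
    finally show ?thesis .
  qed
  have "ev R (psubst (\<lambda>i. \<Sum>x\<in>UNIV. poly_const (A x i) * poly_var x) Q) =
      ev (\<lambda>i. \<Sum>x\<in>UNIV. A x i * R x) Q"
    by (simp add: ev_psubst)
  also have "(\<lambda>i. \<Sum>x\<in>UNIV. A x i * R x) = (\<lambda>(j, s, t). (M ** R' j ** transpose (transpose N)) $ s $ t)"
    by (auto simp: fun_eq_iff entry)
  also have "ev \<dots> Q = eval_matrices Q (\<lambda>j. M ** R' j ** transpose (transpose N))"
    by (simp only: eval_matrices_ev)
  also have "\<dots> = det M ^ v * det (transpose N) ^ v * eval_matrices Q R'"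
  proof -
    have "invertible M" "invertible (transpose N)"
      using N M by (simp_all add: invertible_det_nz)
    then show ?thesis using Q unfolding Q_space_def by blast
  qed
  also have "eval_matrices Q R' = ev R Q"
    by (simp add: eval_matrices_ev R'_def)
  finally show "ev R (psubst (\<lambda>i. \<Sum>x\<in>UNIV. poly_const (A x i) * poly_var x) Q) =
      ev R (poly_const ((det N * det M) ^ v) * Q)"
    by (simp add: power_mult_distrib)
qed

text \<open>The matrix \<open>A\<close> is the one of \<open>psubst_Q_space\<close>; together the
  two lemmas match the affine part of the action on points with its effect on symbols, as
  \<open>pdl_affine\<close> requires.\<close>

lemma coords_linear:
  fixes N M :: "complex^'n^'n::finite" and Y :: "'r::finite \<Rightarrow> complex^'n^'n"
  defines "A \<equiv> \<lambda>(j', q', p') (j, q, p). if j' = j then N $ p' $ p * M $ q $ q' else 0"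
  shows "coords (\<lambda>j. Y j + N ** mt w j ** M) = (\<chi> x. coords Y $ x + (\<Sum>i\<in>UNIV. A x i * w $ i))"
proof -
  have "(\<Sum>i\<in>UNIV. A (j', q', p') i * w $ i) = (N ** mt w j' ** M) $ p' $ q'" for j' q' p'
  proof -
    have "(\<Sum>i\<in>UNIV. A (j', q', p') i * w $ i) =
      (\<Sum>j\<in>UNIV. if j = j' then \<Sum>q\<in>UNIV. \<Sum>p\<in>UNIV. N $ p' $ p * M $ q $ q' * w $ (j, q, p) else 0)"
      unfolding sum_UNIV_triple by (intro sum.cong) (auto simp: A_def)
    also have "\<dots> = (\<Sum>q\<in>UNIV. \<Sum>p\<in>UNIV. N $ p' $ p * M $ q $ q' * w $ (j', q, p))"
      by simp
    also have "\<dots> = (N ** mt w j' ** M) $ p' $ q'"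
      by (simp add: matrix_matrix_mult_def sum_distrib_left sum_distrib_right mult_ac)
    finally show ?thesis .
  qed
  then show ?thesis by (auto simp: vec_eq_iff)
qed

lemma pdl_covariant:
  fixes F :: "'r::finite \<Rightarrow> complex^'n::finite^'n \<Rightarrow> complex"
    and A B C D Z0 :: "complex^'n^'n" and Q :: "('r \<times> 'n \<times> 'n) cpoly"
  defines "g \<equiv> \<lambda>w. \<Prod>j\<in>UNIV. F j (mt w j)"
    and "M \<equiv> C ** Z0 + D" and "act \<equiv> \<lambda>Z. (A ** Z + B) ** matrix_inv (C ** Z + D)"
  defines "N \<equiv> A - act Z0 ** C"
  assumes H: "open H" "Z0 \<in> H" "act Z0 \<in> H"
    and F: "holo {w. \<forall>j. mt w j \<in> H} g"
    and tr: "\<And>j Z. Z \<in> H \<Longrightarrow> F j Z = inverse (det (C ** Z + D)) ^ k j * F j (act Z)"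
    and M: "det M \<noteq> 0" and N: "det N \<noteq> 0"
    and Q: "Q \<in> Q_space v" and Lap: "\<And>a b. Lap k a b Q = 0"
  shows "pdl id Q g (coords (\<lambda>_. Z0)) =
    inverse (det M) ^ (\<Sum>j\<in>UNIV. k j) * (det N * inverse (det M)) ^ v * pdl id Q g (coords (\<lambda>_. act Z0))"
proof -
  let ?HH = "{w :: complex^('r \<times> 'n \<times> 'n). \<forall>j. mt w j \<in> H}"
  have openHH: "open ?HH" by (rule open_mt_Collect[OF H(1)])
  define c where "c = (\<Prod>j\<in>UNIV. inverse (det M) ^ k j)"
  have c: "c = inverse (det M) ^ (\<Sum>j\<in>UNIV. k j)"
    by (simp add: c_def power_sum)
  define A' :: "'r \<times> 'n \<times> 'n \<Rightarrow> 'r \<times> 'n \<times> 'n \<Rightarrow> complex" where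
    "A' = (\<lambda>(j', q', p') (j, q, p). if j' = j then N $ p' $ p * matrix_inv M $ q $ q' else 0)"
  define l where "l = (\<lambda>w :: complex^('r \<times> 'n \<times> 'n). \<chi> x. coords (\<lambda>_. act Z0) $ x + (\<Sum>i\<in>UNIV. A' x i * w $ i))"
  have l: "l w = coords (\<lambda>j. act Z0 + N ** mt w j ** matrix_inv M)" for w
    unfolding l_def A'_def by (rule coords_linear[symmetric])
  have l0: "l 0 = coords (\<lambda>_. act Z0)" by (simp add: l_def)
  let ?S = "{w. l w \<in> ?HH}"
  have S: "open ?S" unfolding l_def by (rule open_affine_vimage[OF openHH])
  have S0: "0 \<in> ?S" using H(3) by (simp add: l0)
  have f: "holo ?S (\<lambda>w. g (l w))" unfolding l_def by (rule holo_affine[OF F])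
  let ?C = "matrix_inv M ** C"
  \<comment> \<open>The denominator factors through its value \<open>M\<close> at \<open>Z0\<close>;
    the second factor is the denominator of the conformal map.\<close>
  have key: "C ** (Z0 + Z) + D = M ** (mat 1 + ?C ** Z)" for Z
    by (simp only: matrix_add_ldistrib matrix_mul_assoc matrix_inv_mult(1)[OF M]
        matrix_mul_rid matrix_mul_lid) (simp only: M_def add_ac)
  have act: "act (Z0 + Z) = act Z0 + N ** (Z ** matrix_inv (mat 1 + ?C ** Z)) ** matrix_inv M"
    if d: "det (mat 1 + ?C ** Z) \<noteq> 0" for Z
  proof -
    have dd: "det (C ** (Z0 + Z) + D) \<noteq> 0"
      unfolding key det_mul using M d by simp
    define P where "P = mat 1 + ?C ** Z"
    have P: "det P \<noteq> 0" using d by (simp add: P_def)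
    have NN: "N + act Z0 ** C = A" by (simp add: N_def)
    have actM: "act Z0 ** M = A ** Z0 + B"
      unfolding act_def M_def matrix_mul_assoc[symmetric] matrix_inv_mult(2)[OF M[unfolded M_def]] by simp
    \<comment> \<open>The claimed expansion is checked after multiplication by the denominator,
      where both sides become \<open>A (Z0 + Z) + B\<close>; uniqueness of the quotient then gives
      the identity.\<close>
    have "(act Z0 + N ** (Z ** matrix_inv P) ** matrix_inv M) ** (C ** (Z0 + Z) + D) =
        act Z0 ** (C ** (Z0 + Z) + D) + N ** (Z ** matrix_inv P) ** ((matrix_inv M ** M) ** P)"
      unfolding matrix_add_rdistrib by (simp only: key P_def matrix_mul_assoc)
    also have "\<dots> = act Z0 ** (C ** (Z0 + Z) + D) + N ** (Z ** (matrix_inv P ** P))"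
      by (simp only: matrix_inv_mult(2)[OF M] matrix_mul_lid matrix_mul_assoc)
    also have "\<dots> = act Z0 ** (C ** (Z0 + Z) + D) + N ** Z"
      by (simp only: matrix_inv_mult(2)[OF P] matrix_mul_rid)
    also have "\<dots> = act Z0 ** (M + C ** Z) + N ** Z"
      by (simp only: M_def matrix_add_ldistrib add_ac)
    also have "\<dots> = A ** Z0 + B + (N + act Z0 ** C) ** Z"
      by (simp only: matrix_add_ldistrib actM matrix_add_rdistrib matrix_mul_assoc add_ac)
    also have "\<dots> = A ** (Z0 + Z) + B"
      by (simp only: NN matrix_add_ldistrib add_ac)
    finally have "act Z0 + N ** (Z ** matrix_inv P) ** matrix_inv M =
        (A ** (Z0 + Z) + B) ** matrix_inv (C ** (Z0 + Z) + D)"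
      by (rule matrix_mult_inv_unique[OF dd])
    then show ?thesis by (simp only: act_def P_def)
  qed
  have expand: "g (coords (\<lambda>_. Z0) + w) = conf k ?C (\<lambda>w. c * g (l w)) w"
    if w: "\<And>j. det (mat 1 + ?C ** mt w j) \<noteq> 0" "\<And>j. Z0 + mt w j \<in> H" for w
  proof -
    have "F j (Z0 + mt w j) = inverse (det M) ^ k j * inverse (det (mat 1 + ?C ** mt w j)) ^ k j *
        F j (act Z0 + N ** (mt w j ** matrix_inv (mat 1 + ?C ** mt w j)) ** matrix_inv M)" for j
      using tr[OF w(2)] by (simp add: key det_mul act[OF w(1)] power_mult_distrib)
    then show ?thesis
      by (simp add: g_def conf_def c_def l prod.distrib mult_ac)
  qed
  have "pdl id Q g (coords (\<lambda>_. Z0)) = pdl id Q (\<lambda>w. g (coords (\<lambda>_. Z0) + w)) 0"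
    using pdl_shift[of id Q g "coords (\<lambda>_. Z0)" 0] by simp
  \<comment> \<open>The expansion holds only where the conformal denominators are invertible and the
    shifted matrices stay in \<open>H\<close>. Both conditions are open and hold at the origin, and
    the operator depends only on the germ there.\<close>
  also have "\<dots> = pdl id Q (conf k ?C (\<lambda>w. c * g (l w))) 0"
  proof (rule pdl_cong[of "{w. \<forall>j. det (mat 1 + ?C ** mt w j) \<noteq> 0} \<inter> (+) (coords (\<lambda>_. Z0)) -` ?HH"])
    show "open ({w. \<forall>j. det (mat 1 + ?C ** mt w j) \<noteq> 0} \<inter> (+) (coords (\<lambda>_. Z0)) -` ?HH)"
      by (intro open_Int conf_dom open_vimage openHH continuous_intros)
    show "0 \<in> {w. \<forall>j. det (mat 1 + ?C ** mt w j) \<noteq> 0} \<inter> (+) (coords (\<lambda>_. Z0)) -` ?HH"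
      using H by simp
  qed (use expand in simp)
  also have "\<dots> = pdl id Q (\<lambda>w. c * g (l w)) 0"
    by (rule pdl_conf[OF Lap S S0 holo_mult[OF holo_const f]])
  also have "\<dots> = c * pdl id Q (\<lambda>w. g (l w)) 0"
    by (rule pdl_fun_cmult[OF S f S0])
  also have "pdl id Q (\<lambda>w. g (l w)) 0 =
      pdl id (psubst (\<lambda>i. \<Sum>x\<in>UNIV. poly_const (A' x i) * poly_var x) Q) g (l 0)"
  proof -
    have "l 0 \<in> ?HH" using S0 by simp
    then show ?thesis unfolding l_def by (rule pdl_affine[OF openHH F])
  qed
  also have "psubst (\<lambda>i. \<Sum>x\<in>UNIV. poly_const (A' x i) * poly_var x) Q =
      poly_const ((det N * det (matrix_inv M)) ^ v) * Q"
    unfolding A'_def by (rule psubst_Q_space[OF Q N]) (simp add: det_matrix_inv M)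
  also have "pdl id \<dots> g (l 0) = (det N * det (matrix_inv M)) ^ v * pdl id Q g (l 0)"
    by (rule pdl_const_mult[OF openHH F]) (use S0 in simp)
  finally show ?thesis
    by (simp only: c l0 det_matrix_inv[OF M] mult.assoc)
qed

section \<open>Comparison with the operator \<open>poly_deriv\<close>\<close>

definition fl :: "complex^('r::finite \<times> 'n::finite \<times> 'n) \<Rightarrow> complex^'n^'n^'r" where
  "fl w = (\<chi> j. mt w j)"

lemma entry_deriv_fl: "(\<lambda>w. entry_deriv j t s G (fl w)) = pd (j, s, t) (\<lambda>w. G (fl w))"
proof -
  have "fl w + axis j (axis t (axis s h)) = fl (w + axis (j, s, t) h)" for w and h
    by (auto simp: fl_def vec_eq_iff axis_def)
  then show ?thesis by (simp add: entry_deriv_def pd_def fun_eq_iff)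
qed

text \<open>The transposition in \<open>monomial_deriv\<close> is absorbed by \<open>mt\<close>, and
  both sides apply the derivatives in the same chosen order, so they agree for arbitrary functions
  \<open>G\<close>.\<close>

lemma poly_deriv_fl: "poly_deriv Q G (fl w) = pdl id Q (\<lambda>w. G (fl w)) w"
proof -
  have "(\<lambda>w. foldr (\<lambda>(j, s, t). entry_deriv j t s ^^ lookup m (j, s, t)) xs G (fl w)) =
      pdf id xs m (\<lambda>w. G (fl w))" for xs and m
  proof (induction xs)
    case (Cons x xs)
    obtain j s t where x: "x = (j, s, t)" by (cases x) auto
    have "(\<lambda>w. (entry_deriv j t s ^^ n) H (fl w)) = (pd (j, s, t) ^^ n) (\<lambda>w. H (fl w))" for n H
      by (induction n) (simp_all add: entry_deriv_fl)
    with Cons show ?case by (simp add: x)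
  qed simp
  then show ?thesis
    unfolding poly_deriv_def monomial_deriv_def pdl_def by (metis (no_types, lifting))
qed


section \<open>The unitary group and its action on the half-space\<close>

abbreviation ct :: "complex^'n^'m \<Rightarrow> complex^'m^'n" where
  "ct \<equiv> conj_transpose"

lemma ct_nth [simp]: "ct A $ i $ j = cnj (A $ j $ i)"
  by (simp add: conj_transpose_def map_matrix_def transpose_def)

lemma ct_ct [simp]: "ct (ct A) = A"
  by (simp add: vec_eq_iff)

lemma ct_mult: "ct (A ** B) = ct B ** ct A"
  for A :: "complex^'n::finite^'m" and B :: "complex^'l^'n"
  by (simp add: vec_eq_iff matrix_matrix_mult_def mult.commute)

lemma ct_add: "ct (A + B) = ct A + ct B" and ct_diff: "ct (A - B) = ct A - ct B"
  by (simp_all add: vec_eq_iff)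

lemma ct_mat_1 [simp]: "ct (mat 1 :: complex^'n^'n) = mat 1"
  by (auto simp: vec_eq_iff mat_def)

lemma det_ct: "det (ct A) = cnj (det A)" for A :: "complex^'n::finite^'n"
proof -
  have "det (ct A) = det (transpose (ct A))" by (simp add: det_transpose)
  also have "\<dots> = cnj (det A)"
    by (simp add: det_def transpose_def)
  finally show ?thesis .
qed

section \<open>The Hermitian inner product and the geometry of the half-space\<close>

definition ip :: "complex^'n \<Rightarrow> complex^'n::finite \<Rightarrow> complex" where
  "ip x y = (\<Sum>s\<in>UNIV. cnj (x $ s) * y $ s)"

lemma ip_diff_right: "ip x (y - z) = ip x y - ip x z"
  by (simp add: ip_def right_diff_distrib sum_subtractf)

lemma ip_adjoint: "ip x (ct A *v y) = ip (A *v x) y" for A :: "complex^'n::finite^'m::finite"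
  unfolding ip_def matrix_vector_mult_def
  by (simp add: sum_distrib_left sum_distrib_right) (subst sum.swap, simp add: mult_ac)

lemma ip_self: "ip x x = of_real ((norm x)\<^sup>2)"
proof -
  have "cnj z * z = of_real ((norm z)\<^sup>2)" for z :: complex
    by (simp add: complex_norm_square[symmetric] mult.commute)
  then show ?thesis
    by (simp add: ip_def norm_vec_def L2_set_def sum_nonneg)
qed

definition im_form :: "complex^'n::finite^'n \<Rightarrow> complex^'n \<Rightarrow> real" where
  "im_form Z x = Re (1 / (2 * \<i>) * ip x ((Z - ct Z) *v x))"

lemma half_space_iff:
  "Z \<in> hermitian_half_space \<longleftrightarrow> (\<forall>x. x \<noteq> 0 \<longrightarrow> 0 < im_form Z x)"
proof -
  let ?M = "map_matrix (\<lambda>z. 1 / (2 * \<i>) * z) (Z - ct Z)"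
  have 1: "ct ?M = ?M"
    by (simp add: vec_eq_iff map_matrix_def field_simps)
  have 2: "(\<Sum>s\<in>UNIV. \<Sum>t\<in>UNIV. cnj (x $ s) * ?M $ s $ t * x $ t) =
      1 / (2 * \<i>) * ip x ((Z - ct Z) *v x)" for x
    by (simp add: ip_def matrix_vector_mult_def map_matrix_def sum_distrib_left mult_ac)
  show ?thesis
    by (simp only: hermitian_half_space_def positive_definite_def im_form_def mem_Collect_eq 1 2 simp_thms)
qed

lemma im_form_eq:
  "im_form Z x = Re (1 / (2 * \<i>) *
    (\<Sum>s\<in>UNIV. \<Sum>t\<in>UNIV. cnj (x $ s) * (Z $ s $ t - cnj (Z $ t $ s)) * x $ t))"
  by (simp add: im_form_def ip_def matrix_vector_mult_def sum_distrib_left mult.assoc)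

lemma Re_complex_of_real_mult: "Re (of_real r * z) = r * Re z"
  by simp

lemma im_form_scale: "im_form Z (c *\<^sub>R x) = c\<^sup>2 * im_form Z x"
proof -
  have c: "(c *\<^sub>R x) $ n = of_real c * x $ n" for n
    unfolding vector_scaleR_component by (rule scaleR_conv_of_real)
  have "(\<Sum>s\<in>UNIV. \<Sum>t\<in>UNIV. cnj ((c *\<^sub>R x) $ s) * A s t * (c *\<^sub>R x) $ t) =
      of_real (c\<^sup>2) * (\<Sum>s\<in>UNIV. \<Sum>t\<in>UNIV. cnj (x $ s) * A s t * x $ t)" for A :: "'a \<Rightarrow> 'a \<Rightarrow> complex"
    unfolding c sum_distrib_left by (intro sum.cong refl) (simp add: power2_eq_square)
  then show ?thesis
    unfolding im_form_eq by (simp only: mult.left_commute[of "1 / (2 * \<i>)"]) simp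
qed

text \<open>By homogeneity positivity need only be tested on the unit sphere, and compactness of the
  sphere makes the set of \<open>Z\<close> that fail at some unit vector closed.\<close>

lemma open_half_space: "open (hermitian_half_space :: (complex^'n::finite^'n) set)"
proof -
  let ?T = "{p :: (complex^'n) \<times> (complex^'n^'n). im_form (snd p) (fst p) \<le> 0}"
  have "closed ?T"
    unfolding im_form_eq by (intro closed_Collect_le continuous_intros)
  then have cl: "closed {Z :: complex^'n^'n. \<exists>x. x \<in> sphere 0 1 \<and> (x, Z) \<in> ?T}"
    by (intro closed_compact_projection) auto
  have eq: "- {Z :: complex^'n^'n. \<exists>x. x \<in> sphere 0 1 \<and> (x, Z) \<in> ?T} = hermitian_half_space"
  proof (intro equalityI subsetI)
    fix Z :: "complex^'n^'n" assume Z: "Z \<in> - {Z. \<exists>x. x \<in> sphere 0 1 \<and> (x, Z) \<in> ?T}"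
    show "Z \<in> hermitian_half_space"
      unfolding half_space_iff
    proof (intro allI impI)
      fix x :: "complex^'n" assume x: "x \<noteq> 0"
      let ?y = "(1 / norm x) *\<^sub>R x"
      have "?y \<in> sphere 0 1" using x by simp
      with Z have "0 < im_form Z ?y" by (auto simp: not_le[symmetric])
      then show "0 < im_form Z x"
        using x by (simp only: im_form_scale) (simp add: zero_less_mult_iff)
    qed
  next
    fix Z :: "complex^'n^'n" assume "Z \<in> hermitian_half_space"
    then have "0 < im_form Z x" if "x \<in> sphere 0 1" for x
    proof -
      have "x \<noteq> 0" using that by auto
      then show ?thesis using \<open>Z \<in> hermitian_half_space\<close> by (simp add: half_space_iff)
    qed
    then show "Z \<in> - {Z. \<exists>x. x \<in> sphere 0 1 \<and> (x, Z) \<in> ?T}"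
      by (auto simp: not_le[symmetric])
  qed
  show ?thesis unfolding eq[symmetric] by (rule open_Compl[OF cl])
qed

text \<open>Convexity serves \<open>modular_form_zero\<close>: a form whose derivative vanishes on
  the half-space is constant there.\<close>

lemma convex_half_space: "convex (hermitian_half_space :: (complex^'n::finite^'n) set)"
proof (rule convexI)
  fix Z W :: "complex^'n^'n" and u v :: real
  assume Z: "Z \<in> hermitian_half_space" and W: "W \<in> hermitian_half_space"
    and uv: "0 \<le> u" "0 \<le> v" "u + v = 1"
  have lin: "im_form (u *\<^sub>R Z + v *\<^sub>R W) x = u * im_form Z x + v * im_form W x" for x
  proof -
    have entry: "(u *\<^sub>R Z + v *\<^sub>R W) $ s $ t = of_real u * Z $ s $ t + of_real v * W $ s $ t" for s t
      by (simp add: complex_eq_iff)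
    have summand: "cnj (x $ s) * (of_real u * Z $ s $ t + of_real v * W $ s $ t -
          cnj (of_real u * Z $ t $ s + of_real v * W $ t $ s)) * x $ t =
        of_real u * (cnj (x $ s) * (Z $ s $ t - cnj (Z $ t $ s)) * x $ t) +
        of_real v * (cnj (x $ s) * (W $ s $ t - cnj (W $ t $ s)) * x $ t)" for s t
    proof -
      have "p * (r * a + q * b - (r * c + q * d)) * y = r * (p * (a - c) * y) + q * (p * (b - d) * y)"
        for a b c d p q r y :: complex
        by (simp add: algebra_simps)
      then show ?thesis
        by (simp only: complex_cnj_add complex_cnj_mult complex_cnj_complex_of_real)
    qed
    have re: "Re (c * (of_real u * a + of_real v * b)) = u * Re (c * a) + v * Re (c * b)" for a b c
    proof -
      have "c * (of_real u * a + of_real v * b) = of_real u * (c * a) + of_real v * (c * b)"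
        by (simp only: distrib_left mult.left_commute)
      then show ?thesis by (simp only: plus_complex.sel Re_complex_of_real_mult)
    qed
    show ?thesis
      unfolding im_form_eq entry summand sum.distrib sum_distrib_left[symmetric] re ..
  qed
  show "u *\<^sub>R Z + v *\<^sub>R W \<in> hermitian_half_space"
    unfolding half_space_iff
  proof (intro allI impI)
    fix x :: "complex^'n" assume "x \<noteq> 0"
    then have pos: "0 < im_form Z x" "0 < im_form W x"
      using Z W by (simp_all add: half_space_iff)
    show "0 < im_form (u *\<^sub>R Z + v *\<^sub>R W) x"
    proof (cases "u = 0")
      case True
      then show ?thesis using uv pos by (simp add: lin)
    next
      case False
      then have "0 < u * im_form Z x" using uv pos by simp
      moreover have "0 \<le> v * im_form W x" using uv pos by simp
      ultimately show ?thesis by (simp add: lin)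
    qed
  qed
qed

lemma scaled_identity_half_space: "0 < y \<Longrightarrow> mat (\<i> * of_real y) \<in> hermitian_half_space"
proof -
  assume y: "0 < y"
  have "ip x ((mat (\<i> * of_real y) - ct (mat (\<i> * of_real y))) *v x) = 2 * \<i> * of_real y * ip x x"
    for x :: "complex^'a"
  proof -
    have "mat (\<i> * of_real y) - ct (mat (\<i> * of_real y)) = (mat (2 * \<i> * of_real y) :: complex^'a^'a)"
      by (auto simp: vec_eq_iff mat_def)
    moreover have "mat c *v x = c *s x" for c :: complex
    proof -
      have "mat c $ i $ j * x $ j = (if j = i then c * x $ i else 0)" for i j
        by (simp add: mat_def)
      then show ?thesis by (simp add: vec_eq_iff matrix_vector_mult_def)
    qed
    ultimately show ?thesis by (simp add: ip_def sum_distrib_left mult_ac)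
  qed
  then show ?thesis
    using y by (simp add: half_space_iff im_form_def ip_self)
qed

subsection \<open>Block matrices\<close>

definition blk :: "complex^'n^'n \<Rightarrow> complex^'n^'n \<Rightarrow> complex^'n^'n \<Rightarrow> complex^'n^'n \<Rightarrow> complex^('n::finite+'n)^('n+'n)" where
  "blk A B C D = (\<chi> i j. case i of
     Inl s \<Rightarrow> (case j of Inl t \<Rightarrow> A $ s $ t | Inr t \<Rightarrow> B $ s $ t)
   | Inr s \<Rightarrow> (case j of Inl t \<Rightarrow> C $ s $ t | Inr t \<Rightarrow> D $ s $ t))"

lemma blk_nth [simp]:
  "blk A B C D $ Inl s $ Inl t = A $ s $ t" "blk A B C D $ Inl s $ Inr t = B $ s $ t"
  "blk A B C D $ Inr s $ Inl t = C $ s $ t" "blk A B C D $ Inr s $ Inr t = D $ s $ t"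
  by (simp_all add: blk_def)

lemma block_blk [simp]:
  "block_A (blk A B C D) = A" "block_B (blk A B C D) = B"
  "block_C (blk A B C D) = C" "block_D (blk A B C D) = D"
  by (simp_all add: vec_eq_iff block_A_def block_B_def block_C_def block_D_def)

lemma vec_eq_iff_sum:
  "U = V \<longleftrightarrow> (\<forall>s t. U $ Inl s $ Inl t = V $ Inl s $ Inl t \<and> U $ Inl s $ Inr t = V $ Inl s $ Inr t \<and>
     U $ Inr s $ Inl t = V $ Inr s $ Inl t \<and> U $ Inr s $ Inr t = V $ Inr s $ Inr t)"
  for U V :: "complex^('n::finite+'n)^('n+'n)"
proof
  assume R: "\<forall>s t. U $ Inl s $ Inl t = V $ Inl s $ Inl t \<and> U $ Inl s $ Inr t = V $ Inl s $ Inr t \<and>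
     U $ Inr s $ Inl t = V $ Inr s $ Inl t \<and> U $ Inr s $ Inr t = V $ Inr s $ Inr t"
  have "U $ i $ j = V $ i $ j" for i j
    by (cases i; cases j) (simp_all add: R)
  then show "U = V" by (simp add: vec_eq_iff)
qed simp

lemma blk_blocks: "blk (block_A \<gamma>) (block_B \<gamma>) (block_C \<gamma>) (block_D \<gamma>) = \<gamma>"
  by (simp add: vec_eq_iff_sum block_A_def block_B_def block_C_def block_D_def)

lemma blk_eq_iff: "blk A B C D = blk A' B' C' D' \<longleftrightarrow> A = A' \<and> B = B' \<and> C = C' \<and> D = D'"
proof
  assume eq: "blk A B C D = blk A' B' C' D'"
  show "A = A' \<and> B = B' \<and> C = C' \<and> D = D'"
    using arg_cong[OF eq, of block_A] arg_cong[OF eq, of block_B]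
      arg_cong[OF eq, of block_C] arg_cong[OF eq, of block_D] by simp
qed simp

lemma sum_UNIV_sum:
  fixes f :: "'a::finite + 'b::finite \<Rightarrow> 'c::comm_monoid_add"
  shows "(\<Sum>i\<in>UNIV. f i) = (\<Sum>s\<in>UNIV. f (Inl s)) + (\<Sum>t\<in>UNIV. f (Inr t))"
proof -
  have "(\<Sum>i\<in>range Inl \<union> range Inr. f i) = (\<Sum>i\<in>range Inl. f i) + (\<Sum>i\<in>range Inr. f i)"
    by (rule sum.union_disjoint) auto
  then show ?thesis
    unfolding UNIV_sum[symmetric] by (simp add: sum.reindex)
qed

lemma prod_UNIV_sum:
  fixes f :: "'a::finite + 'b::finite \<Rightarrow> 'c::comm_monoid_mult"
  shows "(\<Prod>i\<in>UNIV. f i) = (\<Prod>s\<in>UNIV. f (Inl s)) * (\<Prod>t\<in>UNIV. f (Inr t))"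
proof -
  have "(\<Prod>i\<in>range Inl \<union> range Inr. f i) = (\<Prod>i\<in>range Inl. f i) * (\<Prod>i\<in>range Inr. f i)"
    by (rule prod.union_disjoint) auto
  then show ?thesis
    unfolding UNIV_sum[symmetric] by (simp add: prod.reindex)
qed

lemma blk_mult:
  "blk A B C D ** blk A' B' C' D' =
    blk (A ** A' + B ** C') (A ** B' + B ** D') (C ** A' + D ** C') (C ** B' + D ** D')"
  by (simp add: vec_eq_iff_sum matrix_matrix_mult_def sum_UNIV_sum)

lemma ct_blk: "ct (blk A B C D) = blk (ct A) (ct C) (ct B) (ct D)"
  by (simp add: vec_eq_iff_sum)

lemma mat_1_blk: "mat 1 = blk (mat 1) 0 0 (mat 1)"
  by (simp add: vec_eq_iff_sum mat_def)

lemma J_blk: "J_form = blk 0 (mat (- \<i>)) (mat \<i>) 0"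
  by (auto simp: vec_eq_iff_sum J_form_def mat_def)

lemma mat_mult_left: "(mat c ** A) $ i $ j = c * A $ i $ j"
  for A :: "complex^'m^'n::finite"
proof -
  have "mat c $ i $ l * A $ l $ j = (if l = i then c * A $ i $ j else 0)" for l
    by (simp add: mat_def)
  then show ?thesis by (simp add: matrix_matrix_mult_def)
qed

lemma mat_mult_right: "(A ** mat c) $ i $ j = c * A $ i $ j"
  for A :: "complex^'n::finite^'m"
proof -
  have "A $ i $ l * mat c $ l $ j = (if l = j then c * A $ i $ j else 0)" for l
    by (simp add: mat_def)
  then show ?thesis by (simp add: matrix_matrix_mult_def)
qed

lemma matrix_mult_0 [simp]: "(0 :: complex^'n::finite^'m) ** A = 0" "B ** (0 :: complex^'n^'m::finite) = 0"
  by (simp_all add: vec_eq_iff matrix_matrix_mult_def)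

lemma matrix_diff_ldistrib: "A ** (B - C) = A ** B - A ** C"
  for A :: "complex^'n::finite^'m" and B C :: "complex^'l^'n"
  by (simp add: vec_eq_iff matrix_matrix_mult_def right_diff_distrib sum_subtractf)

lemma matrix_diff_rdistrib: "(A - B) ** C = A ** C - B ** C"
  for A B :: "complex^'n::finite^'m" and C :: "complex^'l^'n"
  by (simp add: vec_eq_iff matrix_matrix_mult_def left_diff_distrib sum_subtractf)

text \<open>The blocks of \<open>J_form\<close> are scalar, so a factor \<open>\<i>\<close> cancels
  from each of the four block equations.\<close>

lemma blk_unitary_iff:
  "blk A B C D \<in> unitary_nn \<longleftrightarrow>
    ct A ** C = ct C ** A \<and> ct A ** D - ct C ** B = mat 1 \<and> ct D ** A - ct B ** C = mat 1 \<and>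
    ct B ** D = ct D ** B"
proof -
  have i: "mat \<i> ** M = M ** mat \<i>" "mat (- \<i>) ** M = - (M ** mat \<i>)" "M ** mat (- \<i>) = - (M ** mat \<i>)"
    for M :: "complex^'n^'n"
    by (simp_all add: vec_eq_iff mat_mult_left mat_mult_right)
  have can: "U ** mat \<i> = V ** mat \<i> \<longleftrightarrow> U = V" for U V :: "complex^'n^'n"
    by (simp add: vec_eq_iff mat_mult_right)
  have can0: "X1 ** mat \<i> - X2 ** mat \<i> = 0 \<longleftrightarrow> X1 = X2" for X1 X2 :: "complex^'n^'n"
    by (simp add: can)
  have can1: "X1 ** mat \<i> - X2 ** mat \<i> = mat 1 ** mat \<i> \<longleftrightarrow> X1 - X2 = mat 1" for X1 X2 :: "complex^'n^'n"
    unfolding matrix_diff_rdistrib[symmetric] can ..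
  have can2: "X1 ** mat \<i> - X2 ** mat \<i> = - (mat 1 ** mat \<i>) \<longleftrightarrow> X2 - X1 = mat 1" for X1 X2 :: "complex^'n^'n"
    unfolding can1[symmetric] by (subst equation_minus_iff) (auto simp only: minus_diff_eq)
  have e1: "ct (blk A B C D) ** J_form ** blk A B C D =
      blk (ct C ** A ** mat \<i> - ct A ** C ** mat \<i>) (ct C ** B ** mat \<i> - ct A ** D ** mat \<i>)
          (ct D ** A ** mat \<i> - ct B ** C ** mat \<i>) (ct D ** B ** mat \<i> - ct B ** D ** mat \<i>)"
  proof -
    have m: "(M ** mat \<i>) ** M' = M ** M' ** mat \<i>" for M M' :: "complex^'n^'n"
      by (simp only: matrix_mul_assoc[symmetric] i)
    have neg: "(- M) ** M' = - (M ** M')" for M M' :: "complex^'n^'n"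
      by (simp add: vec_eq_iff matrix_matrix_mult_def sum_negf)
    show ?thesis
      by (simp add: ct_blk J_blk blk_mult i(3) neg m)
  qed
  have e2: "J_form = blk 0 (- (mat 1 ** mat \<i>)) (mat 1 ** mat \<i>) (0 :: complex^'n^'n)"
  proof -
    have "mat (- \<i>) = - (mat \<i> :: complex^'n^'n)"
      by (auto simp: vec_eq_iff mat_def)
    then show ?thesis by (simp add: J_blk)
  qed
  show ?thesis
    unfolding unitary_nn_def mem_Collect_eq e1 unfolding e2 blk_eq_iff can0 can1 can2 by auto
qed

section \<open>The action of the unitary group on the half-space\<close>

lemma unitary_nn_mult:
  fixes \<gamma> \<delta> :: "complex^('n::finite+'n)^('n+'n)"
  assumes "\<gamma> \<in> unitary_nn" "\<delta> \<in> unitary_nn"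
  shows "\<gamma> ** \<delta> \<in> unitary_nn"
proof -
  have "ct (\<gamma> ** \<delta>) ** J_form ** (\<gamma> ** \<delta>) = ct \<delta> ** (ct \<gamma> ** J_form ** \<gamma>) ** \<delta>"
    by (simp add: ct_mult matrix_mul_assoc)
  then show ?thesis using assms by (simp add: unitary_nn_def)
qed

text \<open>Up to the factor \<open>\<i>\<close>, this is the invariance of the form
  \<open>J_form\<close> evaluated on the block column with entries \<open>Z\<close> and
  \<open>1\<close>.\<close>

lemma unitary_action_identity:
  fixes A B C D Z :: "complex^'n^'n::finite"
  assumes "blk A B C D \<in> unitary_nn"
  shows "ct (C ** Z + D) ** (A ** Z + B) - ct (A ** Z + B) ** (C ** Z + D) = Z - ct Z"
proof -
  note r = assms[unfolded blk_unitary_iff]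
  have "ct (C ** Z + D) ** (A ** Z + B) - ct (A ** Z + B) ** (C ** Z + D) =
      ct Z ** (ct C ** A - ct A ** C) ** Z - ct Z ** (ct A ** D - ct C ** B) +
      (ct D ** A - ct B ** C) ** Z + (ct D ** B - ct B ** D)"
    by (simp only: ct_add ct_mult matrix_add_ldistrib matrix_add_rdistrib matrix_diff_ldistrib
        matrix_diff_rdistrib matrix_mul_assoc) (simp only: diff_conv_add_uminus minus_add minus_minus add_ac)
  moreover have "ct C ** A - ct A ** C = 0" "ct D ** B - ct B ** D = 0"
    "ct A ** D - ct C ** B = mat 1" "ct D ** A - ct B ** C = mat 1"
    using r by simp_all
  ultimately show ?thesis by simp
qed

lemma im_form_action:
  fixes Z P R :: "complex^'n^'n::finite"
  assumes "ct R ** P - ct P ** R = Z - ct Z"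
  shows "im_form Z x = Re (1 / (2 * \<i>) * (ip (R *v x) (P *v x) - ip (P *v x) (R *v x)))"
proof -
  have "(Z - ct Z) *v x = ct R *v (P *v x) - ct P *v (R *v x)"
    by (simp add: assms[symmetric] matrix_vector_mult_diff_rdistrib matrix_vector_mul_assoc)
  then show ?thesis by (simp add: im_form_def ip_diff_right ip_adjoint)
qed

text \<open>A kernel vector of \<open>C Z + D\<close> would annihilate the right side of
  \<open>im_form_action\<close>, against positivity.\<close>

lemma det_denominator:
  assumes "blk A B C D \<in> unitary_nn" "Z \<in> hermitian_half_space"
  shows "det (C ** Z + D) \<noteq> 0"
proof -
  have "x = 0" if x: "(C ** Z + D) *v x = 0" for x
  proof (rule ccontr)
    assume "x \<noteq> 0"
    with assms(2) have "0 < im_form Z x" by (simp add: half_space_iff)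
    moreover have "im_form Z x = 0"
      by (simp add: im_form_action[OF unitary_action_identity[OF assms(1)]] x ip_def)
    ultimately show False by simp
  qed
  then have "\<exists>B. B ** (C ** Z + D) = mat 1"
    by (simp add: matrix_left_invertible_ker)
  then show ?thesis
    by (auto simp: invertible_det_nz[symmetric] invertible_left_inverse)
qed

text \<open>The substitution \<open>y = (C Z + D) x\<close> identifies the form of the image point
  at \<open>y\<close> with the form of \<open>Z\<close> at \<open>x\<close>.\<close>

lemma action_half_space:
  assumes "blk A B C D \<in> unitary_nn" "Z \<in> hermitian_half_space"
  shows "(A ** Z + B) ** matrix_inv (C ** Z + D) \<in> hermitian_half_space"
proof -
  define P where "P = A ** Z + B"
  define R where "R = C ** Z + D"
  define V where "V = P ** matrix_inv R"
  have R: "det R \<noteq> 0" unfolding R_def by (rule det_denominator[OF assms])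
  have VR: "V ** R = P"
    by (simp add: V_def matrix_mul_assoc[symmetric] matrix_inv_mult(2)[OF R])
  have "0 < im_form V y" if y: "y \<noteq> 0" for y
  proof -
    define x where "x = matrix_inv R *v y"
    have Rx: "R *v x = y"
      by (simp add: x_def matrix_vector_mul_assoc matrix_inv_mult(1)[OF R])
    then have "x \<noteq> 0" using y by auto
    then have "0 < im_form Z x" using assms(2) by (simp add: half_space_iff)
    also have "im_form Z x = Re (1 / (2 * \<i>) * (ip (R *v x) (P *v x) - ip (P *v x) (R *v x)))"
      unfolding P_def R_def by (rule im_form_action[OF unitary_action_identity[OF assms(1)]])
    also have "P *v x = V *v y"
      by (simp add: VR[symmetric] Rx[symmetric] matrix_vector_mul_assoc)
    also have "Re (1 / (2 * \<i>) * (ip (R *v x) (V *v y) - ip (V *v y) (R *v x))) = im_form V y"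
      by (simp add: Rx im_form_def matrix_vector_mult_diff_rdistrib ip_diff_right ip_adjoint)
    finally show ?thesis .
  qed
  then show ?thesis by (simp add: half_space_iff V_def P_def R_def)
qed

subsection \<open>Determinants of block matrices\<close>

text \<open>A permutation that moves some \<open>Inr t\<close> meets a zero entry. The remaining
  ones are the permutations of the first summand, and extension by the identity preserves the
  sign.\<close>

lemma det_blk_diag1:
  fixes A :: "complex^'n^'n::finite"
  shows "det (blk A 0 0 (mat 1)) = det A"
proof -
  let ?M = "blk A 0 0 (mat 1)"
  let ?f = "\<lambda>p. of_int (sign p) * (\<Prod>i\<in>UNIV. ?M $ i $ p i)"
  let ?\<Phi> = "map_permutation (UNIV :: 'n set) (Inl :: 'n \<Rightarrow> 'n + 'n)"
  have bij: "bij_betw (Inl :: 'n \<Rightarrow> 'n + 'n) UNIV (range Inl)"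
    by (simp add: bij_betw_def)
  have "det ?M = (\<Sum>p | p permutes UNIV. ?f p)"
    by (simp add: det_def)
  also have "\<dots> = (\<Sum>p | p permutes (range Inl). ?f p)"
  proof (rule sum.mono_neutral_right)
    show "finite {p :: 'n + 'n \<Rightarrow> 'n + 'n. p permutes UNIV}"
      by (rule finite_permutations) simp
    show "{p. p permutes range Inl} \<subseteq> {p :: 'n + 'n \<Rightarrow> 'n + 'n. p permutes UNIV}"
      by (auto intro: permutes_subset)
    show "\<forall>p\<in>{p. p permutes UNIV} - {p. p permutes range Inl}. ?f p = 0"
    proof
      fix p :: "'n + 'n \<Rightarrow> 'n + 'n"
      assume p: "p \<in> {p. p permutes UNIV} - {p. p permutes range Inl}"
      have "\<exists>t. p (Inr t) \<noteq> Inr t"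
      proof (rule ccontr)
        assume "\<not> ?thesis"
        then have fixed: "p (Inr t) = Inr t" for t by simp
        have "p permutes range Inl"
        proof (rule permutes_superset[of p UNIV])
          show "p permutes UNIV" using p by simp
          fix i :: "'n + 'n" assume "i \<in> UNIV - range Inl"
          then show "p i = i" by (cases i) (simp_all add: fixed)
        qed
        with p show False by simp
      qed
      then obtain t where t: "p (Inr t) \<noteq> Inr t" ..
      have "?M $ Inr t $ p (Inr t) = 0"
        using t by (cases "p (Inr t)") (auto simp: mat_def)
      then have "(\<Prod>i\<in>UNIV. ?M $ i $ p i) = 0"
        by (intro prod_zero) auto
      then show "?f p = 0" by simp
    qed
  qed
  also have "\<dots> = (\<Sum>q | q permutes (UNIV :: 'n set). of_int (sign q) * (\<Prod>i\<in>UNIV. A $ i $ q i))"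
  proof (rule sum.reindex_bij_witness[of _ ?\<Phi> "map_permutation (range Inl) projl"])
    fix q :: "'n \<Rightarrow> 'n" assume "q \<in> {q. q permutes UNIV}"
    then show "map_permutation (range Inl) projl (?\<Phi> q) = q"
      by (intro map_permutation_compose_inv[OF bij]) auto
  next
    fix q :: "'n \<Rightarrow> 'n" assume "q \<in> {q. q permutes UNIV}"
    then show "?\<Phi> q \<in> {p. p permutes range Inl}"
      using map_permutation_permutes[OF bij] by auto
  next
    fix p :: "'n + 'n \<Rightarrow> 'n + 'n" assume "p \<in> {p. p permutes range Inl}"
    then have p: "p permutes range Inl" by simp
    have bij': "bij_betw (projl :: 'n + 'n \<Rightarrow> 'n) (range Inl) UNIV"
      by (rule bij_betw_byWitness[of _ Inl]) auto
    let ?q = "map_permutation (range Inl) projl p"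
    show inv: "?\<Phi> ?q = p"
      by (rule map_permutation_compose_inv[OF bij' p]) auto
    show q: "?q \<in> {q. q permutes UNIV}"
      using map_permutation_permutes[OF bij' p] by simp
    have sgn: "sign p = sign ?q"
      using sign_map_permutation[of "Inl :: 'n \<Rightarrow> 'n + 'n" UNIV ?q] q unfolding inv by simp
    have app: "p (Inl i) = Inl (?q i)" for i
      using map_permutation_apply[of "Inl :: 'n \<Rightarrow> 'n + 'n" UNIV i ?q] unfolding inv by simp
    have fix_Inr: "p (Inr i) = Inr i" for i
      using p by (auto simp: permutes_def)
    show "of_int (sign ?q) * (\<Prod>i\<in>UNIV. A $ i $ ?q i) = ?f p"
      by (simp add: sgn prod_UNIV_sum app fix_Inr mat_def)
  qed
  also have "\<dots> = det A" by (simp add: det_def)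
  finally show ?thesis .
qed

text \<open>The determinant is a homomorphism from the unipotent block matrices, which are conjugate
  to their squares by the diagonal matrix with entries \<open>2\<close> and \<open>1\<close>.\<close>

lemma det_blk_unipotent_upper:
  fixes B :: "complex^'a^'a::finite"
  shows "det (blk (mat 1) B 0 (mat 1)) = 1"
proof -
  let ?u = "\<lambda>B :: complex^'a^'a. blk (mat 1) B 0 (mat 1)"
  have u: "?u B ** ?u B' = ?u (B + B')" for B B' by (simp add: blk_mult add.commute)
  have "det (?u 0) = 1" unfolding mat_1_blk[symmetric] by (rule det_I)
  moreover have "det (?u B) * det (?u (- B)) = det (?u 0)"
    by (simp flip: det_mul add: u)
  ultimately have nz: "det (?u B) \<noteq> 0" by auto
  have two: "(mat 2 :: complex^'a^'a) ** B = B + B"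
    by (simp add: vec_eq_iff mat_mult_left)
  let ?d = "blk (mat 2) 0 0 (mat 1) :: complex^('a+'a)^('a+'a)"
  have "?d ** ?u B = ?u (B + B) ** ?d"
    by (simp add: blk_mult two)
  from arg_cong[OF this, of det] have "det ?d * det (?u B) = det (?u (B + B)) * det ?d"
    unfolding det_mul .
  moreover have "det ?d \<noteq> 0"
  proof -
    have "det (mat 2 :: complex^'a^'a) = (\<Prod>i\<in>UNIV. (mat 2 :: complex^'a^'a) $ i $ i)"
      by (intro det_diagonal) (simp add: mat_def)
    also have "\<dots> \<noteq> 0" by (simp add: mat_def)
    finally show ?thesis unfolding det_blk_diag1 .
  qed
  ultimately have "det (?u B) = det (?u (B + B))" by simp
  also have "\<dots> = det (?u B) * det (?u B)" by (simp flip: det_mul add: u)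
  finally show ?thesis using nz by simp
qed

lemma ct_unipotent: "ct (blk (mat 1) B 0 (mat 1)) = blk (mat 1) 0 (ct B) (mat 1)"
  by (auto simp: vec_eq_iff_sum mat_def)

lemma det_blk_unipotent_lower: "det (blk (mat 1) 0 C (mat 1)) = 1"
  using det_ct[of "blk (mat 1) (ct C) 0 (mat 1)"]
  by (simp add: ct_unipotent det_blk_unipotent_upper)

text \<open>Conjugation by a block rotation exchanges the two diagonal blocks.\<close>

lemma det_blk_diag2:
  fixes D :: "complex^'n^'n::finite"
  shows "det (blk (mat 1) 0 0 D) = det D"
proof -
  let ?w = "blk 0 (mat 1) (- mat 1) 0 :: complex^('n+'n)^('n+'n)"
  let ?w' = "blk 0 (- mat 1) (mat 1) 0 :: complex^('n+'n)^('n+'n)"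
  have neg: "(- M) ** M' = - (M ** M')" "M ** (- M') = - (M ** M')" for M M' :: "complex^'n^'n"
    by (simp_all add: vec_eq_iff matrix_matrix_mult_def sum_negf)
  have "?w ** ?w' = mat 1" by (simp add: blk_mult mat_1_blk neg)
  from arg_cong[OF this, of det] have ww: "det ?w * det ?w' = 1"
    unfolding det_mul det_I .
  have "?w ** blk D 0 0 (mat 1) ** ?w' = blk (mat 1) 0 0 D"
    by (simp add: blk_mult neg)
  from arg_cong[OF this, of det] have "det (blk (mat 1) 0 0 D) = (det ?w * det ?w') * det (blk D 0 0 (mat 1))"
    unfolding det_mul by (simp only: mult_ac)
  then show ?thesis by (simp only: ww det_blk_diag1 mult_1)
qed

text \<open>Block elimination: the unipotent matrix of \<open>Z\<close> creates the column
  \<open>A Z + B\<close>, \<open>C Z + D\<close>, whose upper entry is cleared with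
  \<open>V\<close>. For \<open>V\<close> the image of \<open>Z\<close> under the action this splits
  \<open>det \<gamma>\<close> into \<open>det N\<close> and \<open>det M\<close>; with
  \<open>Z = 0\<close> it yields \<open>det \<gamma>\<close> from
  \<open>V = B D\<^sup>-\<^sup>1\<close>.\<close>

lemma det_block_schur:
  fixes A B C D Z V :: "complex^'n^'n::finite"
  assumes V: "V ** (C ** Z + D) = A ** Z + B"
  shows "det (blk A B C D) = det (A - V ** C) * det (C ** Z + D)"
proof -
  let ?R = "C ** Z + D"
  have "blk A B C D ** blk (mat 1) Z 0 (mat 1) = blk (mat 1) V 0 (mat 1) ** blk (A - V ** C) 0 C ?R"
    by (simp add: blk_mult V)
  then have "det (blk A B C D) = det (blk (A - V ** C) 0 C ?R)"
    using det_mul[of "blk A B C D" "blk (mat 1) Z 0 (mat 1)"]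
      det_mul[of "blk (mat 1) V 0 (mat 1)" "blk (A - V ** C) 0 C ?R"]
    by (simp add: det_blk_unipotent_upper)
  also have "blk (A - V ** C) 0 C ?R =
      blk (A - V ** C) 0 0 (mat 1) ** (blk (mat 1) 0 C (mat 1) ** blk (mat 1) 0 0 ?R)"
    by (simp add: blk_mult)
  finally show ?thesis
    by (simp add: det_mul det_blk_diag1 det_blk_diag2 det_blk_unipotent_lower)
qed

section \<open>Number fields\<close>

lemma complex_ring_simps [simp]:
  "carrier complex_ring = UNIV" "x \<otimes>\<^bsub>complex_ring\<^esub> y = x * y" "x \<oplus>\<^bsub>complex_ring\<^esub> y = x + y"
  "\<one>\<^bsub>complex_ring\<^esub> = 1" "\<zero>\<^bsub>complex_ring\<^esub> = 0"
  by (simp_all add: ring_of_type_algebra_def)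

interpretation CR: domain complex_ring
  using field_from_type_algebra[where 'a = complex] by (rule field.axioms)

lemma complex_ring_pow [simp]: "x [^]\<^bsub>complex_ring\<^esub> (n::nat) = x ^ n"
  by (induction n) (simp_all add: mult.commute)

lemma complex_ring_minus [simp]: "\<ominus>\<^bsub>complex_ring\<^esub> x = - x"
  using CR.minus_equality[of "- x" x] by simp

lemma subfield_complex:
  assumes "subfield L complex_ring"
  shows "0 \<in> L" "1 \<in> L" "x \<in> L \<Longrightarrow> y \<in> L \<Longrightarrow> x + y \<in> L" "x \<in> L \<Longrightarrow> y \<in> L \<Longrightarrow> x * y \<in> L"
    "x \<in> L \<Longrightarrow> - x \<in> L" "x \<in> L \<Longrightarrow> inverse x \<in> L"
proof -
  have sr: "subring L complex_ring" using assms by (rule subfieldE)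
  show "0 \<in> L" "1 \<in> L" "x \<in> L \<Longrightarrow> y \<in> L \<Longrightarrow> x + y \<in> L" "x \<in> L \<Longrightarrow> y \<in> L \<Longrightarrow> x * y \<in> L"
    "x \<in> L \<Longrightarrow> - x \<in> L"
    using subringE(2,3,5,6,7)[OF sr] by simp_all
  show "inverse x \<in> L" if x: "x \<in> L"
  proof (cases "x = 0")
    case True
    with x show ?thesis by simp
  next
    case False
    then have "m_inv complex_ring x \<in> L" "x * m_inv complex_ring x = 1"
      using CR.subfield_m_inv[OF assms, of x] x by auto
    then show ?thesis using inverse_unique[of x "m_inv complex_ring x"] by simp
  qed
qed

text \<open>Coefficient lists carry the leading coefficient in front, hence the index
  \<open>length p - 1\<close>. The last clause bounds the degree, which keeps the leading
  coefficient visible when the list grows.\<close>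

lemma eval_complex_poly:
  assumes "set p \<subseteq> \<rat>"
  shows "\<exists>q. (\<forall>i. Polynomial.coeff q i \<in> \<rat>) \<and> CR.eval p x = poly q x \<and> (p \<noteq> [] \<longrightarrow> Polynomial.coeff q (length p - 1) = hd p) \<and>
    (\<forall>i\<ge>length p. Polynomial.coeff q i = 0)"
  using assms
proof (induction p)
  case Nil
  then show ?case by (intro exI[of _ 0]) simp
next
  case (Cons a p)
  then obtain q where q: "\<And>i. Polynomial.coeff q i \<in> \<rat>" "CR.eval p x = poly q x" "\<And>i. i \<ge> length p \<Longrightarrow> Polynomial.coeff q i = 0"
    by auto
  show ?case
    using Cons.prems q
    by (intro exI[of _ "Polynomial.monom a (length p) + q"]) (auto simp: poly_monom)
qed

lemma number_field_algebraic:
  assumes "number_field L" "x \<in> L"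
  shows "algebraic x"
proof -
  have L: "subfield L complex_ring" "ring.finite_dimension complex_ring \<rat> L"
    using assms(1) by (simp_all add: number_field_def)
  have Q: "subfield \<rat> complex_ring"
  proof (rule field.subfieldI'[OF field_from_type_algebra])
    show "subring \<rat> complex_ring"
      by (rule CR.subringI) auto
    show "inv\<^bsub>complex_ring\<^esub> k \<in> \<rat>" if "k \<in> \<rat> - {\<zero>\<^bsub>complex_ring\<^esub>}" for k
    proof -
      have "inv\<^bsub>complex_ring\<^esub> k = inverse k"
        using that by (intro CR.comm_inv_char) auto
      then show ?thesis using that by simp
    qed
  qed
  have "(CR.algebraic over \<rat>) x"
    using CR.finite_dimension_imp_algebraic[OF Q subfieldE(1)[OF L(1)] L(2) assms(2)] .
  then obtain p where p: "p \<in> carrier (\<rat> [X]\<^bsub>complex_ring\<^esub>)" "p \<noteq> []" "CR.eval p x = 0"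
    using CR.algebraicE[OF subfieldE(1)[OF Q], of x] by auto
  then have "set p \<subseteq> \<rat>" "hd p \<noteq> 0"
    by (auto simp: univ_poly_carrier[symmetric] polynomial_def)
  with p eval_complex_poly[of p x] obtain q where "\<And>i. Polynomial.coeff q i \<in> \<rat>" "poly q x = 0" "q \<noteq> 0"
    by (metis coeff_0)
  then show ?thesis
    by (auto simp: algebraic_altdef)
qed

lemma algebraic_multiple_int:
  assumes "algebraic (x :: complex)"
  obtains n :: nat where "n > 0" "algebraic_int (of_nat n * x)"
proof -
  obtain p where p: "\<And>i. Polynomial.coeff p i \<in> \<int>" "p \<noteq> 0" "poly p x = 0"
    using assms unfolding algebraic_def by auto
  define d where "d = Polynomial.degree p"
  define c where "c = Polynomial.lead_coeff p"
  have c: "c \<noteq> 0" "c \<in> \<int>" using p by (auto simp: c_def)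
  have d: "d > 0"
  proof (rule ccontr)
    assume "\<not> d > 0"
    then obtain a where "p = [:a:]" unfolding d_def by (auto elim: degree_eq_zeroE)
    then show False using p by simp
  qed
  \<comment> \<open>The coefficients are rescaled so that
    \<open>poly q (c * x) = c ^ (d - 1) * poly p x\<close>; this makes \<open>q\<close> monic while
    its coefficients stay integral.\<close>
  define q where "q = Polynomial.monom 1 d + (\<Sum>i<d. Polynomial.monom (Polynomial.coeff p i * c ^ (d - 1 - i)) i)"
  have deg: "Polynomial.degree (\<Sum>i<d. Polynomial.monom (Polynomial.coeff p i * c ^ (d - 1 - i)) i) < d"
    using d by (intro degree_sum_less) (auto intro: le_less_trans[OF degree_monom_le])
  have "Polynomial.lead_coeff q = 1"
  proof -
    have "Polynomial.degree q = d" unfolding q_def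
      using deg by (subst degree_add_eq_left) (simp_all add: degree_monom_eq)
    then show ?thesis using deg by (simp add: q_def coeff_eq_0)
  qed
  moreover have "\<forall>i. Polynomial.coeff q i \<in> \<int>"
    unfolding q_def coeff_add coeff_sum coeff_monom
    using p(1) c by (intro allI Ints_add Ints_sum) (auto intro!: Ints_mult Ints_power)
  moreover have "poly q (c * x) = 0"
  proof -
    have "poly q (c * x) = (c * x) ^ d + (\<Sum>i<d. Polynomial.coeff p i * c ^ (d - 1 - i) * (c * x) ^ i)"
      by (simp add: q_def poly_monom poly_sum)
    also have "(c * x) ^ d = c ^ (d - 1) * (Polynomial.coeff p d * x ^ d)"
    proof -
      have "c ^ d = c ^ (d - 1) * c" using d by (metis power_minus_mult)
      then show ?thesis by (simp add: power_mult_distrib c_def d_def)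
    qed
    also have "(\<Sum>i<d. Polynomial.coeff p i * c ^ (d - 1 - i) * (c * x) ^ i) = c ^ (d - 1) * (\<Sum>i<d. Polynomial.coeff p i * x ^ i)"
      unfolding sum_distrib_left
    proof (intro sum.cong refl)
      fix i assume "i \<in> {..<d}"
      then have "c ^ (d - 1) = c ^ (d - 1 - i) * c ^ i"
        by (simp flip: power_add)
      then show "Polynomial.coeff p i * c ^ (d - 1 - i) * (c * x) ^ i = c ^ (d - 1) * (Polynomial.coeff p i * x ^ i)"
        by (simp add: power_mult_distrib)
    qed
    also have "c ^ (d - 1) * (Polynomial.coeff p d * x ^ d) + c ^ (d - 1) * (\<Sum>i<d. Polynomial.coeff p i * x ^ i) = c ^ (d - 1) * poly p x"
    proof -
      have "poly p x = (\<Sum>i<d. Polynomial.coeff p i * x ^ i) + Polynomial.coeff p d * x ^ d"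
        unfolding poly_altdef d_def[symmetric] lessThan_Suc_atMost[symmetric] by simp
      then show ?thesis by (simp only: distrib_left add.commute)
    qed
    finally show ?thesis using p by simp
  qed
  ultimately have ai: "algebraic_int (c * x)"
    by (intro algebraic_int.intros)
  obtain m where m: "c = of_int m" using c by (auto elim: Ints_cases)
  have "algebraic_int (of_nat (nat \<bar>m\<bar>) * x)"
    using ai by (cases "m \<ge> 0") (auto simp: m)
  moreover have "nat \<bar>m\<bar> > 0" using c m by auto
  ultimately show ?thesis using that by blast
qed

lemma number_field_integer_multiple:
  assumes "number_field L" "x \<in> L"
  obtains n :: nat where "n > 0" "of_nat n * x \<in> ring_of_integers L"
proof -
  obtain n :: nat where n: "n > 0" "algebraic_int (of_nat n * x)"
    using algebraic_multiple_int[OF number_field_algebraic[OF assms]] .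
  have "subfield L complex_ring" using assms by (simp add: number_field_def)
  note c = subfield_complex[OF this]
  have "of_nat n \<in> L"
    by (induction n) (simp_all add: c)
  then have "of_nat n * x \<in> L" using assms(2) by (simp add: c)
  with n show ?thesis using that by (simp add: ring_of_integers_def)
qed

text \<open>The identity is one of the embeddings, so \<open>K\<close> is real and \<open>L\<close>
  is not. Completing the square for a nonreal element of \<open>L\<close> yields a purely imaginary
  generator over \<open>K\<close>.\<close>

lemma quadratic_extension_basis:
  assumes "totally_imaginary_quadratic_extension L K"
  obtains y :: real where "y \<noteq> 0" "\<i> * of_real y \<in> L" "of_real (y\<^sup>2) \<in> K"
    "L = {a + b * (\<i> * of_real y) | a b. a \<in> K \<and> b \<in> K}" "K \<subseteq> \<real>" "K \<subseteq> L"
    "subfield L complex_ring" "subfield K complex_ring" "number_field L"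
proof -
  have K: "totally_real K" and L: "totally_imaginary L" and KL: "K \<subseteq> L"
    and dim: "CR.dimension 2 K L"
    using assms by (auto simp: totally_imaginary_quadratic_extension_def)
  have nf: "number_field L" "number_field K"
    using K L by (auto simp: totally_real_def totally_imaginary_def)
  then have sf: "subfield L complex_ring" "subfield K complex_ring" by (auto simp: number_field_def)
  note l = subfield_complex[OF sf(1)] and k = subfield_complex[OF sf(2)]
  have id: "(\<lambda>x. x) \<in> field_embeddings M" for M
    by (simp add: field_embeddings_def ring_hom_def)
  have KR: "K \<subseteq> \<real>" using K id[of K] by (force simp: totally_real_def)
  have LR: "\<not> L \<subseteq> \<real>" using L id[of L] by (force simp: totally_imaginary_def)
  obtain u w where uw: "L = {a * u + b * w | a b. a \<in> K \<and> b \<in> K}"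
  proof -
    from dim obtain u E where E: "L = CR.line_extension K u E" "CR.dimension 1 K E"
      by (cases rule: CR.dimension.cases) (auto simp: numeral_2_eq_2)
    have dim_0: "E' = {0}" if "CR.dimension 0 K E'" for E'
      using that by (cases rule: CR.dimension.cases) auto
    from E(2)[unfolded One_nat_def] obtain w E' where "E = CR.line_extension K w E'" "CR.dimension 0 K E'"
      by (cases rule: CR.dimension.cases) auto
    then have w: "E = CR.line_extension K w {0}" using dim_0 by blast
    have "L = {a * u + b * w | a b. a \<in> K \<and> b \<in> K}"
      unfolding E(1) w CR.line_extension_def r_coset_def set_add_def set_mult_def by auto
    then show ?thesis by (rule that)
  qed
  obtain \<beta> where \<beta>: "\<beta> \<in> L" "\<beta> \<notin> \<real>" using LR by blast
  have "1 \<in> L" by (rule l)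
  then obtain a1 b1 where 1: "1 = a1 * u + b1 * w" "a1 \<in> K" "b1 \<in> K" unfolding uw by blast
  obtain a2 b2 where 2: "\<beta> = a2 * u + b2 * w" "a2 \<in> K" "b2 \<in> K" using \<beta>(1) unfolding uw by blast
  \<comment> \<open>The determinant of the change of basis from \<open>u\<close>, \<open>w\<close>
    to \<open>1\<close>, \<open>\<beta>\<close>. If it vanished, \<open>\<beta>\<close> would be a
    quotient of elements of \<open>K\<close> and hence real.\<close>
  define D where "D = a1 * b2 - a2 * b1"
  have DK: "D \<in> K" unfolding D_def diff_conv_add_uminus by (intro k 1 2)
  have "D \<noteq> 0"
  proof
    assume "D = 0"
    have "a1 * \<beta> = a2 * 1 + D * w" "b1 * \<beta> = b2 * 1 - D * u"
      unfolding 2(1) D_def by (subst 1(1), simp add: algebra_simps)+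
    then have e: "a1 * \<beta> = a2" "b1 * \<beta> = b2"
      using \<open>D = 0\<close> by simp_all
    have r: "a1 \<in> \<real>" "b1 \<in> \<real>" "a2 \<in> \<real>" "b2 \<in> \<real>" using KR 1(2,3) 2(2,3) by blast+
    have "\<beta> \<in> \<real>"
    proof (cases "a1 = 0")
      case True
      then have "b1 \<noteq> 0" using 1(1) by auto
      then have b: "\<beta> = b2 / b1" using e by (simp add: field_simps)
      show ?thesis unfolding b by (rule Reals_divide[OF r(4,2)])
    next
      case False
      then have b: "\<beta> = a2 / a1" using e by (simp add: field_simps)
      show ?thesis unfolding b by (rule Reals_divide[OF r(3,1)])
    qed
    with \<beta> show False by simp
  qed
  have span: "\<exists>a\<in>K. \<exists>b\<in>K. x = a + b * \<beta>" if xL: "x \<in> L" for x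
  proof -
    obtain a b where x: "x = a * u + b * w" "a \<in> K" "b \<in> K" using xL unfolding uw by blast
    have uD: "u * D = b2 * 1 - b1 * \<beta>" and wD: "w * D = - a2 * 1 + a1 * \<beta>"
      unfolding 2(1) D_def by (subst 1(1), simp add: algebra_simps)+
    have "x * D = a * (u * D) + b * (w * D)"
      unfolding x(1) by (simp add: algebra_simps)
    also have "\<dots> = (a * b2 - b * a2) + (b * a1 - a * b1) * \<beta>"
      unfolding uD wD by (simp add: algebra_simps)
    finally have "x * D = (a * b2 - b * a2) + (b * a1 - a * b1) * \<beta>" .
    then have "x = (a * b2 - b * a2) * inverse D + ((b * a1 - a * b1) * inverse D) * \<beta>"
      using \<open>D \<noteq> 0\<close> by (simp add: field_simps)
    moreover have "(a * b2 - b * a2) * inverse D \<in> K" "(b * a1 - a * b1) * inverse D \<in> K"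
      unfolding diff_conv_add_uminus by (intro k x 1 2 DK)+
    ultimately show ?thesis by blast
  qed
  obtain c b where cb: "c \<in> K" "b \<in> K" "\<beta> * \<beta> = c + b * \<beta>"
    using span[of "\<beta> * \<beta>"] l(4)[OF \<beta>(1) \<beta>(1)] by auto
  have reals: "Im c = 0" "Im b = 0" using KR cb by (auto simp: complex_is_Real_iff)
  define y where "y = Im \<beta>"
  have y: "y \<noteq> 0" using \<beta> by (simp add: y_def complex_is_Real_iff)
  \<comment> \<open>Imaginary parts are compared in
    \<open>\<beta> * \<beta> = c + b * \<beta>\<close> with real \<open>b\<close> and
    \<open>c\<close>; thus \<open>\<beta> - b / 2\<close> is purely imaginary.\<close>
  have re: "2 * Re \<beta> = Re b"
  proof -
    have "Im (\<beta> * \<beta>) = Im (c + b * \<beta>)" using cb by simp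
    then have "2 * Re \<beta> * Im \<beta> = Re b * Im \<beta>" using reals by (simp add: algebra_simps)
    then show ?thesis using y by (simp add: y_def)
  qed
  define h where "h = b * inverse (1 + 1)"
  have half: "h \<in> K" unfolding h_def by (intro k cb)
  have bh: "b = h + h" by (simp add: h_def)
  have iy: "\<i> * of_real y = \<beta> + - h"
    using re reals by (simp add: complex_eq_iff y_def h_def)
  show ?thesis
  proof (rule that)
    show "y \<noteq> 0" by fact
    show iyL: "\<i> * of_real y \<in> L" unfolding iy by (intro l \<beta> subsetD[OF KL half])
    show "of_real (y\<^sup>2) \<in> K"
    proof -
      have "of_real (y\<^sup>2) = - ((\<i> * of_real y) * (\<i> * of_real y))"
        by (simp add: power2_eq_square complex_eq_iff)
      also have "(\<i> * of_real y) * (\<i> * of_real y) = \<beta> * \<beta> - (h + h) * \<beta> + h * h"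
        unfolding iy by (simp add: algebra_simps)
      also have "\<beta> * \<beta> - (h + h) * \<beta> + h * h = c + h * h" unfolding cb(3) bh by simp
      finally show ?thesis using k(5)[OF k(3)[OF cb(1) k(4)[OF half half]]] by simp
    qed
    show "L = {a + b * (\<i> * of_real y) | a b. a \<in> K \<and> b \<in> K}"
    proof (intro equalityI subsetI)
      fix x assume "x \<in> L"
      then obtain a' b' where x: "a' \<in> K" "b' \<in> K" "x = a' + b' * \<beta>" using span by blast
      have "x = (a' + b' * h) + b' * (\<i> * of_real y)"
        unfolding x(3) iy by (simp add: algebra_simps)
      moreover have "a' + b' * h \<in> K" by (intro k x half)
      ultimately show "x \<in> {a + b * (\<i> * of_real y) | a b. a \<in> K \<and> b \<in> K}" using x by blast
    next
      fix x assume "x \<in> {a + b * (\<i> * of_real y) | a b. a \<in> K \<and> b \<in> K}"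
      then show "x \<in> L" using iyL KL by (auto intro!: l)
    qed
  qed (fact KR KL sf nf)+
qed

section \<open>Integrality in imaginary quadratic fields\<close>

definition ring_set :: "complex set \<Rightarrow> bool" where
  "ring_set R \<longleftrightarrow> 0 \<in> R \<and> 1 \<in> R \<and> (\<forall>x\<in>R. \<forall>y\<in>R. x + y \<in> R \<and> x * y \<in> R) \<and> (\<forall>x\<in>R. - x \<in> R)"

lemma ring_setI:
  assumes "0 \<in> R" "1 \<in> R" "\<And>x y. x \<in> R \<Longrightarrow> y \<in> R \<Longrightarrow> x + y \<in> R"
    "\<And>x y. x \<in> R \<Longrightarrow> y \<in> R \<Longrightarrow> x * y \<in> R" "\<And>x y. x \<in> R \<Longrightarrow> y \<in> R \<Longrightarrow> - x \<in> R"
  shows "ring_set R"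
  using assms by (auto simp: ring_set_def)

lemma ring_setD:
  assumes "ring_set R"
  shows "0 \<in> R" "1 \<in> R" "x \<in> R \<Longrightarrow> y \<in> R \<Longrightarrow> x + y \<in> R" "x \<in> R \<Longrightarrow> y \<in> R \<Longrightarrow> x * y \<in> R"
    "x \<in> R \<Longrightarrow> - x \<in> R" "x \<in> R \<Longrightarrow> y \<in> R \<Longrightarrow> x - y \<in> R"
proof -
  show a: "0 \<in> R" "1 \<in> R" "x \<in> R \<Longrightarrow> y \<in> R \<Longrightarrow> x + y \<in> R" "x \<in> R \<Longrightarrow> y \<in> R \<Longrightarrow> x * y \<in> R"
    "x \<in> R \<Longrightarrow> - x \<in> R" for x y
    using assms by (simp_all add: ring_set_def)
  show "x \<in> R \<Longrightarrow> y \<in> R \<Longrightarrow> x - y \<in> R"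
    using a(3)[of x "- y"] a(5)[of y] by simp
qed

lemma ring_set_sum: "ring_set R \<Longrightarrow> (\<And>i. i \<in> I \<Longrightarrow> f i \<in> R) \<Longrightarrow> sum f I \<in> R"
  by (induction I rule: infinite_finite_induct) (auto intro: ring_setD)

lemma ring_set_prod: "ring_set R \<Longrightarrow> (\<And>i. i \<in> I \<Longrightarrow> f i \<in> R) \<Longrightarrow> prod f I \<in> R"
  by (induction I rule: infinite_finite_induct) (auto intro: ring_setD)

lemma ring_set_power: "ring_set R \<Longrightarrow> x \<in> R \<Longrightarrow> x ^ n \<in> R"
  by (induction n) (auto intro: ring_setD)

lemma ring_set_of_nat: "ring_set R \<Longrightarrow> of_nat n \<in> R"
  by (induction n) (auto intro: ring_setD)

lemma ring_set_of_int: "ring_set R \<Longrightarrow> of_int n \<in> R"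
  by (cases n) (auto intro!: ring_setD(5) ring_set_of_nat simp del: of_nat_Suc)

lemma ring_set_matrix_mult:
  "ring_set R \<Longrightarrow> (\<And>i j. A $ i $ j \<in> R) \<Longrightarrow> (\<And>i j. B $ i $ j \<in> R) \<Longrightarrow> (A ** B) $ i $ j \<in> R"
  by (auto simp: matrix_matrix_mult_def intro!: ring_set_sum ring_setD(4))

lemma ring_set_det: "ring_set R \<Longrightarrow> (\<And>i j. A $ i $ j \<in> R) \<Longrightarrow> det A \<in> R"
  unfolding det_def by (intro ring_set_sum ring_setD(4) ring_set_of_int ring_set_prod) auto

lemma cnj_Rats: "x \<in> \<rat> \<Longrightarrow> cnj x = x" and Im_Rats: "x \<in> \<rat> \<Longrightarrow> Im x = 0"
proof -
  assume "x \<in> \<rat>"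
  then obtain a b where "x = of_int a / of_int b" by (rule Rats_cases')
  then have "x = of_real (of_int a / of_int b)" by simp
  then show "cnj x = x" "Im x = 0" by (metis complex_cnj_complex_of_real, metis Im_complex_of_real)
qed

section \<open>The localization of the integers at a prime, inside the complex numbers\<close>

definition local_ints :: "int \<Rightarrow> complex set" where
  "local_ints p = {of_int m / of_int n | m n. \<not> p dvd n}"

lemma local_intsI: "\<not> p dvd n \<Longrightarrow> of_int m / of_int n \<in> local_ints p"
  by (auto simp: local_ints_def)

lemma local_intsE:
  assumes "x \<in> local_ints p"
  obtains m n where "x = of_int m / of_int n" "\<not> p dvd n" "n \<noteq> 0"
  using assms by (auto simp: local_ints_def)

lemma local_ints_Rats: "x \<in> local_ints p \<Longrightarrow> x \<in> \<rat>"
  by (auto simp: local_ints_def)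

lemma ring_set_local_ints:
  assumes "Factorial_Ring.prime p"
  shows "ring_set (local_ints p)"
proof -
  have p1: "\<not> p dvd 1" using assms by (simp add: prime_int_iff)
  have i: "of_int m \<in> local_ints p" for m
    using local_intsI[OF p1, of m] by simp
  have cl: "x + y \<in> local_ints p" "x * y \<in> local_ints p" "- x \<in> local_ints p"
    if xy: "x \<in> local_ints p" "y \<in> local_ints p" for x y
  proof -
    obtain m n where x: "x = of_int m / of_int n" "\<not> p dvd n" "n \<noteq> 0" using xy(1) by (rule local_intsE)
    obtain m' n' where y: "y = of_int m' / of_int n'" "\<not> p dvd n'" "n' \<noteq> 0" using xy(2) by (rule local_intsE)
    have nn: "\<not> p dvd n * n'" using x y assms by (simp add: prime_dvd_mult_iff)
    have "x + y = of_int (m * n' + m' * n) / of_int (n * n')" "x * y = of_int (m * m') / of_int (n * n')"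
      "- x = of_int (- m) / of_int n"
      using x y by (simp_all add: add_frac_eq)
    then show "x + y \<in> local_ints p" "x * y \<in> local_ints p" "- x \<in> local_ints p"
      using nn x(2) by (auto intro: local_intsI simp del: of_int_add of_int_mult of_int_minus)
  qed
  have z: "0 \<in> local_ints p" "1 \<in> local_ints p" using i[of 0] i[of 1] by simp_all
  show ?thesis
    by (rule ring_setI, rule z(1), rule z(2), rule cl(1), assumption+, rule cl(2), assumption+, rule cl(3), assumption+)
qed

text \<open>The dichotomy of a valuation ring; the second alternative says that the inverse of
  \<open>x\<close> lies in the maximal ideal.\<close>

lemma local_ints_cases:
  assumes "Factorial_Ring.prime p" "x \<in> \<rat>"
  obtains "x \<in> local_ints p" | z where "z \<in> local_ints p" "x * (of_int p * z) = 1"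
proof -
  obtain m n where x: "n > 0" "coprime m n" "x = of_int m / of_int n"
    using assms(2) by (rule Rats_cases')
  show thesis
  proof (cases "p dvd n")
    case False
    then show ?thesis using that(1) x local_intsI by blast
  next
    case True
    then obtain n' where n': "n = p * n'" by (rule dvdE)
    have m: "\<not> p dvd m"
      using True x(2) assms(1) by (metis coprime_common_divisor not_prime_unit)
    then have m0: "m \<noteq> 0" by auto
    have "p \<noteq> 0" "n' \<noteq> 0" using x(1) n' by auto
    then have "x * (of_int p * (of_int n' / of_int m)) = 1"
      unfolding x(3) n' using m0 by simp
    then show ?thesis using that(2)[OF local_intsI[OF m, of n']] by simp
  qed
qed

lemma local_ints_not_unit:
  assumes "z \<in> local_ints p"
  shows "of_int p * z \<noteq> 1"
proof
  assume e: "of_int p * z = 1"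
  obtain m n where z: "z = of_int m / of_int n" "\<not> p dvd n" "n \<noteq> 0" using assms by (rule local_intsE)
  then have "(of_int (p * m) :: complex) = of_int n" using e unfolding z(1) by (simp add: divide_eq_eq)
  then have "p * m = n" by (simp only: of_int_eq_iff)
  then show False using z by auto
qed

lemma local_ints_unit:
  assumes "Factorial_Ring.prime p" "\<not> p dvd m" "z \<in> local_ints p"
  shows "of_int m + of_int p * z \<noteq> 0" "inverse (of_int m + of_int p * z) \<in> local_ints p"
proof -
  obtain a b where z: "z = of_int a / of_int b" "\<not> p dvd b" "b \<noteq> 0" using assms(3) by (rule local_intsE)
  have nd: "\<not> p dvd m * b + p * a"
  proof
    assume "p dvd m * b + p * a"
    then have "p dvd (m * b + p * a) - p * a" by (rule dvd_diff) (rule dvd_triv_left)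
    then have "p dvd m * b" by (simp only: add_diff_cancel_right')
    then show False using prime_dvd_multD[OF assms(1)] assms(2) z(2) by blast
  qed
  have eq: "of_int m + of_int p * z = of_int (m * b + p * a) / of_int b"
    unfolding z(1) using z(3) by (simp add: add_divide_distrib)
  have "m * b + p * a \<noteq> 0" using nd by force
  then show "of_int m + of_int p * z \<noteq> 0" unfolding eq using z(3)
    by (simp del: of_int_add of_int_mult)
  show "inverse (of_int m + of_int p * z) \<in> local_ints p"
    unfolding eq inverse_divide by (rule local_intsI[OF nd])
qed

text \<open>The valuation of \<open>p x\<^sup>2\<close> is odd, so being nonnegative it is at least
  one, and \<open>x\<close> has nonnegative valuation.\<close>

lemma local_ints_sqrt:
  assumes "Factorial_Ring.prime p" "x \<in> \<rat>" "of_int p * (x * x) \<in> local_ints p"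
  shows "x \<in> local_ints p"
  using assms(1,2)
proof (cases rule: local_ints_cases)
  case (2 z)
  note r = ring_setD(4)[OF ring_set_local_ints[OF assms(1)]]
  have "of_int p * (of_int p * (x * x) * (z * z)) = (x * (of_int p * z)) * (x * (of_int p * z))"
    by (simp add: algebra_simps)
  also have "\<dots> = 1" using 2 by simp
  finally show ?thesis
    using local_ints_not_unit[OF r[OF assms(3) r[OF 2(1) 2(1)]]] by simp
qed

section \<open>Norm forms at a ramified prime\<close>

lemma quadratic_norm:
  assumes "cnj l = of_int t - l" "l * cnj l = of_int n" "a \<in> \<rat>" "b \<in> \<rat>"
  shows "(a + b * l) * cnj (a + b * l) = a * a + of_int t * (a * b) + of_int n * (b * b)"
proof -
  have r: "cnj a = a" "cnj b = b"
    using assms(3,4) by (simp_all add: cnj_Rats)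
  have "(a + b * l) * (a + b * (u - l)) = a * a + u * (a * b) + (l * (u - l)) * (b * b)" for u
    by (simp add: algebra_simps)
  then show ?thesis using assms(1,2) r by simp
qed

text \<open>An Eisenstein situation: the terms \<open>a\<^sup>2\<close> and
  \<open>n b\<^sup>2\<close> of the norm form have valuations of different parity and cannot cancel,
  and the mixed term is smaller \<open>p\<close>-adically because \<open>p\<close> divides
  \<open>t\<close>.\<close>

lemma quadratic_local_integral:
  assumes p: "Factorial_Ring.prime p" and t: "p dvd t" and n: "p dvd n" "\<not> p\<^sup>2 dvd n"
    and l: "cnj l = of_int t - l" "l * cnj l = of_int n" and ab: "a \<in> \<rat>" "b \<in> \<rat>"
  shows "(a + b * l) * cnj (a + b * l) \<in> local_ints p \<longleftrightarrow> a \<in> local_ints p \<and> b \<in> local_ints p"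
proof
  note rs = ring_set_local_ints[OF p]
  note r = ring_setD[OF rs] and ri = ring_set_of_int[OF rs]
  note norm = quadratic_norm[OF l ab]
  show "(a + b * l) * cnj (a + b * l) \<in> local_ints p" if "a \<in> local_ints p \<and> b \<in> local_ints p"
    unfolding norm using that by (intro r ri) auto
  show "a \<in> local_ints p \<and> b \<in> local_ints p" if N: "(a + b * l) * cnj (a + b * l) \<in> local_ints p"
  proof -
    obtain t' where t': "t = p * t'" using t by (rule dvdE)
    obtain n' where n': "n = p * n'" using n by auto
    have nn': "\<not> p dvd n'" using n(2) unfolding n' power2_eq_square by auto
    have np1: "\<not> p dvd 1" using p by (simp add: prime_int_iff)
    show ?thesis
    proof (cases "b = 0")
      case True
      have "a * a + of_int t * (a * b) + of_int n * (b * b) \<in> local_ints p" using N by (simp only: norm)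
      then have "a * a \<in> local_ints p" using True by simp
      then have "a \<in> local_ints p" by (rule local_ints_sqrt[OF p ab(1) r(4)[OF ri]])
      then show ?thesis using True r by simp
    next
      case False
      have "a / b \<in> \<rat>" using ab by simp
      \<comment> \<open>If \<open>b / a\<close> is integral at \<open>p\<close>, the norm is
        \<open>a * a\<close> times a unit congruent to 1 modulo \<open>p\<close>.\<close>
      have main: ?thesis if c: "c \<in> local_ints p" "b = c * a" for c
      proof -
        define u :: complex where "u = of_int t' * c + of_int n' * (c * c)"
        have u: "u \<in> local_ints p" unfolding u_def by (intro r ri c)
        have f: "a * a + of_int t * (a * b) + of_int n * (b * b) = (of_int 1 + of_int p * u) * (a * a)"
          unfolding c(2) u_def t' n' by (simp add: algebra_simps)
        have "inverse (of_int 1 + of_int p * u) * ((a + b * l) * cnj (a + b * l)) = a * a"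
          unfolding norm f using local_ints_unit(1)[OF p np1 u] by (simp add: field_simps)
        then have "a * a \<in> local_ints p"
          using r(4)[OF local_ints_unit(2)[OF p np1 u] N] by simp
        then have "a \<in> local_ints p" by (rule local_ints_sqrt[OF p ab(1) r(4)[OF ri]])
        then show ?thesis using c r(4) by simp
      qed
      \<comment> \<open>In the opposite case \<open>a / b\<close> is divisible by \<open>p\<close>,
        and the norm is \<open>p * (b * b)\<close> times a unit congruent to
        \<open>n' = n / p\<close>, which is prime to \<open>p\<close>.\<close>
      have second: ?thesis if c: "c \<in> local_ints p" "a = of_int p * c * b" for c
      proof -
        define u :: complex where "u = c * c + of_int t' * c"
        have u: "u \<in> local_ints p" unfolding u_def by (intro r ri c)
        have f: "a * a + of_int t * (a * b) + of_int n * (b * b) = (of_int n' + of_int p * u) * (of_int p * (b * b))"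
          unfolding c(2) u_def t' n' by (simp add: algebra_simps)
        have "inverse (of_int n' + of_int p * u) * ((a + b * l) * cnj (a + b * l)) = of_int p * (b * b)"
          unfolding norm f using local_ints_unit(1)[OF p nn' u] by (simp add: field_simps)
        then have "of_int p * (b * b) \<in> local_ints p"
          using r(4)[OF local_ints_unit(2)[OF p nn' u] N] by simp
        then have "b \<in> local_ints p" by (rule local_ints_sqrt[OF p ab(2)])
        then show ?thesis using c r(4) ri by simp
      qed
      show ?thesis
      proof (cases "a = 0")
        case True
        then show ?thesis using second[of 0] r by simp
      next
        case a0: False
        have "b / a \<in> \<rat>" using ab by simp
        with p show ?thesis
        proof (cases rule: local_ints_cases)
          case 1
          then show ?thesis using main[of "b / a"] a0 by simp
        next
          case (2 z)
          then have "a = of_int p * z * b" using a0 by (simp add: field_simps)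
          then show ?thesis using second 2 by simp
        qed
      qed
    qed
  qed
qed

text \<open>At a ramified prime the elements with \<open>p\<close>-integral norm form the ring
  generated by \<open>l\<close> over the local integers. At a split prime such a set is not closed
  under addition, so the choice of \<open>p\<close> matters.\<close>

lemma ring_set_quadratic_local:
  assumes p: "Factorial_Ring.prime p" and t: "p dvd t" and n: "p dvd n" "\<not> p\<^sup>2 dvd n"
    and l: "cnj l = of_int t - l" "l * cnj l = of_int n"
    and L: "L = {a + b * l | a b. a \<in> \<rat> \<and> b \<in> \<rat>}"
  shows "ring_set {x \<in> L. x * cnj x \<in> local_ints p}"
proof -
  note rs = ring_set_local_ints[OF p]
  note r = ring_setD[OF rs] and ri = ring_set_of_int[OF rs]
  have V: "{x \<in> L. x * cnj x \<in> local_ints p} = {a + b * l | a b. a \<in> local_ints p \<and> b \<in> local_ints p}"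
    (is "_ = ?V")
  proof (intro equalityI subsetI)
    fix x assume xV: "x \<in> {x \<in> L. x * cnj x \<in> local_ints p}"
    then obtain a b where x: "x = a + b * l" "a \<in> \<rat>" "b \<in> \<rat>" unfolding L by blast
    have "(a + b * l) * cnj (a + b * l) \<in> local_ints p" using xV unfolding x(1) by blast
    from iffD1[OF quadratic_local_integral[OF p t n l x(2,3)] this]
    show "x \<in> ?V" using x(1) by blast
  next
    fix x assume "x \<in> ?V"
    then obtain a b where x: "x = a + b * l" "a \<in> local_ints p" "b \<in> local_ints p" by blast
    note ab = local_ints_Rats[OF x(2)] local_ints_Rats[OF x(3)]
    have "(a + b * l) * cnj (a + b * l) \<in> local_ints p"
      by (rule iffD2[OF quadratic_local_integral[OF p t n l ab] conjI[OF x(2,3)]])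
    moreover have "a + b * l \<in> L" unfolding L using ab by blast
    ultimately show "x \<in> {x \<in> L. x * cnj x \<in> local_ints p}" unfolding x(1) by blast
  qed
  have VI: "a + b * l \<in> ?V" if "a \<in> local_ints p" "b \<in> local_ints p" for a b
    using that by blast
  have sq: "l * l = of_int t * l - of_int n"
  proof -
    have "of_int n = l * (of_int t - l)" using l(2) unfolding l(1) by (rule sym)
    then show ?thesis by (simp add: algebra_simps)
  qed
  have cl: "x + y \<in> ?V" "x * y \<in> ?V" "- x \<in> ?V" if "x \<in> ?V" "y \<in> ?V" for x y
  proof -
    obtain a b c d where x: "x = a + b * l" "a \<in> local_ints p" "b \<in> local_ints p"
      and y: "y = c + d * l" "c \<in> local_ints p" "d \<in> local_ints p"
      using \<open>x \<in> ?V\<close> \<open>y \<in> ?V\<close> by blast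
    have "x * y = a * c + (a * d + b * c) * l + b * d * (l * l)"
      unfolding x y by (simp add: algebra_simps)
    also have "\<dots> = (a * c - of_int n * (b * d)) + (a * d + b * c + of_int t * (b * d)) * l"
      unfolding sq by (simp add: algebra_simps)
    finally have m: "x * y = (a * c - of_int n * (b * d)) + (a * d + b * c + of_int t * (b * d)) * l" .
    have s: "x + y = (a + c) + (b + d) * l" "- x = - a + (- b) * l"
      unfolding x y by (simp_all add: algebra_simps)
    show "x + y \<in> ?V" "- x \<in> ?V" unfolding s by (intro VI r x y)+
    show "x * y \<in> ?V" unfolding m by (intro VI r ri x y)
  qed
  have z: "0 \<in> ?V" "1 \<in> ?V" using VI[OF r(1) r(1)] VI[OF r(2) r(1)] by simp_all
  show ?thesis unfolding V
    by (rule ring_setI, rule z(1), rule z(2), rule cl(1), assumption+, rule cl(2), assumption+, rule cl(3), assumption+)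
qed

section \<open>Integral elements of an imaginary quadratic field\<close>

locale imaginary_quadratic =
  fixes L :: "complex set" and D :: nat
  assumes D_pos: "0 < D" and D_squarefree: "squarefree D"
    and L_eq: "L = {a + b * (\<i> * of_real (sqrt (real D))) | a b. a \<in> \<rat> \<and> b \<in> \<rat>}"
begin

definition \<beta> :: complex where "\<beta> = \<i> * of_real (sqrt (real D))"

lemma \<beta>_sq: "\<beta> * \<beta> = - of_nat D" and cnj_\<beta>: "cnj \<beta> = - \<beta>"
  by (simp_all add: \<beta>_def complex_eq_iff flip: real_sqrt_mult)

definition lattice :: "complex set" where
  "lattice = {of_int a + of_int b * \<beta> | a b. True}"

text \<open>Almost integral elements: one denominator serves all powers. In this form closure under
  sums is a binomial expansion and closure under conjugation is immediate, whereas monic equations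
  would require resultants.\<close>

definition integral_elements :: "complex set" where
  "integral_elements = {x \<in> L. \<exists>d>0. \<forall>k. of_nat d * x ^ k \<in> lattice}"

lemma L_iff: "x \<in> L \<longleftrightarrow> (\<exists>a\<in>\<rat>. \<exists>b\<in>\<rat>. x = a + b * \<beta>)"
  unfolding L_eq \<beta>_def by blast

lemma ring_set_lattice: "ring_set lattice"
proof -
  have I: "of_int a + of_int b * \<beta> \<in> lattice" for a b
    unfolding lattice_def by blast
  have cl: "x + y \<in> lattice" "x * y \<in> lattice" "- x \<in> lattice" if "x \<in> lattice" "y \<in> lattice" for x y
  proof -
    obtain a b c d where x: "x = of_int a + of_int b * \<beta>" and y: "y = of_int c + of_int d * \<beta>"
      using \<open>x \<in> lattice\<close> \<open>y \<in> lattice\<close> unfolding lattice_def by blast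
    have "x * y = of_int a * of_int c + (of_int a * of_int d + of_int b * of_int c) * \<beta> + of_int b * of_int d * (\<beta> * \<beta>)"
      unfolding x y by (simp add: algebra_simps)
    also have "\<dots> = of_int (a * c - b * d * int D) + of_int (a * d + b * c) * \<beta>"
      unfolding \<beta>_sq by (simp add: algebra_simps)
    finally have m: "x * y = of_int (a * c - b * d * int D) + of_int (a * d + b * c) * \<beta>" .
    have s: "x + y = of_int (a + c) + of_int (b + d) * \<beta>" "- x = of_int (- a) + of_int (- b) * \<beta>"
      unfolding x y by (simp_all add: algebra_simps)
    show "x + y \<in> lattice" "- x \<in> lattice" "x * y \<in> lattice" unfolding s m by (rule I)+
  qed
  have z: "0 \<in> lattice" "1 \<in> lattice" using I[of 0 0] I[of 1 0] by simp_all
  show ?thesis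
    by (rule ring_setI, rule z(1), rule z(2), rule cl(1), assumption+, rule cl(2), assumption+, rule cl(3), assumption+)
qed

lemma cnj_lattice: "x \<in> lattice \<Longrightarrow> cnj x \<in> lattice"
proof -
  assume "x \<in> lattice"
  then obtain a b where x: "x = of_int a + of_int b * \<beta>" unfolding lattice_def by blast
  have "cnj x = of_int a + of_int (- b) * \<beta>" unfolding x by (simp add: cnj_\<beta>)
  then show ?thesis unfolding lattice_def by blast
qed

lemma Im_\<beta>: "Im \<beta> \<noteq> 0" and Re_\<beta>: "Re \<beta> = 0"
  using D_pos by (simp_all add: \<beta>_def)

lemma lattice_real: "x \<in> lattice \<Longrightarrow> Im x = 0 \<Longrightarrow> x \<in> \<int>"
  unfolding lattice_def using Im_\<beta> by auto

lemma L_real: "x \<in> L \<Longrightarrow> Im x = 0 \<Longrightarrow> x \<in> \<rat>"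
proof -
  assume "x \<in> L" and Im: "Im x = 0"
  then obtain a b where x: "x = a + b * \<beta>" "a \<in> \<rat>" "b \<in> \<rat>" unfolding L_iff by blast
  have "Re b = 0" using Im Im_\<beta> x by (simp add: Im_Rats Re_\<beta>)
  then have "b = 0" using Im_Rats[OF x(3)] by (simp add: complex_eq_iff)
  then show "x \<in> \<rat>" using x by simp
qed

lemma ring_set_L: "ring_set L"
proof -
  have cl: "x + y \<in> L" "x * y \<in> L" "- x \<in> L" if "x \<in> L" "y \<in> L" for x y
  proof -
    obtain a b c d where x: "x = a + b * \<beta>" "a \<in> \<rat>" "b \<in> \<rat>" and y: "y = c + d * \<beta>" "c \<in> \<rat>" "d \<in> \<rat>"
      using \<open>x \<in> L\<close> \<open>y \<in> L\<close> unfolding L_iff by blast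
    have "x * y = a * c + (a * d + b * c) * \<beta> + b * d * (\<beta> * \<beta>)"
      unfolding x y by (simp add: algebra_simps)
    also have "\<dots> = (a * c - b * d * of_nat D) + (a * d + b * c) * \<beta>"
      unfolding \<beta>_sq by (simp add: algebra_simps)
    finally have m: "x * y = (a * c - b * d * of_nat D) + (a * d + b * c) * \<beta>" .
    have s: "x + y = (a + c) + (b + d) * \<beta>" "- x = - a + (- b) * \<beta>"
      unfolding x y by (simp_all add: algebra_simps)
    show "x + y \<in> L" "- x \<in> L" "x * y \<in> L" unfolding s m L_iff using x y
      by (blast intro: Rats_add Rats_mult Rats_diff Rats_minus_iff[THEN iffD2] Rats_of_nat)+
  qed
  have z: "0 \<in> L" "1 \<in> L" unfolding L_iff
    by (intro bexI[of _ 0] bexI[of _ 1], simp_all)+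
  show ?thesis
    by (rule ring_setI, rule z(1), rule z(2), rule cl(1), assumption+, rule cl(2), assumption+, rule cl(3), assumption+)
qed

lemma cnj_L: "x \<in> L \<Longrightarrow> cnj x \<in> L"
proof -
  assume "x \<in> L"
  then obtain a b where x: "x = a + b * \<beta>" "a \<in> \<rat>" "b \<in> \<rat>" unfolding L_iff by blast
  have "cnj a = a" "cnj b = b" using x by (simp_all add: cnj_Rats)
  then have e: "cnj x = a + (- b) * \<beta>" unfolding x by (simp add: cnj_\<beta>)
  show ?thesis unfolding L_iff
    by (rule bexI[of _ a], rule bexI[of _ "- b"], rule e) (use x in simp_all)
qed

lemma L_denominator:
  assumes "x \<in> L"
  obtains d :: nat where "d > 0" "of_nat d * x \<in> lattice"
proof -
  obtain a b where x: "x = a + b * \<beta>" "a \<in> \<rat>" "b \<in> \<rat>" using assms unfolding L_iff by blast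
  obtain m n where a: "n > 0" "a = of_int m / of_int n" using x(2) by (rule Rats_cases')
  obtain m' n' where b: "n' > 0" "b = of_int m' / of_int n'" using x(3) by (rule Rats_cases')
  have nn: "of_nat (nat (n * n')) = (of_int (n * n') :: complex)" using a b by simp
  have "of_nat (nat (n * n')) * x = of_int (m * n') + of_int (m' * n) * \<beta>"
    unfolding nn x a b using a(1) b(1) by (simp add: field_simps)
  then have "of_nat (nat (n * n')) * x \<in> lattice" unfolding lattice_def by blast
  moreover have "nat (n * n') > 0" using a b by simp
  ultimately show ?thesis using that by blast
qed

lemma inverse_L: "x \<in> L \<Longrightarrow> inverse x \<in> L"
proof -
  assume x: "x \<in> L"
  show "inverse x \<in> L"
  proof (cases "x = 0")
    case True
    then show ?thesis using x by simp
  next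
    case False
    have "x * cnj x \<in> \<rat>"
      by (rule L_real[OF ring_setD(4)[OF ring_set_L x cnj_L[OF x]]]) simp
    then have "inverse (x * cnj x) \<in> \<rat>" by (rule Rats_inverse)
    then have "inverse (x * cnj x) \<in> L"
      unfolding L_iff by (intro bexI[of _ "inverse (x * cnj x)"] bexI[of _ 0]) auto
    then have m: "cnj x * inverse (x * cnj x) \<in> L" using ring_setD(4)[OF ring_set_L] cnj_L[OF x] by blast
    have e: "cnj x * inverse (x * cnj x) = inverse x" using False by (simp add: field_simps)
    show ?thesis using m unfolding e .
  qed
qed

lemma ring_set_integral_elements: "ring_set integral_elements"
proof -
  note r = ring_setD[OF ring_set_lattice] and rl = ring_setD[OF ring_set_L]
  have cl: "x + y \<in> integral_elements" "x * y \<in> integral_elements" "- x \<in> integral_elements"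
    if "x \<in> integral_elements" "y \<in> integral_elements" for x y
  proof -
    obtain d e :: nat where x: "x \<in> L" "d > 0" "\<And>k. of_nat d * x ^ k \<in> lattice"
      and y: "y \<in> L" "e > 0" "\<And>k. of_nat e * y ^ k \<in> lattice"
      using \<open>x \<in> integral_elements\<close> \<open>y \<in> integral_elements\<close> unfolding integral_elements_def by blast
    have de: "d * e > 0" using x y by simp
    have "of_nat (d * e) * (x + y) ^ k \<in> lattice" for k
    proof -
      have "of_nat (d * e) * (x + y) ^ k = (\<Sum>i\<le>k. of_nat (k choose i) * ((of_nat d * x ^ i) * (of_nat e * y ^ (k - i))))"
        by (simp add: binomial_ring sum_distrib_left mult_ac)
      also have "\<dots> \<in> lattice"
        by (intro ring_set_sum[OF ring_set_lattice] r x y ring_set_of_nat[OF ring_set_lattice])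
      finally show ?thesis .
    qed
    then show "x + y \<in> integral_elements"
      unfolding integral_elements_def using de rl(3)[OF x(1) y(1)] by blast
    have "of_nat (d * e) * (x * y) ^ k \<in> lattice" for k
    proof -
      have eq: "of_nat (d * e) * (x * y) ^ k = (of_nat d * x ^ k) * (of_nat e * y ^ k)"
        by (simp add: power_mult_distrib mult_ac)
      show ?thesis unfolding eq by (rule r(4)[OF x(3) y(3)])
    qed
    then show "x * y \<in> integral_elements"
      unfolding integral_elements_def using de rl(4)[OF x(1) y(1)] by blast
    have "of_nat d * (- x) ^ k \<in> lattice" for k
    proof -
      have eq: "of_nat d * (- x) ^ k = (- 1) ^ k * (of_nat d * x ^ k)"
        by (simp add: power_minus[of x])
      show ?thesis unfolding eq
        by (rule r(4)[OF ring_set_power[OF ring_set_lattice r(5)[OF r(2)]] x(3)])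
    qed
    then show "- x \<in> integral_elements"
      unfolding integral_elements_def using x rl(5)[OF x(1)] by blast
  qed
  have z: "0 \<in> integral_elements" "1 \<in> integral_elements"
    unfolding integral_elements_def
    using rl r ring_set_power[OF ring_set_lattice r(1)] by (auto intro!: exI[of _ 1])
  show ?thesis
    by (rule ring_setI, rule z(1), rule z(2), rule cl(1), assumption+, rule cl(2), assumption+, rule cl(3), assumption+)
qed

lemma cnj_integral_elements: "x \<in> integral_elements \<Longrightarrow> cnj x \<in> integral_elements"
proof -
  assume "x \<in> integral_elements"
  then obtain d :: nat where x: "x \<in> L" "d > 0" "\<And>k. of_nat d * x ^ k \<in> lattice"
    unfolding integral_elements_def by blast
  have "of_nat d * (cnj x) ^ k \<in> lattice" for k
    using cnj_lattice[OF x(3)[of k]] by simp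
  then show ?thesis unfolding integral_elements_def using x cnj_L by blast
qed

text \<open>The monic equation expresses high powers of \<open>x\<close> by lower ones, so a common
  denominator of the powers below the degree serves all of them.\<close>

lemma algebraic_int_integral: "ring_of_integers L \<subseteq> integral_elements"
proof
  fix x assume "x \<in> ring_of_integers L"
  then have x: "x \<in> L" "algebraic_int x" by (simp_all add: ring_of_integers_def)
  obtain p where p: "poly p x = 0" "Polynomial.lead_coeff p = 1" "\<And>i. Polynomial.coeff p i \<in> \<int>"
    using x(2) by (auto elim: algebraic_int.cases)
  define n where "n = Polynomial.degree p"
  note r = ring_setD[OF ring_set_lattice]
  have "\<exists>d>0. of_nat d * x ^ i \<in> lattice" for i
  proof -
    obtain d :: nat where "d > 0" "of_nat d * x ^ i \<in> lattice"
      using L_denominator[OF ring_set_power[OF ring_set_L x(1), of i]] .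
    then show ?thesis by (intro exI[of _ d] conjI)
  qed
  then obtain d :: "nat \<Rightarrow> nat" where d: "\<And>i. d i > 0" "\<And>i. of_nat (d i) * x ^ i \<in> lattice"
    by metis
  define e where "e = (\<Prod>i<n. d i)"
  have e: "e > 0" unfolding e_def using d by (simp add: prod_pos)
  have "of_nat e * x ^ k \<in> lattice" for k
  proof (induction k rule: less_induct)
    case (less k)
    show ?case
    proof (cases "k < n")
      case True
      then have "d k dvd e" unfolding e_def by (intro dvd_prodI) auto
      then obtain c where "e = d k * c" by (rule dvdE)
      then have eq: "of_nat e * x ^ k = of_nat c * (of_nat (d k) * x ^ k)" by simp
      show ?thesis unfolding eq by (rule r(4)[OF ring_set_of_nat[OF ring_set_lattice] d(2)])
    next
      case False
      have z0: "0 = (\<Sum>i<n. Polynomial.coeff p i * x ^ i) + x ^ n"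
        using p(1,2) unfolding poly_altdef n_def[symmetric] lessThan_Suc_atMost[symmetric] by simp
      have xn: "x ^ n = - (\<Sum>i<n. Polynomial.coeff p i * x ^ i)"
        unfolding eq_neg_iff_add_eq_0 by (subst add.commute) (rule z0[symmetric])
      have "of_nat e * x ^ k = of_nat e * x ^ (k - n) * x ^ n"
        using False by (simp add: mult.assoc flip: power_add)
      also have "\<dots> = - (\<Sum>i<n. Polynomial.coeff p i * (of_nat e * x ^ (k - n + i)))"
        unfolding xn by (simp add: sum_distrib_left power_add mult_ac)
      also have "\<dots> \<in> lattice"
      proof (rule r(5), rule ring_set_sum[OF ring_set_lattice], rule r(4))
        fix i assume "i \<in> {..<n}"
        then show "of_nat e * x ^ (k - n + i) \<in> lattice" using False by (intro less) auto
        show "Polynomial.coeff p i \<in> lattice"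
          using p(3)[of i] ring_set_of_int[OF ring_set_lattice] by (auto elim: Ints_cases)
      qed
      finally show ?thesis .
    qed
  qed
  then show "x \<in> integral_elements" unfolding integral_elements_def using x e by blast
qed

text \<open>For \<open>x = a / b\<close> in lowest terms every power of \<open>b\<close> divides the
  fixed denominator \<open>d\<close>, which forces \<open>b = 1\<close>.\<close>

lemma integral_real:
  assumes "x \<in> integral_elements" "Im x = 0"
  shows "x \<in> \<int>"
proof -
  obtain d :: nat where x: "x \<in> L" "d > 0" "\<And>k. of_nat d * x ^ k \<in> lattice"
    using assms(1) unfolding integral_elements_def by blast
  have "x \<in> \<rat>" using L_real x(1) assms(2) by blast
  then obtain a b where ab: "b > 0" "coprime a b" "x = of_int a / of_int b" by (rule Rats_cases')
  have "b ^ k dvd int d" for k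
  proof -
    have "of_nat d * x ^ k \<in> \<int>"
      by (rule lattice_real[OF x(3)]) (simp add: ab(3) flip: of_int_power)
    then obtain m where "of_nat d * x ^ k = of_int m" by (auto elim: Ints_cases)
    then have "(of_int (int d * a ^ k) :: complex) = of_int (m * b ^ k)"
      using ab by (simp add: field_simps)
    then have "int d * a ^ k = m * b ^ k" by (simp only: of_int_eq_iff)
    then have "b ^ k dvd int d * a ^ k" by simp
    moreover have "coprime (b ^ k) (a ^ k)" using ab(2) by (simp add: coprime_commute)
    ultimately show ?thesis by (simp add: coprime_dvd_mult_left_iff)
  qed
  then have le: "b ^ k \<le> int d" for k using x(2) by (intro zdvd_imp_le) auto
  have "b = 1"
  proof (rule ccontr)
    assume "b \<noteq> 1"
    then have "2 \<le> b" using ab by simp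
    then have "2 ^ d \<le> b ^ d" by (intro power_mono) auto
    then have "(2::int) ^ d \<le> int d" using le[of d] by (rule order_trans)
    moreover have "int d < 2 ^ d" by (metis of_nat_less_two_power)
    ultimately show False by (rule notE[OF leD])
  qed
  then show ?thesis using ab by simp
qed

lemma integral_norm:
  assumes "x \<in> integral_elements"
  shows "x * cnj x \<in> \<int>"
  by (rule integral_real[OF ring_setD(4)[OF ring_set_integral_elements assms cnj_integral_elements[OF assms]]]) simp

text \<open>The trace \<open>t\<close> is an integer with absolute value at most 2. For
  \<open>t = 2, -2, 0, 1, -1\<close> the roots of \<open>x\<^sup>2 - t x + 1\<close> have order 1,
  2, 4, 6, 3, and 12 is the least common multiple.\<close>

lemma integral_unit_circle:
  assumes "x \<in> integral_elements" "x * cnj x = 1"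
  shows "x ^ 12 = 1"
proof -
  have "x + cnj x \<in> \<int>"
    by (rule integral_real[OF ring_setD(3)[OF ring_set_integral_elements assms(1) cnj_integral_elements[OF assms(1)]]]) simp
  then obtain t where t: "x + cnj x = of_int t" by (auto elim: Ints_cases)
  have "real_of_int t = 2 * Re x" using arg_cong[OF t, of Re] by simp
  moreover have "complex_of_real ((norm x)\<^sup>2) = 1" by (simp only: complex_norm_square assms(2))
  then have "(norm x)\<^sup>2 = 1" by (simp only: of_real_eq_1_iff)
  then have "norm x = 1" using norm_ge_zero[of x] by (auto simp: power2_eq_1_iff)
  then have "\<bar>Re x\<bar> \<le> 1" using abs_Re_le_cmod[of x] by simp
  ultimately have "\<bar>real_of_int t\<bar> \<le> 2" by simp
  then have "t = -2 \<or> t = -1 \<or> t = 0 \<or> t = 1 \<or> t = 2" by linarith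
  moreover have c: "cnj x = of_int t - x" using t by (simp add: algebra_simps)
  have "x * (of_int t - x) = 1" using assms(2) unfolding c .
  then have sq: "x * x = of_int t * x - 1" by (simp add: algebra_simps)
  have p12: "x ^ 12 = ((x * x) * x) * ((x * x) * x) * (((x * x) * x) * ((x * x) * x))"
    by (simp add: eval_nat_numeral mult_ac)
  ultimately consider "t = 2" | "t = -2" | "t = 0" | "t = 1" | "t = -1" by blast
  then show ?thesis
  proof cases
    case 1
    then have "(x - 1) * (x - 1) = 0" using sq by (simp add: algebra_simps)
    then show ?thesis by simp
  next
    case 2
    have "(x + 1) * (x + 1) = x * x + 2 * x + 1" by (simp add: algebra_simps)
    also have "\<dots> = 0" using sq 2 by simp
    finally have "(x + 1) * (x + 1) = 0" .
    then have "x = - 1" by (simp add: eq_neg_iff_add_eq_0)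
    then show ?thesis by simp
  next
    case 3
    then have "x * x = - 1" using sq by simp
    then have "x\<^sup>2 = - 1" by (simp add: power2_eq_square)
    then have "(x\<^sup>2) ^ 6 = 1" by simp
    then show ?thesis by (simp flip: power_mult)
  next
    case 4
    then have s: "x * x = x - 1" using sq by simp
    have "(x * x) * x = (x - 1) * x" by (simp only: s)
    also have "\<dots> = x * x - x" by (simp add: algebra_simps)
    finally have "x * x * x = - 1" by (simp add: s)
    then show ?thesis unfolding p12 by simp
  next
    case 5
    then have s: "x * x = - x - 1" using sq by simp
    have "(x * x) * x = (- x - 1) * x" by (simp only: s)
    also have "\<dots> = - (x * x) - x" by (simp add: algebra_simps)
    finally have "x * x * x = 1" by (simp add: s)
    then show ?thesis unfolding p12 by simp
  qed
qed

end

lemma imaginary_quadraticI: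
  assumes y: "y \<noteq> 0" "complex_of_real (y\<^sup>2) \<in> \<rat>"
    and L: "L = {a + b * (\<i> * of_real y) | a b. a \<in> \<rat> \<and> b \<in> \<rat>}"
  obtains D where "imaginary_quadratic L D"
proof -
  obtain m n where mn: "n > 0" "complex_of_real (y\<^sup>2) = of_int m / of_int n" using y(2) by (rule Rats_cases')
  then have "complex_of_real (y\<^sup>2) = of_real (of_int m / of_int n)" by simp
  then have y2: "y\<^sup>2 = of_int m / of_int n" by (simp only: of_real_eq_iff)
  then have "m > 0" using y(1) mn(1) by (metis divide_eq_0_iff linorder_neqE_linordered_idom not_less_iff_gr_or_eq of_int_0 of_int_pos zero_eq_power2 zero_less_divide_iff zero_less_power2 of_int_less_0_iff)
  \<comment> \<open>For \<open>y\<^sup>2 = m / n\<close> one has \<open>(n y)\<^sup>2 = m n\<close>,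
    so \<open>y\<close> is a rational multiple of the square root of the squarefree part of
    \<open>m n\<close>; the factor \<open>q\<close> below also carries the sign of
    \<open>y\<close>.\<close>
  define k where "k = nat (m * n)"
  have k: "k > 0" "real k = of_int m * of_int n" using mn(1) \<open>m > 0\<close> by (simp_all add: k_def)
  define D where "D = squarefree_part k"
  define s where "s = square_part k"
  have ks: "k = D * s\<^sup>2" unfolding D_def s_def by (rule squarefree_decompose)
  then have pos: "D > 0" "s > 0" using k by (auto intro: Nat.gr0I)
  have "(of_int n * y)\<^sup>2 = of_int n * of_int n * (of_int m / of_int n)"
    by (simp only: power_mult_distrib y2 power2_eq_square[of "of_int n"])
  also have "\<dots> = of_int m * of_int n" using mn(1) by simp
  also have "\<dots> = real D * (real s)\<^sup>2" unfolding k(2)[symmetric] by (subst ks) simp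
  finally have ny2: "(of_int n * y)\<^sup>2 = real D * (real s)\<^sup>2" .
  have "(of_int n * \<bar>y\<bar>)\<^sup>2 = (of_int n * y)\<^sup>2" by (simp only: power_mult_distrib power2_abs)
  also have "\<dots> = (real s * sqrt (real D))\<^sup>2" unfolding ny2 by (simp add: power_mult_distrib)
  finally have ny: "of_int n * \<bar>y\<bar> = real s * sqrt (real D)"
    by (rule power2_eq_imp_eq) (use mn(1) in simp_all)
  define q :: real where "q = sgn y * (real s / of_int n)"
  have q: "y = q * sqrt (real D)" "q \<noteq> 0"
    using ny mn(1) y(1) pos unfolding q_def by (auto simp: field_simps sgn_if abs_if split: if_splits)
  have qQ: "complex_of_real q \<in> \<rat>"
    unfolding q_def sgn_if by auto
  have "L = {a + b * (\<i> * of_real (sqrt (real D))) | a b. a \<in> \<rat> \<and> b \<in> \<rat>}"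
  proof (intro equalityI subsetI)
    fix x assume "x \<in> L"
    then obtain a b where "x = a + b * (\<i> * of_real y)" "a \<in> \<rat>" "b \<in> \<rat>" unfolding L by blast
    then have "x = a + (b * of_real q) * (\<i> * of_real (sqrt (real D)))" "b * of_real q \<in> \<rat>"
      using qQ unfolding q(1) by (simp_all add: mult_ac)
    with \<open>a \<in> \<rat>\<close> show "x \<in> {a + b * (\<i> * of_real (sqrt (real D))) | a b. a \<in> \<rat> \<and> b \<in> \<rat>}" by blast
  next
    fix x assume "x \<in> {a + b * (\<i> * of_real (sqrt (real D))) | a b. a \<in> \<rat> \<and> b \<in> \<rat>}"
    then obtain a b where "x = a + b * (\<i> * of_real (sqrt (real D)))" "a \<in> \<rat>" "b \<in> \<rat>" by blast
    then have "x = a + (b / of_real q) * (\<i> * of_real y)" "b / of_real q \<in> \<rat>"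
      using qQ q(2) unfolding q(1) by simp_all
    with \<open>a \<in> \<rat>\<close> show "x \<in> L" unfolding L by blast
  qed
  then have "imaginary_quadratic L D"
    using pos by unfold_locales (simp_all add: D_def)
  then show ?thesis by (rule that)
qed

section \<open>Determinants of unitary matrices over imaginary quadratic fields\<close>

definition coordinate_projection :: "'n set \<Rightarrow> complex^'n^'n" where
  "coordinate_projection S = (\<chi> i j. if i = j \<and> i \<in> S then 1 else 0)"

lemma coordinate_projection_mult:
  "(coordinate_projection S ** M) $ i $ j = (if i \<in> S then M $ i $ j else 0)"
  for M :: "complex^'m^'n::finite"
proof -
  have "(coordinate_projection S ** M) $ i $ j = (\<Sum>l\<in>UNIV. if l = i then (if i \<in> S then M $ i $ j else 0) else 0)"
    unfolding matrix_matrix_mult_def coordinate_projection_def vec_lambda_beta by (intro sum.cong) auto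
  then show ?thesis by simp
qed

text \<open>A Weyl element: it exchanges, up to sign, the coordinates in \<open>S\<close> of the two
  blocks. It is a product of an upper, a lower and an upper unipotent matrix, which gives its
  determinant.\<close>

lemma coordinate_swap:
  fixes S :: "'n::finite set"
  defines "E \<equiv> coordinate_projection S"
  defines "w \<equiv> blk (mat 1 - E) (- E) E (mat 1 - E)"
  shows "w \<in> unitary_nn" "det w = 1"
proof -
  have ct: "ct E = E" by (auto simp: E_def coordinate_projection_def vec_eq_iff)
  have EE: "E ** E = E"
    by (auto simp: E_def vec_eq_iff coordinate_projection_mult) (auto simp: coordinate_projection_def)
  have neg: "(- M) ** N = - (M ** N)" "M ** (- N) = - (M ** N)" for M N :: "complex^'n^'n"
    by (simp_all add: vec_eq_iff matrix_matrix_mult_def sum_negf)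
  have ctn: "ct (- E) = - E" using ct by (simp add: vec_eq_iff)
  show "w \<in> unitary_nn"
    unfolding w_def blk_unitary_iff ct_diff ct_mat_1 ct ctn
    by (simp add: neg EE matrix_diff_ldistrib matrix_diff_rdistrib)
  have "w = blk (mat 1) (- E) 0 (mat 1) ** blk (mat 1) 0 E (mat 1) ** blk (mat 1) (- E) 0 (mat 1)"
    unfolding w_def by (simp add: blk_mult blk_eq_iff neg EE matrix_add_rdistrib matrix_diff_rdistrib)
  then show "det w = 1"
    by (simp add: det_mul det_blk_unipotent_upper det_blk_unipotent_lower)
qed

lemma matrix_row_combination: "(\<Sum>j\<in>UNIV. (x $ j) *s row j (mat 1 :: complex^'n^'n)) = x"
  for x :: "complex^'n::finite"
  by (simp add: vec_eq_iff row_def mat_def vector_scalar_mult_def if_distrib cong: if_cong)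

lemma det_replace_row:
  fixes x :: "complex^'n::finite"
  shows "det (\<chi> i. if i = k then x else row i (mat 1 :: complex^'n^'n)) = x $ k"
  using cramer_lemma_transpose[of k x "mat 1"] unfolding matrix_row_combination by simp

text \<open>Row \<open>s\<close> is expanded in the standard basis; a basis row other than the
  \<open>s\<close>-th and \<open>t\<close>-th repeats another row of the matrix and contributes
  nothing.\<close>

lemma det_replace_two_rows:
  fixes x y :: "complex^'n::finite"
  assumes st: "s \<noteq> t"
  shows "det (\<chi> i. if i = s then x else if i = t then y else row i (mat 1 :: complex^'n^'n)) =
    x $ s * y $ t - x $ t * y $ s"
proof -
  define e where "e = (\<lambda>i. row i (mat 1 :: complex^'n^'n))"
  have e_nth: "e i $ j = (if i = j then 1 else 0)" for i j
    by (simp add: e_def row_def mat_def)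
  define \<phi> where "\<phi> = (\<lambda>z. det (\<chi> i. if i = s then z else if i = t then y else e i))"
  have "\<phi> x = \<phi> (\<Sum>j\<in>UNIV. (x $ j) *s e j)"
    by (simp add: e_def matrix_row_combination)
  also have "\<dots> = (\<Sum>j\<in>UNIV. \<phi> ((x $ j) *s e j))"
    unfolding \<phi>_def by (rule det_linear_row_sum) simp
  also have "\<dots> = (\<Sum>j\<in>UNIV. x $ j * \<phi> (e j))"
    unfolding \<phi>_def by (simp add: det_row_mul)
  also have "\<dots> = (\<Sum>j\<in>{s, t}. x $ j * \<phi> (e j))"
  proof (rule sum.mono_neutral_right)
    show "\<forall>j\<in>UNIV - {s, t}. x $ j * \<phi> (e j) = 0"
    proof
      fix j assume j: "j \<in> UNIV - {s, t}"
      have "\<phi> (e j) = 0"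
        unfolding \<phi>_def
        by (rule det_identical_rows[of s j]) (use j in \<open>auto simp: row_def vec_eq_iff\<close>)
      then show "x $ j * \<phi> (e j) = 0" by simp
    qed
  qed auto
  also have "\<phi> (e s) = y $ t"
  proof -
    have rows: "(\<chi> i. if i = s then e s else if i = t then y else e i) = (\<chi> i. if i = t then y else e i)"
      using st by (auto simp: vec_eq_iff)
    show ?thesis unfolding \<phi>_def rows unfolding e_def by (rule det_replace_row)
  qed
  then have "(\<Sum>j\<in>{s, t}. x $ j * \<phi> (e j)) = x $ s * y $ t + x $ t * \<phi> (e t)"
    using st by simp
  also have "\<phi> (e t) = - (y $ s)"
  proof -
    \<comment> \<open>\<open>W\<close> is the identity with rows \<open>s\<close> and
      \<open>t\<close> exchanged, so Cramer's lemma applied to it brings in the sign.\<close>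
    define W :: "complex^'n^'n" where "W = (\<chi> i. e (Transposition.transpose s t i))"
    have p: "Transposition.transpose s t permutes (UNIV :: 'n set)" by (rule permutes_swap_id) auto
    have "W = (\<chi> i. (mat 1 :: complex^'n^'n) $ Transposition.transpose s t i)"
      by (simp add: W_def e_def row_def vec_eq_iff)
    then have "det W = of_int (sign (Transposition.transpose s t)) * det (mat 1 :: complex^'n^'n)"
      using det_permute_rows[OF p, of "mat 1 :: complex^'n^'n"] by simp
    then have dW: "det W = - 1" using st by (simp add: sign_swap_id)
    define z where "z = (\<chi> j. y $ (Transposition.transpose s t j))"
    have row_W: "row j W = e (Transposition.transpose s t j)" for j
      by (simp add: W_def row_def vec_eq_iff)
    have yz: "(\<Sum>j\<in>UNIV. (z $ j) *s row j W) = y"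
    proof -
      have "(\<Sum>j\<in>UNIV. (z $ j) *s row j W) = (\<Sum>j\<in>UNIV. (y $ (Transposition.transpose s t j)) *s e (Transposition.transpose s t j))"
        by (simp add: row_W z_def)
      also have "\<dots> = (\<Sum>j\<in>UNIV. (y $ j) *s e j)"
        using sum.permute[OF p, of "\<lambda>j. (y $ j) *s e j"] by (simp add: comp_def)
      also have "\<dots> = y" by (simp add: e_def matrix_row_combination)
      finally show ?thesis .
    qed
    have rows: "(\<chi> i. if i = s then e t else if i = t then y else e i) = (\<chi> i. if i = t then y else row i W)"
      using st by (auto simp: vec_eq_iff row_W Transposition.transpose_def)
    have "\<phi> (e t) = det (\<chi> i. if i = t then y else row i W)"
      unfolding \<phi>_def rows ..
    also have "\<dots> = z $ t * det W"
      using cramer_lemma_transpose[of t z W] unfolding yz .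
    finally have "\<phi> (e t) = z $ t * det W" .
    then show ?thesis by (simp add: z_def dW)
  qed
  finally show ?thesis unfolding \<phi>_def e_def by simp
qed

text \<open>The determinant is a polynomial in the scalar \<open>t\<close>. At \<open>\<i>\<close>
  it is the denominator at a point of the half-space and does not vanish, so some integer is not a
  root.\<close>

lemma unitary_translate_denominator:
  fixes \<gamma> :: "complex^('n::finite+'n)^('n+'n)"
  assumes "\<gamma> \<in> unitary_nn"
  obtains t :: int where "det (mat (of_int t) ** block_C \<gamma> + block_D \<gamma>) \<noteq> 0"
proof -
  define q where "q = (\<Sum>p\<in>{p. p permutes (UNIV :: 'n set)}. Polynomial.smult (of_int (sign p))
    (\<Prod>i\<in>UNIV. [:block_D \<gamma> $ i $ p i, block_C \<gamma> $ i $ p i:]))"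
  have q: "poly q c = det (mat c ** block_C \<gamma> + block_D \<gamma>)" for c
    by (simp add: q_def det_def poly_sum poly_prod mat_mult_left add.commute)
  have "det (block_C \<gamma> ** mat \<i> + block_D \<gamma>) \<noteq> 0"
    using assms scaled_identity_half_space[of 1]
      det_denominator[of "block_A \<gamma>" "block_B \<gamma>" "block_C \<gamma>" "block_D \<gamma>" "mat \<i>"] by (simp add: blk_blocks)
  moreover have "block_C \<gamma> ** mat \<i> = mat \<i> ** block_C \<gamma>"
    by (simp add: vec_eq_iff mat_mult_left mat_mult_right)
  ultimately have "poly q \<i> \<noteq> 0" by (simp add: q)
  then have "q \<noteq> 0" by auto
  then have "finite {c. poly q c = 0}" by (rule poly_roots_finite)
  moreover have "infinite (range (of_int :: int \<Rightarrow> complex))"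
    using infinite_UNIV_int by (auto dest!: finite_imageD simp: inj_on_def)
  ultimately have "\<not> range (of_int :: int \<Rightarrow> complex) \<subseteq> {c. poly q c = 0}"
    using finite_subset by blast
  then obtain t :: int where "poly q (of_int t) \<noteq> 0" by blast
  then show ?thesis using that[of t] by (simp only: q not_False_eq_True)
qed

lemma ct_0 [simp]: "ct 0 = 0"
  by (simp add: vec_eq_iff)

context imaginary_quadratic
begin

lemma integral_local:
  assumes "Factorial_Ring.prime p" "x \<in> integral_elements"
  shows "x \<in> {x \<in> L. x * cnj x \<in> local_ints p}"
proof -
  obtain n where "x * cnj x = of_int n" using integral_norm[OF assms(2)] by (auto elim: Ints_cases)
  then have "x * cnj x \<in> local_ints p" using ring_set_of_int[OF ring_set_local_ints[OF assms(1)]] by simp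
  then show ?thesis using assms(2) unfolding integral_elements_def by blast
qed

text \<open>Among the integral unitary matrices with determinant \<open>\<delta>\<close> choose one for which the norm of
  \<open>det D\<close> has minimal \<open>p\<close>-adic valuation. Exchanging one or two rows of \<open>D\<close> with rows of \<open>B\<close> shows
  that the principal minors of size one and two of the Hermitian matrix \<open>B D\<^sup>-\<^sup>1\<close> are local
  integers, whence all its entries are, and \<open>det D\<close> is a local unit.\<close>

lemma unitary_local_unit:
  fixes \<gamma> :: "complex^('n::finite+'n)^('n+'n)"
  assumes p: "Factorial_Ring.prime p" and V: "ring_set {x \<in> L. x * cnj x \<in> local_ints p}"
    and \<gamma>: "\<gamma> \<in> unitary_nn" "\<And>a b. \<gamma> $ a $ b \<in> integral_elements"
  obtains u where "u \<in> L" "u \<noteq> 0" "u * cnj u \<in> local_ints p" "inverse (u * cnj u) \<in> local_ints p"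
    "det \<gamma> * cnj u = u"
proof -
  define V where "V = {x \<in> L. x * cnj x \<in> local_ints p}"
  have rV: "ring_set V" unfolding V_def by (rule V)
  define G where "G = {g :: complex^('n+'n)^('n+'n). g \<in> unitary_nn \<and> (\<forall>a b. g $ a $ b \<in> integral_elements) \<and> det g = det \<gamma>}"
  note rB = ring_set_integral_elements
  note r = ring_setD[OF rB]
  \<comment> \<open>The norm of an integral element is an integer stored as a complex number; the
    floor of the real part recovers it for \<open>multiplicity\<close>.\<close>
  define f where "f = (\<lambda>g :: complex^('n+'n)^('n+'n). multiplicity p \<lfloor>Re (det (block_D g) * cnj (det (block_D g)))\<rfloor>)"
  have mat_B: "(mat c :: complex^'n^'n) $ a $ b \<in> integral_elements" if "c \<in> integral_elements" for a b c
    using that r by (simp add: mat_def)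
  obtain t :: int where t: "det (mat (of_int t) ** block_C \<gamma> + block_D \<gamma>) \<noteq> 0"
    using unitary_translate_denominator[OF \<gamma>(1)] .
  \<comment> \<open>An integral translation preserves the determinant and makes the lower right
    block invertible, so there is a matrix to start the minimisation from.\<close>
  define g0 where "g0 = \<gamma> ** blk (mat 1) (mat (of_int t)) 0 (mat 1)"
  have g0_blk: "g0 = blk (block_A \<gamma>) (block_A \<gamma> ** mat (of_int t) + block_B \<gamma>) (block_C \<gamma>) (block_C \<gamma> ** mat (of_int t) + block_D \<gamma>)"
    unfolding g0_def by (subst blk_blocks[of \<gamma>, symmetric]) (simp add: blk_mult)
  have "ct (mat (of_int t)) = (mat (of_int t) :: complex^'n^'n)"
    by (auto simp: vec_eq_iff mat_def)
  then have "blk (mat 1) (mat (of_int t)) 0 (mat 1) \<in> (unitary_nn :: (complex^('n+'n)^('n+'n)) set)"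
    by (simp add: blk_unitary_iff)
  then have g0u: "g0 \<in> unitary_nn" unfolding g0_def by (rule unitary_nn_mult[OF \<gamma>(1)])
  have zB: "(0 :: complex^'n^'n) $ a $ b \<in> integral_elements" for a b
    using r(1) by simp
  have blk_B: "blk A B C E $ a $ b \<in> integral_elements"
    if "\<And>a b. A $ a $ b \<in> integral_elements" "\<And>a b. B $ a $ b \<in> integral_elements"
      "\<And>a b. C $ a $ b \<in> integral_elements" "\<And>a b. E $ a $ b \<in> integral_elements"
    for A B C E :: "complex^'n^'n" and a b
    using that by (cases a; cases b) simp_all
  have "g0 $ a $ b \<in> integral_elements" for a b
    unfolding g0_def
    by (intro ring_set_matrix_mult[OF rB] \<gamma>(2) blk_B mat_B r ring_set_of_int[OF rB] zB)
  moreover have "det g0 = det \<gamma>"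
    unfolding g0_def by (simp add: det_mul det_blk_unipotent_upper)
  moreover have comm: "block_C \<gamma> ** mat (of_int t) = mat (of_int t) ** block_C \<gamma>"
    by (simp add: vec_eq_iff mat_mult_left mat_mult_right)
  have "det (block_D g0) \<noteq> 0"
    unfolding g0_blk using t by (simp add: comm)
  ultimately have "g0 \<in> G \<and> det (block_D g0) \<noteq> 0"
    using g0u by (simp add: G_def)
  then obtain g where g: "g \<in> G" "det (block_D g) \<noteq> 0"
    and min: "\<And>h. h \<in> G \<Longrightarrow> det (block_D h) \<noteq> 0 \<Longrightarrow> f g \<le> f h"
    using ex_has_least_nat[of "\<lambda>g. g \<in> G \<and> det (block_D g) \<noteq> 0" g0 f] by blast
  define A B C E where ABCE: "A = block_A g" "B = block_B g" "C = block_C g" "E = block_D g"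
  have g_blk: "g = blk A B C E" by (simp add: ABCE blk_blocks)
  have gu: "blk A B C E \<in> unitary_nn" using g(1) by (simp add: G_def g_blk)
  have gB: "A $ a $ b \<in> integral_elements" "B $ a $ b \<in> integral_elements" "C $ a $ b \<in> integral_elements"
    "E $ a $ b \<in> integral_elements" for a b
    using g(1) by (simp_all add: G_def ABCE block_A_def block_B_def block_C_def block_D_def)
  have dE: "det E \<noteq> 0" using g(2) by (simp add: ABCE)
  have BV: "x \<in> V" if "x \<in> integral_elements" for x
    using integral_local[OF p that] by (simp add: V_def)
  have BL: "x \<in> L" if "x \<in> integral_elements" for x
    using that by (simp add: integral_elements_def)
  \<comment> \<open>By minimality of \<open>g\<close> the norm of the quotient has nonnegative
    valuation at \<open>p\<close>.\<close>
  have ratio: "det (block_D h) * inverse (det E) \<in> V" if h: "h \<in> G" for h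
  proof (cases "det (block_D h) = 0")
    case True
    then show ?thesis using ring_setD(1)[OF rV] by simp
  next
    case False
    have hB: "det (block_D h) \<in> integral_elements" "det E \<in> integral_elements"
      using h gB by (auto intro!: ring_set_det[OF rB] simp: G_def block_D_def)
    obtain N N' where N: "det E * cnj (det E) = of_int N" "det (block_D h) * cnj (det (block_D h)) = of_int N'"
      using integral_norm[OF hB(1)] integral_norm[OF hB(2)] by (auto elim!: Ints_cases)
    have "(of_int N :: complex) \<noteq> 0" "(of_int N' :: complex) \<noteq> 0"
      using N[symmetric] dE False by simp_all
    then have nz: "N \<noteq> 0" "N' \<noteq> 0" by simp_all
    have "multiplicity p N \<le> multiplicity p N'"
    proof -
      have "f g = multiplicity p N" unfolding f_def ABCE(4)[symmetric] N(1) by simp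
      moreover have "f h = multiplicity p N'" unfolding f_def N(2) by simp
      ultimately show ?thesis using min[OF h False] by simp
    qed
    then obtain e where e: "multiplicity p N' = multiplicity p N + e" using le_Suc_ex by blast
    have nu: "\<not> is_unit p" using p by (simp add: prime_int_iff)
    obtain m where m: "N = p ^ multiplicity p N * m" "\<not> p dvd m"
      using multiplicity_decompose'[OF nz(1) nu] by metis
    obtain m' where m': "N' = p ^ multiplicity p N' * m'"
      using multiplicity_decompose'[OF nz(2) nu] by metis
    have "p \<noteq> 0" using p by auto
    have "(of_int N' :: complex) = of_int p ^ multiplicity p N * (of_int p ^ e * of_int m')"
      by (subst m') (simp add: e power_add)
    moreover have "(of_int N :: complex) = of_int p ^ multiplicity p N * of_int m"
      by (subst m(1)) simp
    ultimately have "of_int N' * inverse (of_int N :: complex) = of_int (p ^ e * m') / of_int m"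
      using \<open>p \<noteq> 0\<close> by (simp add: divide_inverse)
    then have "of_int N' * inverse (of_int N :: complex) \<in> local_ints p"
      using local_intsI[OF m(2), of "p ^ e * m'"] by (simp only:)
    moreover have "(det (block_D h) * inverse (det E)) * cnj (det (block_D h) * inverse (det E)) =
        of_int N' * inverse (of_int N)"
      unfolding N[symmetric] by simp
    moreover have "det (block_D h) * inverse (det E) \<in> L"
      by (intro ring_setD(4)[OF ring_set_L] inverse_L BL hB)
    ultimately show ?thesis by (simp add: V_def)
  qed
  define M where "M = B ** matrix_inv E"
  have ME: "M ** E = B"
    unfolding M_def by (simp add: matrix_mul_assoc[symmetric] matrix_inv_mult[OF dE])
  \<comment> \<open>With \<open>P\<close> the projection to \<open>S\<close>, the lower right block
    of the swapped matrix is \<open>(P M + 1 - P) E\<close>; divided by \<open>det E\<close>, its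
    determinant is the principal minor of \<open>M\<close> on \<open>S\<close>.\<close>
  have minor: "det (coordinate_projection S ** M + (mat 1 - coordinate_projection S)) \<in> V" for S :: "'n set"
  proof -
    let ?P = "coordinate_projection S :: complex^'n^'n"
    define w where "w = blk (mat 1 - ?P) (- ?P) ?P (mat 1 - ?P)"
    have w: "w \<in> unitary_nn" "det w = 1" unfolding w_def by (rule coordinate_swap)+
    have PB: "?P $ a $ b \<in> integral_elements" for a b
      using r by (simp add: coordinate_projection_def)
    have "w $ a $ b \<in> integral_elements" for a b
      unfolding w_def using PB mat_B[OF r(2)] r(5,6) by (intro blk_B) simp_all
    then have "(w ** g) $ a $ b \<in> integral_elements" for a b
      using g(1) by (intro ring_set_matrix_mult[OF rB]) (simp_all add: G_def)
    then have "w ** g \<in> G"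
      using g(1) w unitary_nn_mult[of w g] by (simp add: G_def det_mul)
    from ratio[OF this] have D: "det (block_D (w ** g)) * inverse (det E) \<in> V" .
    have "block_D (w ** g) = (?P ** M + (mat 1 - ?P)) ** E"
      unfolding w_def g_blk by (simp add: blk_mult matrix_add_rdistrib ME matrix_mul_assoc[symmetric])
    then have eq: "det (block_D (w ** g)) = det (?P ** M + (mat 1 - ?P)) * det E"
      by (simp add: det_mul)
    show ?thesis using D dE unfolding eq mult.assoc by simp
  qed
  have row1: "row i (mat 1 :: complex^'n^'n) $ j = (if i = j then 1 else 0)" for i j
    by (simp add: row_def mat_def)
  have diag: "M $ s $ s \<in> V" for s
  proof -
    have "coordinate_projection {s} ** M + (mat 1 - coordinate_projection {s}) =
        (\<chi> i. if i = s then M $ s else row i (mat 1))"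
      by (auto simp: vec_eq_iff coordinate_projection_mult row1) (auto simp: coordinate_projection_def mat_def)
    then show ?thesis using minor[of "{s}"] by (simp add: det_replace_row)
  qed
  have two: "M $ s $ s * M $ t $ t - M $ s $ t * M $ t $ s \<in> V" if "s \<noteq> t" for s t
  proof -
    have "coordinate_projection {s, t} ** M + (mat 1 - coordinate_projection {s, t}) =
        (\<chi> i. if i = s then M $ s else if i = t then M $ t else row i (mat 1))"
      by (auto simp: vec_eq_iff coordinate_projection_mult row1) (auto simp: coordinate_projection_def mat_def)
    then show ?thesis using minor[of "{s, t}"] det_replace_two_rows[OF that, of "M $ s" "M $ t"] by simp
  qed
  have rel: "ct A ** C = ct C ** A" "ct A ** E - ct C ** B = mat 1" "ct B ** E = ct E ** B"
    using gu by (simp_all add: blk_unitary_iff)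
  have herm: "ct M = M"
  proof -
    have "ct E ** (ct M ** E) = ct E ** (M ** E)"
      using rel(3) by (simp add: ME[symmetric] ct_mult matrix_mul_assoc)
    then have "ct (matrix_inv E) ** (ct E ** (ct M ** E)) ** matrix_inv E = ct (matrix_inv E) ** (ct E ** (M ** E)) ** matrix_inv E"
      by simp
    moreover have "ct (matrix_inv E) ** (ct E ** (N ** E)) ** matrix_inv E = N" for N :: "complex^'n^'n"
    proof -
      have "ct (matrix_inv E) ** (ct E ** (N ** E)) ** matrix_inv E = (ct (matrix_inv E) ** ct E) ** N ** (E ** matrix_inv E)"
        by (simp add: matrix_mul_assoc)
      also have "\<dots> = N" by (simp add: ct_mult[symmetric] matrix_inv_mult[OF dE])
      finally show ?thesis .
    qed
    ultimately show ?thesis by simp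
  qed
  have herm_nth: "cnj (M $ s $ t) = M $ t $ s" for s t
    using herm by (metis ct_nth)
  have M_L: "M $ s $ t \<in> L" for s t
  proof -
    have "matrix_inv E $ a $ b \<in> L" for a b
    proof -
      have "(\<Sum>j\<in>UNIV. E $ i $ j * matrix_inv E $ j $ b) = (axis b 1 :: complex^'n) $ i" for i
        using matrix_inv_mult(1)[OF dE] by (simp add: vec_eq_iff matrix_matrix_mult_def mat_def axis_def)
      then have "E *v (column b (matrix_inv E)) = axis b 1"
        by (simp add: vec_eq_iff matrix_vector_mult_def column_def)
      then have "column b (matrix_inv E) = (\<chi> k. det (\<chi> i j. if j = k then (axis b 1 :: complex^'n) $ i else E $ i $ j) / det E)"
        using cramer[OF dE] by blast
      then have "matrix_inv E $ a $ b = det (\<chi> i j. if j = a then (axis b 1 :: complex^'n) $ i else E $ i $ j) * inverse (det E)"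
        by (simp add: vec_eq_iff column_def divide_inverse)
      moreover have "det (\<chi> i j. if j = a then (axis b 1 :: complex^'n) $ i else E $ i $ j) \<in> integral_elements"
        using gB r by (intro ring_set_det[OF rB]) (simp add: axis_def)
      moreover have "det E \<in> integral_elements" by (intro ring_set_det[OF rB] gB)
      ultimately show ?thesis using BL inverse_L ring_setD(4)[OF ring_set_L] by simp
    qed
    then show ?thesis unfolding M_def by (intro ring_set_matrix_mult[OF ring_set_L]) (simp_all add: BL gB)
  qed
  have MV: "M $ s $ t \<in> V" for s t
  proof (cases "s = t")
    case True
    then show ?thesis using diag by simp
  next
    case False
    \<comment> \<open>As \<open>M\<close> is Hermitian, the norm of an off-diagonal entry is the
      diagonal product minus the minor. It is rational and lies in \<open>V\<close>, so its square
      is integral at \<open>p\<close>, and then so is the norm itself.\<close>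
    have "M $ s $ s * M $ t $ t - (M $ s $ s * M $ t $ t - M $ s $ t * M $ t $ s) \<in> V"
      by (intro ring_setD[OF rV] diag two False)
    then have c: "M $ s $ t * cnj (M $ s $ t) \<in> V" by (simp add: herm_nth)
    have "M $ s $ t * cnj (M $ s $ t) \<in> \<rat>"
      by (rule L_real[OF ring_setD(4)[OF ring_set_L M_L cnj_L[OF M_L]]]) simp
    moreover have "(M $ s $ t * cnj (M $ s $ t)) * (M $ s $ t * cnj (M $ s $ t)) \<in> local_ints p"
      using c by (simp add: V_def mult.commute)
    then have "of_int p * ((M $ s $ t * cnj (M $ s $ t)) * (M $ s $ t * cnj (M $ s $ t))) \<in> local_ints p"
      by (rule ring_setD(4)[OF ring_set_local_ints[OF p] ring_set_of_int[OF ring_set_local_ints[OF p]]])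
    ultimately have "M $ s $ t * cnj (M $ s $ t) \<in> local_ints p"
      by (rule local_ints_sqrt[OF p])
    then show ?thesis using M_L by (simp add: V_def)
  qed
  \<comment> \<open>The unitary relations make \<open>T\<close> the inverse of \<open>E\<close>.
    This expression has entries in the ring \<open>V\<close>, so the inverse of \<open>det E\<close>
    is integral at \<open>p\<close> as well.\<close>
  define T where "T = ct A - ct C ** M"
  have TE: "T ** E = mat 1"
    unfolding T_def by (simp add: matrix_diff_rdistrib matrix_mul_assoc[symmetric] ME rel(2))
  then have dT: "det T * det E = 1" by (metis det_mul det_I)
  have "T $ i $ j \<in> V" for i j
  proof -
    have ctA: "ct A $ i $ j \<in> V" and ctC: "ct C $ a $ b \<in> V" for a b
      using BV cnj_integral_elements gB by simp_all
    show ?thesis unfolding T_def vector_minus_component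
      by (rule ring_setD(6)[OF rV ctA ring_set_matrix_mult[OF rV ctC MV]])
  qed
  then have TV: "det T \<in> V" by (rule ring_set_det[OF rV])
  have invE: "inverse (det E) = det T" using dT by (metis inverse_unique mult.commute)
  have eq: "inverse (det E * cnj (det E)) = det T * cnj (det T)"
    unfolding invE[symmetric] by simp
  have iV: "inverse (det E * cnj (det E)) \<in> local_ints p"
    using TV unfolding eq V_def by simp
  have EB: "det E \<in> integral_elements" by (intro ring_set_det[OF rB] gB)
  \<comment> \<open>The Schur formula at \<open>Z = 0\<close>; the complementary block is the
    adjoint of \<open>T\<close>, hence \<open>det g = det E / cnj (det E)\<close>.\<close>
  have "det g = det (A - M ** C) * det E"
    unfolding g_blk using det_block_schur[of M C 0 E A B] by (simp add: ME)
  also have "A - M ** C = ct T" by (simp add: T_def ct_diff ct_mult herm)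
  finally have "det g = cnj (inverse (det E)) * det E" by (simp add: det_ct invE)
  moreover have "det g = det \<gamma>" using g(1) by (simp add: G_def)
  ultimately have "det \<gamma> * cnj (det E) = det E" using dE by simp
  moreover have "det E * cnj (det E) \<in> local_ints p" using BV[OF EB] by (simp add: V_def)
  ultimately show ?thesis using that[of "det E"] BL[OF EB] dE iV by blast
qed

lemma unitary_det_not_ramified:
  fixes \<gamma> :: "complex^('n::finite+'n)^('n+'n)"
  assumes p: "Factorial_Ring.prime p" and t: "p dvd t" and n: "p dvd n" "\<not> p\<^sup>2 dvd n"
    and l: "cnj l = of_int t - l" "l * cnj l = of_int n"
    and L: "L = {a + b * l | a b. a \<in> \<rat> \<and> b \<in> \<rat>}"
    and \<gamma>: "\<gamma> \<in> unitary_nn" "\<And>a b. \<gamma> $ a $ b \<in> integral_elements"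
    and \<delta>: "det \<gamma> * cnj l = l"
  shows False
proof -
  note rs = ring_set_local_ints[OF p]
  obtain u where u: "u \<in> L" "u \<noteq> 0" "u * cnj u \<in> local_ints p" "inverse (u * cnj u) \<in> local_ints p"
    "det \<gamma> * cnj u = u"
    using unitary_local_unit[OF p ring_set_quadratic_local[OF p t n l L] \<gamma>] .
  have n0: "n \<noteq> 0" using n by auto
  then have l0: "l \<noteq> 0" using l(2) by auto
  have "l = 0 + 1 * l" by simp
  then have "l \<in> L" unfolding L by (metis (mono_tags, lifting) Rats_0 Rats_1 mem_Collect_eq)
  then have qL: "u * inverse l \<in> L" using u inverse_L ring_setD(4)[OF ring_set_L] by blast
  have "(det \<gamma> * cnj l) * cnj u = (det \<gamma> * cnj u) * cnj l" by simp
  then have "l * cnj u = u * cnj l" by (simp only: \<delta> u(5))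
  then have "cnj (u * inverse l) = u * inverse l" using l0 by (simp add: field_simps)
  then have "Im (u * inverse l) = 0" by (metis Reals_cnj_iff complex_is_Real_iff)
  then have qQ: "u * inverse l \<in> \<rat>" by (rule L_real[OF qL])
  define q where "q = u * inverse l"
  have q: "q \<in> \<rat>" "u = q * l" "cnj q = q" using qQ l0 cnj_Rats[OF qQ] by (simp_all add: q_def)
  obtain n' where n': "n = p * n'" using n by auto
  have nn': "\<not> p dvd n'" using n(2) unfolding n' power2_eq_square by auto
  \<comment> \<open>As \<open>q\<close> is rational, the norm of \<open>u\<close> is
    \<open>q * q\<close> times the norm \<open>n\<close> of \<open>l\<close>, which \<open>p\<close>
    divides exactly once.\<close>
  have N: "u * cnj u = of_int p * (of_int n' * (q * q))"
  proof -
    have "u * cnj u = (q * q) * (l * cnj l)" using q by (simp add: mult_ac)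
    then show ?thesis unfolding l(2) n' by (simp add: mult_ac)
  qed
  have z0: "0 \<in> local_ints p" by (rule ring_setD(1)[OF rs])
  have "inverse (of_int n') * (u * cnj u) = of_int p * (q * q)"
    unfolding N using n0 n' by (simp add: field_simps)
  moreover have "inverse (of_int n') \<in> local_ints p"
    using local_ints_unit(2)[OF p nn' z0] by simp
  ultimately have "of_int p * (q * q) \<in> local_ints p"
    using ring_setD(4)[OF rs _ u(3), of "inverse (of_int n')"] by simp
  then have qZ: "q \<in> local_ints p" by (rule local_ints_sqrt[OF p q(1)])
  have "of_int p * ((of_int n' * (q * q)) * inverse (u * cnj u)) = (u * cnj u) * inverse (u * cnj u)"
    unfolding N by (simp only: mult.assoc)
  also have "\<dots> = 1" using u(2) by (intro right_inverse) simp
  finally show False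
    using local_ints_not_unit[of "(of_int n' * (q * q)) * inverse (u * cnj u)" p]
      ring_setD(4)[OF rs] ring_set_of_int[OF rs] qZ u(4) by blast
qed

end

text \<open>Multiplication by \<open>x\<close> permutes the roots of unity; comparing the product of
  all of them before and after is the usual argument for finite abelian groups.\<close>

lemma finite_unity_roots_power:
  assumes "x \<in> unity_roots L" "subfield L complex_ring" "finite (unity_roots L)"
  shows "x ^ card (unity_roots L) = 1"
proof -
  let ?U = "unity_roots L"
  obtain m where m: "m > 0" "x ^ m = 1" "x \<in> L" using assms(1) by (auto simp: unity_roots_def)
  have x0: "x \<noteq> 0" using m by (auto simp: zero_power)
  have nz: "y \<noteq> 0" if "y \<in> ?U" for y using that by (auto simp: unity_roots_def zero_power)
  have "(*) x ` ?U \<subseteq> ?U"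
  proof
    fix z assume "z \<in> (*) x ` ?U"
    then obtain y m' where y: "z = x * y" "y \<in> L" "m' > 0" "y ^ m' = 1" by (auto simp: unity_roots_def)
    have "(x * y) ^ (m * m') = (x ^ m) ^ m' * (y ^ m') ^ m"
      by (simp add: power_mult_distrib power_mult[symmetric] mult.commute)
    then have "(x * y) ^ (m * m') = 1" using m y by simp
    then show "z \<in> ?U"
      using m y subfield_complex(4)[OF assms(2)] by (auto simp: unity_roots_def intro!: exI[of _ "m * m'"])
  qed
  moreover have inj: "inj_on ((*) x) ?U" using x0 by (simp add: inj_on_def)
  ultimately have im: "(*) x ` ?U = ?U" using assms(3) by (intro endo_inj_surj) auto
  have "prod (\<lambda>y. y) ?U = prod (\<lambda>y. x * y) ?U"
    using prod.reindex[OF inj, of "\<lambda>y. y"] im by (simp add: comp_def)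
  also have "\<dots> = x ^ card ?U * prod (\<lambda>y. y) ?U" by (simp add: prod.distrib)
  finally show ?thesis
    using nz assms(3) by (simp add: prod_zero_iff)
qed

section \<open>Orders of determinants of integral unitary matrices\<close>

lemma det_unitary: "\<gamma> \<in> unitary_nn \<Longrightarrow> det \<gamma> * cnj (det \<gamma>) = 1"
proof -
  assume "\<gamma> \<in> unitary_nn"
  then have "ct \<gamma> ** J_form ** \<gamma> = J_form" by (simp add: unitary_nn_def)
  then have "cnj (det \<gamma>) * det (J_form :: complex^('a+'a)^('a+'a)) * det \<gamma> = det (J_form :: complex^('a+'a)^('a+'a))"
    by (metis det_mul det_ct)
  moreover have "det (J_form :: complex^('a+'a)^('a+'a)) \<noteq> 0"
  proof -
    have "J_form ** J_form = (mat 1 :: complex^('a+'a)^('a+'a))"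
      by (simp add: J_blk blk_mult mat_1_blk blk_eq_iff) (simp add: vec_eq_iff mat_mult_left, simp add: mat_def)
    then have "det (J_form :: complex^('a+'a)^('a+'a)) * det (J_form :: complex^('a+'a)^('a+'a)) = 1"
      by (metis det_mul det_I)
    then show ?thesis by auto
  qed
  ultimately show ?thesis by (simp add: mult_ac)
qed

fun matrix_power :: "complex^'n^'n \<Rightarrow> nat \<Rightarrow> complex^'n::finite^'n" where
  "matrix_power A 0 = mat 1"
| "matrix_power A (Suc n) = A ** matrix_power A n"

lemma det_matrix_power: "det (matrix_power A n) = det A ^ n"
  by (induction n) (simp_all add: det_mul)

lemma ring_set_matrix_power:
  "ring_set R \<Longrightarrow> (\<And>i j. A $ i $ j \<in> R) \<Longrightarrow> matrix_power A n $ i $ j \<in> R"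
  by (induction n arbitrary: i j) (auto simp: mat_def ring_setD(1,2) intro: ring_set_matrix_mult)

lemma unitary_matrix_power: "\<gamma> \<in> unitary_nn \<Longrightarrow> matrix_power \<gamma> n \<in> unitary_nn"
proof (induction n)
  case 0
  show ?case by (simp add: mat_1_blk blk_unitary_iff)
qed (simp add: unitary_nn_mult)

text \<open>The determinant is integral of absolute value one, hence a root of unity in
  \<open>L\<close>, and its power to half the number of such roots is \<open>1\<close> or
  \<open>- 1\<close>. The value \<open>- 1\<close> is excluded at a ramified prime.\<close>

lemma (in imaginary_quadratic) det_unitary_power:
  assumes \<gamma>: "\<gamma> \<in> unitary_nn" "\<And>a b. \<gamma> $ a $ b \<in> ring_of_integers L"
    and sf: "subfield L complex_ring" and v: "0 < v" "card (unity_roots L) div 2 dvd v"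
  shows "det \<gamma> ^ v = 1"
proof -
  let ?c = "card (unity_roots L)" and ?\<delta> = "det \<gamma>"
  have \<gamma>B: "\<gamma> $ a $ b \<in> integral_elements" for a b using \<gamma>(2) algebraic_int_integral by blast
  \<comment> \<open>An infinite set has \<open>card\<close> zero, and zero divides only zero; so
    positivity of \<open>v\<close> makes the set of roots of unity finite.\<close>
  have "0 < ?c"
  proof (rule ccontr)
    assume "\<not> 0 < ?c"
    then have c0: "?c = 0" unfolding neq0_conv[symmetric] not_not .
    have "0 dvd v" using v(2) unfolding c0 by simp
    then show False using v(1) by simp
  qed
  then have fin: "finite (unity_roots L)" by (rule card_ge_0_finite)
  have root: "x ^ ?c = 1" if "x \<in> L" "x ^ m = 1" "m > 0" for x m
    using that finite_unity_roots_power[OF _ sf fin] by (auto simp: unity_roots_def)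
  have \<delta>B: "?\<delta> \<in> integral_elements" by (rule ring_set_det[OF ring_set_integral_elements \<gamma>B])
  have \<delta>c: "?\<delta> ^ ?c = 1"
    using root[OF _ integral_unit_circle[OF \<delta>B det_unitary[OF \<gamma>(1)]]] \<delta>B by (simp add: integral_elements_def)
  have "(- 1) ^ ?c = (1 :: complex)"
    by (rule root[of _ 2]) (auto intro: subfield_complex[OF sf])
  then have ev: "even ?c" by (metis neg_one_odd_power one_neq_neg_one)
  have pow: "matrix_power \<gamma> m \<in> unitary_nn" "\<And>a b. matrix_power \<gamma> m $ a $ b \<in> integral_elements"
    "det (matrix_power \<gamma> m) = ?\<delta> ^ m" for m
    by (rule unitary_matrix_power[OF \<gamma>(1)] ring_set_matrix_power[OF ring_set_integral_elements \<gamma>B] det_matrix_power)+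
  have "?\<delta> ^ (?c div 2) = 1"
  proof (rule ccontr)
    assume ne: "?\<delta> ^ (?c div 2) \<noteq> 1"
    have "?\<delta> ^ (?c div 2) * ?\<delta> ^ (?c div 2) = 1"
      using \<delta>c ev by (simp flip: power_add mult_2)
    then have m1: "?\<delta> ^ (?c div 2) = - 1" using ne by (simp add: square_eq_1_iff)
    show False
    proof (cases "D = 1")
      \<comment> \<open>Here \<open>- 1\<close> is the quotient of \<open>\<beta>\<close> by its
        conjugate, and the norm of \<open>\<beta>\<close> is the squarefree number \<open>D\<close>,
        so any prime divisor of \<open>D\<close> serves.\<close>
      case False
      then obtain p where p: "Factorial_Ring.prime p" "p dvd D" using prime_factor_nat by blast
      then obtain e where e: "D = p * e" by auto
      have pp: "Factorial_Ring.prime (int p)" using p by simp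
      have nd: "\<not> (int p)\<^sup>2 dvd int D"
      proof
        assume "(int p)\<^sup>2 dvd int D"
        then have "p\<^sup>2 dvd D" by (metis int_dvd_int_iff of_nat_power)
        then show False using D_squarefree p by (metis squarefreeD not_prime_unit)
      qed
      show False
      proof (rule unitary_det_not_ramified[OF pp _ _ nd, of 0 \<beta> "matrix_power \<gamma> (?c div 2)"])
        show "\<beta> * cnj \<beta> = of_int (int D)" using \<beta>_sq by (simp add: cnj_\<beta>)
        show "L = {a + b * \<beta> | a b. a \<in> \<rat> \<and> b \<in> \<rat>}" unfolding \<beta>_def by (rule L_eq)
        show "int p dvd int D" using p by simp
      qed (simp_all add: cnj_\<beta> pow m1)
    next
      \<comment> \<open>For the Gaussian field no prime divides \<open>D\<close>. The ramified prime
        is 2, and \<open>1 + \<epsilon>\<close> with \<open>\<epsilon> = \<plusminus>\<i>\<close>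
        has norm 2 and quotient \<open>\<epsilon>\<close> by its conjugate. Hence a quarter of the
        number of roots is taken as exponent, where the determinant is a square root of
        \<open>- 1\<close>.\<close>
      case True
      then have \<beta>i: "\<beta> = \<i>" unfolding \<beta>_def by simp
      then have iL: "\<i> \<in> L" unfolding L_iff by (intro bexI[of _ 0] bexI[of _ 1]) auto
      have i4: "\<i> ^ ?c = 1" by (rule root[OF iL, of 4]) simp_all
      have "4 dvd ?c"
      proof -
        obtain h where h: "?c = 2 * h" using ev by (rule evenE)
        have "(- 1) ^ h = (1 :: complex)" using i4 unfolding h by (simp add: power_mult)
        then have "even h" by (metis neg_one_odd_power one_neq_neg_one)
        then show ?thesis unfolding h by auto
      qed
      then obtain m where m: "?c = 4 * m" by (rule dvdE)
      define \<epsilon> where "\<epsilon> = ?\<delta> ^ m"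
      have "\<epsilon> * \<epsilon> = - 1" using m1 unfolding m \<epsilon>_def by (simp flip: power_add mult_2)
      then have "(\<epsilon> - \<i>) * (\<epsilon> + \<i>) = 0" by (simp add: algebra_simps)
      then have \<epsilon>: "\<epsilon> = \<i> \<or> \<epsilon> = - \<i>" by (auto simp: eq_neg_iff_add_eq_0)
      \<comment> \<open>The sign relating \<open>\<epsilon>\<close> to \<open>\<i>\<close>, used to
        pass between the bases \<open>1\<close>, \<open>\<i>\<close> and \<open>1\<close>,
        \<open>1 + \<epsilon>\<close> of \<open>L\<close>.\<close>
      define s :: complex where "s = (if \<epsilon> = \<i> then 1 else - 1)"
      have s: "\<epsilon> = s * \<i>" "s * s = 1" "s \<in> \<rat>" using \<epsilon> by (auto simp: s_def)
      show False
      proof (rule unitary_det_not_ramified[of 2 2 2 "1 + \<epsilon>" "matrix_power \<gamma> m"])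
        show "L = {a + b * (1 + \<epsilon>) | a b. a \<in> \<rat> \<and> b \<in> \<rat>}"
        proof (intro equalityI subsetI)
          fix x assume "x \<in> L"
          then obtain a b where x: "x = a + b * \<i>" "a \<in> \<rat>" "b \<in> \<rat>" unfolding L_iff \<beta>i by blast
          have "x = (a - b * s) + (b * s) * (1 + \<epsilon>)"
            unfolding x s(1) using s(2) by (simp add: algebra_simps)
          then show "x \<in> {a + b * (1 + \<epsilon>) | a b. a \<in> \<rat> \<and> b \<in> \<rat>}" using x s(3) by fastforce
        next
          fix x assume "x \<in> {a + b * (1 + \<epsilon>) | a b. a \<in> \<rat> \<and> b \<in> \<rat>}"
          then obtain a b where x: "x = a + b * (1 + \<epsilon>)" "a \<in> \<rat>" "b \<in> \<rat>" by blast
          have "x = (a + b) + (b * s) * \<i>" unfolding x s(1) by (simp add: algebra_simps)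
          then show "x \<in> L" unfolding L_iff \<beta>i using x s(3) by (metis Rats_add Rats_mult)
        qed
        show "(1 + \<epsilon>) * cnj (1 + \<epsilon>) = of_int 2" using \<epsilon> by (auto simp: algebra_simps)
        show "cnj (1 + \<epsilon>) = of_int 2 - (1 + \<epsilon>)" using \<epsilon> by auto
        show "det (matrix_power \<gamma> m) * cnj (1 + \<epsilon>) = 1 + \<epsilon>"
          unfolding pow(3) \<epsilon>_def[symmetric] using \<epsilon> by (auto simp: algebra_simps)
      qed (simp_all add: pow)
    qed
  qed
  moreover obtain d where "v = ?c div 2 * d" using v(2) by (rule dvdE)
  ultimately show ?thesis by (simp add: power_mult)
qed

section \<open>Modular forms over fields of higher degree\<close>

text \<open>Multiplying the coefficient of degree \<open>i\<close> by \<open>m ^ (d - i)\<close>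
  keeps the polynomial monic and scales its roots by \<open>m\<close>.\<close>

lemma algebraic_int_of_nat_mult:
  assumes "algebraic_int (x :: complex)"
  shows "algebraic_int (of_nat m * x)"
proof -
  obtain p where p: "poly p x = 0" "Polynomial.lead_coeff p = 1" "\<And>i. Polynomial.coeff p i \<in> \<int>"
    using assms by (auto elim: algebraic_int.cases)
  define d where "d = Polynomial.degree p"
  define q where "q = (\<Sum>i\<le>d. Polynomial.monom (Polynomial.coeff p i * of_nat m ^ (d - i)) i)"
  have q: "Polynomial.coeff q j = (if j \<le> d then Polynomial.coeff p j * of_nat m ^ (d - j) else 0)" for j
    by (simp add: q_def Polynomial.coeff_sum)
  have "Polynomial.degree q = d"
  proof (rule antisym)
    show "Polynomial.degree q \<le> d" by (rule degree_le) (simp add: q)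
    show "d \<le> Polynomial.degree q" using p(2) by (intro le_degree) (simp add: q d_def)
  qed
  then have "Polynomial.lead_coeff q = 1" using p(2) by (simp add: q d_def)
  moreover have "\<forall>i. Polynomial.coeff q i \<in> \<int>" using p(3) by (simp add: q)
  moreover have "poly q (of_nat m * x) = (\<Sum>i\<le>d. of_nat m ^ d * (Polynomial.coeff p i * x ^ i))"
    unfolding q_def poly_sum poly_monom
  proof (intro sum.cong refl)
    fix i assume "i \<in> {..d}"
    then have "(of_nat m :: complex) ^ d = of_nat m ^ (d - i) * of_nat m ^ i" by (simp flip: power_add)
    then show "Polynomial.coeff p i * of_nat m ^ (d - i) * (of_nat m * x) ^ i = of_nat m ^ d * (Polynomial.coeff p i * x ^ i)"
      by (simp add: power_mult_distrib)
  qed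
  then have "poly q (of_nat m * x) = 0"
    using p(1) by (simp add: sum_distrib_left[symmetric] poly_altdef d_def)
  ultimately show ?thesis by (intro algebraic_int.intros)
qed

lemma ring_of_integers_cnj_real:
  assumes "subfield L complex_ring" "x \<in> ring_of_integers L" "cnj x = x \<or> cnj x = - x"
  shows "cnj x \<in> ring_of_integers L"
  using assms(2,3) subfield_complex(5)[OF assms(1), of x] by (auto simp: ring_of_integers_def)

text \<open>These are the Hermitian directions of translation; real and purely imaginary
  \<open>x\<close> separate the two real directions belonging to an off-diagonal entry.\<close>

definition hermitian_unit :: "'n \<Rightarrow> 'n \<Rightarrow> complex \<Rightarrow> complex^'n^'n" where
  "hermitian_unit s t x = (\<chi> i j. if i = s \<and> j = t then x else if i = t \<and> j = s then cnj x else 0)"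

lemma ct_hermitian_unit:
  assumes "s = t \<Longrightarrow> cnj x = x"
  shows "ct (hermitian_unit s t x) = hermitian_unit s t x"
proof -
  have "ct (hermitian_unit s t x) $ i $ j = hermitian_unit s t x $ i $ j" for i j
    unfolding ct_nth hermitian_unit_def vec_lambda_beta using assms by (cases "s = t") auto
  then show ?thesis unfolding vec_eq_iff by blast
qed

lemma hermitian_unit_scaleR: "hermitian_unit s t (of_real c * x) = c *\<^sub>R hermitian_unit s t x"
proof -
  have "hermitian_unit s t (of_real c * x) $ i $ j = (c *\<^sub>R hermitian_unit s t x) $ i $ j" for i j
    unfolding hermitian_unit_def vector_scaleR_component vec_lambda_beta
    by (auto simp: complex_eq_iff)
  then show ?thesis unfolding vec_eq_iff by blast
qed

lemma half_space_translate:
  assumes "Z \<in> hermitian_half_space" "ct S = S"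
  shows "Z + S \<in> hermitian_half_space"
proof -
  have eq: "Z + S - ct (Z + S) = Z - ct Z" by (simp add: ct_add assms(2))
  show ?thesis using assms(1) unfolding hermitian_half_space_def mem_Collect_eq eq .
qed

text \<open>Translation by \<open>S\<close> is the action of an upper unipotent matrix congruent to
  1 modulo \<open>N\<close>, whose automorphy factor is 1.\<close>

lemma modular_form_translate:
  fixes S :: "complex^'n::finite^'n"
  assumes F: "hermitian_modular_form \<Gamma> \<kappa> F" and N: "principal_congruence_subgroup L N \<subseteq> \<Gamma>"
    and L: "subfield L complex_ring"
    and S: "ct S = S" "\<And>i j. \<exists>x\<in>ring_of_integers L. S $ i $ j = of_nat N * x"
      "\<And>i j. S $ i $ j \<in> ring_of_integers L"
    and Z: "Z \<in> hermitian_half_space"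
  shows "F (Z + S) = F Z"
proof -
  let ?g = "blk (mat 1) S 0 (mat 1)"
  have z: "0 \<in> ring_of_integers L" "1 \<in> ring_of_integers L"
    using subfield_complex(1,2)[OF L] by (simp_all add: ring_of_integers_def)
  have ct0: "ct (0 :: complex^'n^'n) = 0" by (simp add: vec_eq_iff)
  have "?g \<in> unitary_nn" using S(1) ct0 by (simp add: blk_unitary_iff)
  moreover have "?g $ a $ b \<in> ring_of_integers L" for a b
    using z S(3) by (cases a; cases b) (simp_all add: mat_def)
  moreover have "\<exists>x\<in>ring_of_integers L. ?g $ a $ b - mat 1 $ a $ b = of_nat N * x" for a b
    unfolding mat_1_blk using S(2) z(1) by (cases a; cases b) (auto intro!: bexI[of _ 0])
  ultimately have "?g \<in> \<Gamma>"
    using N by (auto simp: principal_congruence_subgroup_def unitary_nn_integers_def)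
  then have "F Z = det (block_C ?g ** Z + block_D ?g) powi (- \<kappa>) * F (moebius ?g Z)"
    using F Z by (simp add: hermitian_modular_form_def)
  moreover have "matrix_inv (mat 1 :: complex^'n^'n) = mat 1"
    using matrix_inv_mult(1)[of "mat 1 :: complex^'n^'n"] by simp
  ultimately show ?thesis by (simp add: moebius_def)
qed

text \<open>The real multiples of the direction under which \<open>F\<close> is invariant form a
  group containing \<open>a\<close> and \<open>a * \<theta>\<close>. These are incommensurable, so
  Dirichlet approximation gives arbitrarily small nonzero elements, along which the difference
  quotients vanish. The condition \<open>cnj x = x \<or> cnj x = - x\<close> keeps the conjugate
  entry among the integers of \<open>L\<close>.\<close>

lemma modular_form_derivative_zero:
  fixes F :: "complex^'n::finite^'n \<Rightarrow> complex"
  assumes F: "hermitian_modular_form \<Gamma> \<kappa> F" and N: "principal_congruence_subgroup L N \<subseteq> \<Gamma>" "0 < N"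
    and L: "number_field L" and \<theta>: "of_real \<theta> \<in> L" "\<theta> \<notin> \<rat>"
    and x: "x \<in> L" "cnj x = x \<or> cnj x = - x" "s = t \<Longrightarrow> cnj x = x"
    and Z: "Z \<in> hermitian_half_space" and D: "(F has_derivative D) (at Z)"
  shows "D (hermitian_unit s t x) = 0"
proof -
  have sf: "subfield L complex_ring" using L by (simp add: number_field_def)
  note l = subfield_complex[OF sf]
  obtain n1 :: nat where n1: "n1 > 0" "of_nat n1 * x \<in> ring_of_integers L"
    using number_field_integer_multiple[OF L x(1)] .
  obtain n2 :: nat where n2: "n2 > 0" "of_nat n2 * (of_real \<theta> * x) \<in> ring_of_integers L"
    using number_field_integer_multiple[OF L l(4)[OF \<theta>(1) x(1)]] .
  have mult: "of_nat m * y \<in> ring_of_integers L" if "y \<in> ring_of_integers L" for m y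
  proof -
    have "of_nat m \<in> L" by (induction m) (simp_all add: l)
    then show ?thesis using that l(4) algebraic_int_of_nat_mult by (simp add: ring_of_integers_def)
  qed
  define S where "S = (\<lambda>c :: real. hermitian_unit s t (of_real c * x))"
  have S_scale: "S c = c *\<^sub>R hermitian_unit s t x" for c
    unfolding S_def by (rule hermitian_unit_scaleR)
  have S_ct: "ct (S c) = S c" for c
    unfolding S_def using x(3) by (intro ct_hermitian_unit) simp
  define P where "P = (\<lambda>c. \<forall>Z\<in>hermitian_half_space. F (Z + S c) = F Z)"
  have S_add: "S (c + d) = S c + S d" for c d
    by (simp add: S_scale scaleR_left_distrib)
  have P_add: "P (c + d)" if "P c" "P d" for c d
    unfolding P_def
  proof
    fix Z :: "complex^'n^'n" assume Z: "Z \<in> hermitian_half_space"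
    have "F (Z + S (c + d)) = F ((Z + S c) + S d)" by (simp add: S_add add.assoc)
    also have "\<dots> = F (Z + S c)"
      using \<open>P d\<close> half_space_translate[OF Z S_ct] by (simp add: P_def)
    also have "\<dots> = F Z" using \<open>P c\<close> Z by (simp add: P_def)
    finally show "F (Z + S (c + d)) = F Z" .
  qed
  have P_minus: "P (- c)" if "P c" for c
    unfolding P_def
  proof
    fix Z :: "complex^'n^'n" assume Z: "Z \<in> hermitian_half_space"
    have "F (Z + S (- c) + S c) = F (Z + S (- c))"
      using \<open>P c\<close> half_space_translate[OF Z S_ct] by (simp add: P_def)
    moreover have "S (- c) + S c = 0" by (simp add: S_scale)
    then have "Z + S (- c) + S c = Z" by (simp add: add.assoc)
    ultimately show "F (Z + S (- c)) = F Z" by simp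
  qed
  have P_0: "P 0" by (simp add: P_def S_scale)
  have P_nat: "P (of_nat m * c)" if "P c" for m c
    by (induction m) (simp_all add: P_0 distrib_right P_add that)
  have P_int: "P (of_int m * c)" if "P c" for m c
    using P_nat[OF that] P_minus[OF P_nat[OF that]] by (cases m) (simp_all del: of_nat_Suc)
  have P_mem: "P (of_nat N * c)" if c: "of_real c * x \<in> ring_of_integers L" for c
    unfolding P_def
  proof
    fix Z :: "complex^'n^'n" assume Z: "Z \<in> hermitian_half_space"
    let ?y = "of_real c * x"
    have y: "cnj ?y = ?y \<or> cnj ?y = - ?y" using x(2) by auto
    have yc: "cnj ?y \<in> ring_of_integers L"
      by (rule ring_of_integers_cnj_real[OF sf c y])
    have z: "0 \<in> ring_of_integers L" using l(1) by (simp add: ring_of_integers_def)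
    have ex: "\<exists>x'\<in>ring_of_integers L. S (of_nat N * c) $ i $ j = of_nat N * x'" for i j
      unfolding S_def hermitian_unit_def using c yc z by (auto simp: mult_ac)
    moreover have "S (of_nat N * c) $ i $ j \<in> ring_of_integers L" for i j
      using ex[of i j] mult by auto
    ultimately show "F (Z + S (of_nat N * c)) = F Z"
      by (intro modular_form_translate[OF F N(1) sf S_ct _ _ Z]) auto
  qed
  \<comment> \<open>The factors \<open>n1\<close> and \<open>n2\<close> clear the denominators of
    \<open>x\<close> and \<open>\<theta> * x\<close>, and \<open>N\<close> puts the translations
    into the principal congruence subgroup.\<close>
  define a where "a = real N * real n1 * real n2"
  have a: "a > 0" using N(2) n1 n2 by (simp add: a_def)
  have "of_real (real n1 * real n2) * x = of_nat n2 * (of_nat n1 * x)" by simp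
  then have "P (of_nat N * (real n1 * real n2))"
    using mult[OF n1(2), of n2] by (intro P_mem) (simp add: mult_ac)
  then have Pa: "P a" by (simp add: a_def mult_ac)
  have "of_real (real n1 * real n2 * \<theta>) * x = of_nat n1 * (of_nat n2 * (of_real \<theta> * x))" by simp
  then have "P (of_nat N * (real n1 * real n2 * \<theta>))"
    using mult[OF n2(2), of n1] by (intro P_mem) (simp add: mult_ac)
  then have Pb: "P (a * \<theta>)" by (simp add: a_def mult_ac)
  let ?U = "hermitian_unit s t x"
  have small: "\<exists>c. P c \<and> c \<noteq> 0 \<and> \<bar>c\<bar> < \<epsilon>" if "\<epsilon> > 0" for \<epsilon> :: real
  proof -
    obtain M :: nat where M: "a / \<epsilon> < real M" using reals_Archimedean2 by blast
    have "0 < a / \<epsilon>" using a that by simp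
    then have "M > 0" using M by (metis less_trans of_nat_0_less_iff)
    then obtain h k where hk: "0 < k" "\<bar>of_int k * \<theta> - of_int h\<bar> < 1 / real M"
      using Dirichlet_approx[of M \<theta>] by metis
    let ?c = "of_int k * (a * \<theta>) + of_int (- h) * a"
    have e: "?c = a * (of_int k * \<theta> - of_int h)" by (simp add: algebra_simps)
    have "P ?c" by (intro P_add P_int Pa Pb)
    moreover have "of_int k * \<theta> \<noteq> of_int h"
    proof
      assume "of_int k * \<theta> = of_int h"
      then have "\<theta> = of_int h / of_int k" using hk(1) by (simp add: field_simps)
      then show False using \<theta>(2) by simp
    qed
    then have "?c \<noteq> 0" unfolding e using a by simp
    moreover have "\<bar>?c\<bar> < \<epsilon>"
    proof -
      have "\<bar>?c\<bar> < a * (1 / real M)" unfolding e abs_mult using a mult_strict_left_mono[OF hk(2) a] by simp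
      also have "\<dots> < \<epsilon>" using M \<open>M > 0\<close> that by (simp add: field_simps)
      finally show ?thesis .
    qed
    ultimately show ?thesis by blast
  qed
  interpret D: bounded_linear D using D by (rule has_derivative_bounded_linear)
  have bnd: "norm (D ?U) \<le> e * norm ?U" if "e > 0" for e
  proof -
    obtain d where d: "d > 0" "\<And>y. norm (y - Z) < d \<Longrightarrow> norm (F y - F Z - D (y - Z)) \<le> e * norm (y - Z)"
      using D \<open>e > 0\<close> unfolding has_derivative_at_alt by blast
    obtain c where c: "P c" "c \<noteq> 0" "\<bar>c\<bar> < d / (norm ?U + 1)"
      using small[of "d / (norm ?U + 1)"] d(1) by (auto simp: add_nonneg_pos)
    have pos: "norm ?U + 1 > 0" by (simp add: add_nonneg_pos)
    have "norm (S c) = \<bar>c\<bar> * norm ?U" by (simp add: S_scale)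
    also have "\<dots> \<le> \<bar>c\<bar> * (norm ?U + 1)" by (intro mult_left_mono) auto
    also have "\<dots> < d" using c(3) pos by (simp add: pos_less_divide_eq)
    finally have "norm (F (Z + S c) - F Z - D (S c)) \<le> e * norm (S c)"
      using d(2)[of "Z + S c"] by simp
    moreover have "F (Z + S c) = F Z" using c(1) Z by (simp add: P_def)
    ultimately have "norm (D (c *\<^sub>R ?U)) \<le> e * (\<bar>c\<bar> * norm ?U)" by (simp add: S_scale)
    then have "\<bar>c\<bar> * norm (D ?U) \<le> \<bar>c\<bar> * (e * norm ?U)" by (simp add: D.scaleR mult_ac)
    then show ?thesis using c(2) by simp
  qed
  have lim: "norm (D ?U) \<le> e" if "e > 0" for e
  proof -
    have pos: "norm ?U + 1 > 0" by (simp add: add_nonneg_pos)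
    have "norm (D ?U) \<le> e / (norm ?U + 1) * norm ?U" by (rule bnd) (use that pos in simp)
    also have "\<dots> \<le> e / (norm ?U + 1) * (norm ?U + 1)" using that pos by (intro mult_left_mono) auto
    also have "\<dots> = e" using pos by simp
    finally show ?thesis .
  qed
  have "norm (D ?U) \<le> 0" by (rule field_le_epsilon) (use lim in simp)
  then show ?thesis by simp
qed

lemma modular_form_zero:
  fixes F :: "complex^'n::finite^'n \<Rightarrow> complex"
  assumes F: "hermitian_modular_form \<Gamma> \<kappa> F" and \<Gamma>: "congruence_subgroup L \<Gamma>" and \<kappa>: "0 < \<kappa>"
    and L: "number_field L" and \<theta>: "of_real \<theta> \<in> L" "\<theta> \<notin> \<rat>" and y: "\<i> * of_real y \<in> L" "y \<noteq> 0"
    and Z: "Z \<in> hermitian_half_space"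
  shows "F Z = 0"
proof -
  obtain N where N: "0 < N" "principal_congruence_subgroup L N \<subseteq> \<Gamma>"
    using \<Gamma> by (auto simp: congruence_subgroup_def)
  have sf: "subfield L complex_ring" using L by (simp add: number_field_def)
  note l = subfield_complex[OF sf]
  have "(F has_derivative (\<lambda>_. 0)) (at Z)" if Z: "Z \<in> hermitian_half_space" for Z
  proof -
    obtain D where D: "(F has_derivative D) (at Z)" "\<And>c W. D (map_matrix (\<lambda>w. c * w) W) = c * D W"
      using F Z by (auto simp: hermitian_modular_form_def holomorphic_matrix_fun_def)
    interpret D: bounded_linear D using D(1) by (rule has_derivative_bounded_linear)
    define u where "u = (\<lambda>s t. axis s (axis t 1) :: complex^'n^'n)"
    note dz = modular_form_derivative_zero[OF F N(2,1) L \<theta> _ _ _ Z D(1)]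
    have u0: "D (u s t) = 0" for s t
    proof (cases "s = t")
      case True
      have "hermitian_unit s t 1 = u s t"
        unfolding True by (auto simp: vec_eq_iff hermitian_unit_def u_def axis_def)
      then show ?thesis using dz[of 1 s t] l(2) by simp
    next
      case False
      \<comment> \<open>Off the diagonal, the direction for \<open>\<i> y\<close> plus
        \<open>\<i> y\<close> times the direction for \<open>1\<close> cancels in position
        \<open>(t, s)\<close> and isolates a single matrix entry; complex linearity of
        \<open>D\<close> then applies.\<close>
      have e: "hermitian_unit s t (\<i> * of_real y) + map_matrix (\<lambda>w. (\<i> * of_real y) * w) (hermitian_unit s t 1) =
          map_matrix (\<lambda>w. (2 * \<i> * of_real y) * w) (u s t)"
        using False by (auto simp: vec_eq_iff hermitian_unit_def u_def axis_def map_matrix_def)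
      have "D (hermitian_unit s t 1) = 0" "D (hermitian_unit s t (\<i> * of_real y)) = 0"
        using dz[of 1 s t] dz[of "\<i> * of_real y" s t] l(2) y(1) False by simp_all
      then have "(2 * \<i> * of_real y) * D (u s t) = 0"
        unfolding D(2)[symmetric] e[symmetric] by (simp add: D.add D(2))
      then show ?thesis using y(2) by simp
    qed
    have "D W = 0" for W
    proof -
      have "W = (\<Sum>s\<in>UNIV. \<Sum>t\<in>UNIV. map_matrix (\<lambda>w. W $ s $ t * w) (u s t))"
      proof -
        have "(\<Sum>s\<in>UNIV. \<Sum>t\<in>UNIV. map_matrix (\<lambda>w. W $ s $ t * w) (u s t)) $ i $ j = W $ i $ j" for i j
        proof -
          have entry: "map_matrix (\<lambda>w. W $ s $ t * w) (u s t) $ i $ j =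
              (if s = i then if t = j then W $ s $ t else 0 else 0)" for s t
            by (auto simp: map_matrix_def u_def axis_def)
          have row: "(\<Sum>t\<in>UNIV. if s = i then if t = j then W $ s $ t else 0 else 0) =
              (if s = i then W $ s $ j else 0)" for s
            by simp
          show ?thesis unfolding sum_component entry row by simp
        qed
        then show ?thesis by (simp add: vec_eq_iff)
      qed
      then have "D W = (\<Sum>s\<in>UNIV. \<Sum>t\<in>UNIV. D (map_matrix (\<lambda>w. W $ s $ t * w) (u s t)))"
        by (metis (no_types, lifting) D.sum sum.cong)
      then show ?thesis by (simp add: D(2) u0)
    qed
    then have "D = (\<lambda>_. 0)" by blast
    then show ?thesis using D(1) by simp
  qed
  then have "\<exists>c. \<forall>Z\<in>hermitian_half_space. F Z = c"
    by (intro has_derivative_zero_constant[OF convex_half_space]) (blast intro: has_derivative_at_withinI)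
  then obtain c where c: "\<And>Z. Z \<in> hermitian_half_space \<Longrightarrow> F Z = c" by blast
  \<comment> \<open>A lower unipotent matrix congruent to 1 modulo \<open>N\<close>. Its denominator
    at \<open>\<i>\<close> has determinant of absolute value greater than 1, so in positive weight a
    constant satisfies the transformation law only if it is zero.\<close>
  let ?g = "blk (mat 1) 0 (mat (of_nat N)) (mat 1) :: complex^('n+'n)^('n+'n)"
  have ct0: "ct (0 :: complex^'n^'n) = 0" "ct (mat (of_nat N)) = (mat (of_nat N) :: complex^'n^'n)"
    by (auto simp: vec_eq_iff mat_def)
  have gu: "?g \<in> unitary_nn" using ct0 by (simp add: blk_unitary_iff)
  have z: "0 \<in> ring_of_integers L" "1 \<in> ring_of_integers L" "of_nat N \<in> ring_of_integers L"
  proof -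
    have "of_nat m \<in> L" for m by (induction m) (simp_all add: l)
    then show "0 \<in> ring_of_integers L" "1 \<in> ring_of_integers L" "of_nat N \<in> ring_of_integers L"
      using l(1,2) by (simp_all add: ring_of_integers_def)
  qed
  have "?g $ a $ b \<in> ring_of_integers L" for a b
    using z by (cases a; cases b) (simp_all add: mat_def)
  moreover have "\<exists>x\<in>ring_of_integers L. ?g $ a $ b - mat 1 $ a $ b = of_nat N * x" for a b
  proof (cases "?g $ a $ b - mat 1 $ a $ b = 0")
    case True
    then show ?thesis using z(1) by (auto intro!: bexI[of _ 0])
  next
    case False
    then have "?g $ a $ b - mat 1 $ a $ b = of_nat N * 1"
      unfolding mat_1_blk by (cases a; cases b) (auto simp: mat_def split: if_splits)
    then show ?thesis using z(2) by blast
  qed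
  ultimately have "?g \<in> \<Gamma>"
    using N gu by (auto simp: principal_congruence_subgroup_def unitary_nn_integers_def)
  define Z0 :: "complex^'n^'n" where "Z0 = mat \<i>"
  have Z0: "Z0 \<in> hermitian_half_space" using scaled_identity_half_space[of 1] by (simp add: Z0_def)
  have "F Z0 = det (block_C ?g ** Z0 + block_D ?g) powi (- \<kappa>) * F (moebius ?g Z0)"
    using F Z0 \<open>?g \<in> \<Gamma>\<close> unfolding hermitian_modular_form_def by blast
  moreover have "moebius ?g Z0 \<in> hermitian_half_space"
    using action_half_space[OF gu Z0] by (simp add: moebius_def)
  moreover have "block_C ?g ** Z0 + block_D ?g = mat (of_nat N * \<i> + 1)"
    by (auto simp: Z0_def vec_eq_iff mat_mult_left) (auto simp: mat_def)
  moreover have "det (mat (of_nat N * \<i> + 1) :: complex^'n^'n) = (of_nat N * \<i> + 1) ^ CARD('n)"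
    by (subst det_diagonal) (simp_all add: mat_def)
  ultimately have eq: "c = ((of_nat N * \<i> + 1) ^ CARD('n)) powi (- \<kappa>) * c"
    using c Z0 by metis
  have "1 < norm (of_nat N * \<i> + 1)"
    using N(1) by (auto simp: cmod_def)
  then have "1 < norm ((of_nat N * \<i> + 1) ^ CARD('n))"
    by (simp add: norm_power one_less_power)
  then have "1 < norm (((of_nat N * \<i> + 1) ^ CARD('n)) ^ nat \<kappa>)"
    unfolding norm_power by (rule one_less_power) (use \<kappa> in simp)
  moreover have "((of_nat N * \<i> + 1) ^ CARD('n)) powi (- \<kappa>) = inverse (((of_nat N * \<i> + 1) ^ CARD('n)) ^ nat \<kappa>)"
    using \<kappa> by (simp add: power_int_def power_inverse)
  ultimately obtain w where w: "1 < norm w" "c = inverse w * c" using eq by metis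
  then have "w * c = c" by (metis (no_types, lifting) mult.assoc mult_1 norm_zero not_one_less_zero right_inverse)
  then have "(w - 1) * c = 0" by (simp add: algebra_simps)
  then have "c = 0" using w(1) by auto
  then show ?thesis using c Z by simp
qed

section \<open>The differential operator on modular forms\<close>

lemma holo_mt:
  fixes f :: "complex^'n::finite^'n \<Rightarrow> complex"
  assumes "holomorphic_matrix_fun H f"
  shows "holo {w :: complex^('r::finite \<times> 'n \<times> 'n). \<forall>j. mt w j \<in> H} (\<lambda>w. f (mt w j))"
  unfolding holo_def
proof
  fix w :: "complex^('r \<times> 'n \<times> 'n)" assume "w \<in> {w. \<forall>j. mt w j \<in> H}"
  then have "mt w j \<in> H" by blast
  then obtain D where D: "(f has_derivative D) (at (mt w j))"
    "\<And>c W. D (map_matrix (\<lambda>w. c * w) W) = c * D W"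
    using assms by (auto simp: holomorphic_matrix_fun_def)
  have "linear (\<lambda>w :: complex^('r \<times> 'n \<times> 'n). mt w j)"
    by (rule linearI) (simp_all add: vec_eq_iff)
  then have "bounded_linear (\<lambda>w :: complex^('r \<times> 'n \<times> 'n). mt w j)"
    by (rule linear_conv_bounded_linear[THEN iffD1])
  then have "((\<lambda>w :: complex^('r \<times> 'n \<times> 'n). mt w j) has_derivative (\<lambda>w. mt w j)) (at w)"
    by (rule bounded_linear_imp_has_derivative)
  then have "((\<lambda>w. f (mt w j)) has_derivative (\<lambda>w. D (mt w j))) (at w)"
    using D(1) by (rule has_derivative_compose)
  moreover have "mt (c *s w') j = map_matrix (\<lambda>w. c * w) (mt w' j)"
    for c and w' :: "complex^('r \<times> 'n \<times> 'n)"
    by (simp add: vec_eq_iff map_matrix_def)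
  ultimately have "cder (\<lambda>w. f (mt w j)) (\<lambda>w. D (mt w j)) w"
    by (simp add: cder_def D(2))
  then show "\<exists>D. cder (\<lambda>w. f (mt w j)) D w" by blast
qed

lemma holomorphic_diagonal:
  fixes h :: "complex^('r::finite \<times> 'n::finite \<times> 'n) \<Rightarrow> complex"
  assumes "holo {w. \<forall>j. mt w j \<in> H} h"
  shows "holomorphic_matrix_fun H (\<lambda>Z. h (coords (\<lambda>_. Z)))"
  unfolding holomorphic_matrix_fun_def
proof
  fix Z assume "Z \<in> H"
  then have "coords (\<lambda>_. Z) \<in> {w :: complex^('r \<times> 'n \<times> 'n). \<forall>j. mt w j \<in> H}" by simp
  then obtain D where D: "cder h D (coords (\<lambda>_. Z))"
    using assms unfolding holo_def by blast
  then have Dh: "(h has_derivative D) (at (coords (\<lambda>_. Z)))" by (simp add: cder_def)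
  let ?l = "\<lambda>Z. coords (\<lambda>_. Z) :: complex^('r \<times> 'n \<times> 'n)"
  have "linear ?l"
    by (rule linearI) (auto simp: vec_eq_iff)
  then have "bounded_linear ?l"
    by (rule linear_conv_bounded_linear[THEN iffD1])
  then have "(?l has_derivative ?l) (at Z)"
    by (rule bounded_linear_imp_has_derivative)
  then have "((\<lambda>Z. h (?l Z)) has_derivative (\<lambda>W. D (?l W))) (at Z)"
    using Dh by (rule has_derivative_compose)
  moreover have "?l (map_matrix (\<lambda>w. c * w) W) = c *s ?l W" for c W
    by (auto simp: vec_eq_iff map_matrix_def)
  then have "D (?l (map_matrix (\<lambda>w. c * w) W)) = c * D (?l W)" for c W
    using D by (simp add: cder_def)
  ultimately show "\<exists>D. ((\<lambda>Z. h (?l Z)) has_derivative D) (at Z) \<and>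
      (\<forall>c W. D (map_matrix (\<lambda>w. c * w) W) = c * D W)" by blast
qed

text \<open>The alternatives correspond to \<open>K \<subseteq> \<rat>\<close> or not. In the second
  case an irrational element of the real field \<open>K\<close> takes the part of
  \<open>\<theta>\<close> in \<open>modular_form_zero\<close>.\<close>

lemma congruence_subgroup_det_or_zero:
  fixes \<Gamma> :: "(complex^('n::finite+'n)^('n+'n)) set" and k :: "'r \<Rightarrow> nat"
  assumes L: "totally_imaginary_quadratic_extension L K" and k: "\<And>j. 0 < k j" and v: "0 < v"
    and dvd: "(card (unity_roots L) div 2) * unit_index L K dvd v"
    and \<Gamma>: "congruence_subgroup L \<Gamma>"
    and F: "\<And>j. hermitian_modular_form \<Gamma> (int (k j)) (F j)"
  shows "(\<forall>\<gamma>\<in>\<Gamma>. det \<gamma> ^ v = 1) \<or> (\<forall>j. \<forall>Z\<in>hermitian_half_space. F j Z = 0)"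
proof -
  obtain y where y: "y \<noteq> 0" "\<i> * of_real y \<in> L" "of_real (y\<^sup>2) \<in> K"
    "L = {a + b * (\<i> * of_real y) | a b. a \<in> K \<and> b \<in> K}" "K \<subseteq> \<real>" "K \<subseteq> L"
    "subfield L complex_ring" "subfield K complex_ring" "number_field L"
    using quadratic_extension_basis[OF L] by blast
  show ?thesis
  proof (cases "K \<subseteq> \<rat>")
    case True
    note k = subfield_complex[OF y(8)]
    have nat: "of_nat m \<in> K" for m by (induction m) (simp_all add: k)
    have int: "of_int m \<in> K" for m
      by (cases m) (auto intro: nat k(5) simp del: of_nat_Suc)
    have "\<rat> \<subseteq> K"
    proof
      fix x :: complex assume "x \<in> \<rat>"
      then obtain a b where "x = of_int a / of_int b" by (rule Rats_cases')
      then show "x \<in> K" using k(4)[OF int k(6)[OF int]] by (simp add: divide_inverse)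
    qed
    with True have K: "K = \<rat>" by blast
    obtain D where "imaginary_quadratic L D"
      using imaginary_quadraticI[OF y(1) y(3)[unfolded K] y(4)[unfolded K]] .
    then interpret imaginary_quadratic L D .
    have c: "card (unity_roots L) div 2 dvd v" using dvd by (rule dvd_mult_left)
    have "det \<gamma> ^ v = 1" if "\<gamma> \<in> \<Gamma>" for \<gamma>
    proof -
      have "\<gamma> \<in> carrier (unitary_nn_integers L)"
        using \<Gamma> that subgroup.subset unfolding congruence_subgroup_def by blast
      then have "\<gamma> \<in> unitary_nn" "\<And>a b. \<gamma> $ a $ b \<in> ring_of_integers L"
        by (simp_all add: unitary_nn_integers_def)
      then show ?thesis by (rule det_unitary_power[OF _ _ y(7) v c])
    qed
    then show ?thesis by blast
  next
    case False
    then obtain x where x: "x \<in> K" "x \<notin> \<rat>" by blast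
    then obtain \<theta> where \<theta>: "x = of_real \<theta>" using y(5) by (auto elim: Reals_cases)
    have "\<theta> \<notin> \<rat>"
    proof
      assume "\<theta> \<in> \<rat>"
      then obtain a b where "\<theta> = of_int a / of_int b" by (rule Rats_cases')
      then show False using x \<theta> by simp
    qed
    moreover have "of_real \<theta> \<in> L" using x \<theta> y(6) by blast
    ultimately have "F j Z = 0" if "Z \<in> hermitian_half_space" for j Z
      using k by (intro modular_form_zero[OF F \<Gamma> _ y(9) _ _ y(2,1) that]) auto
    then show ?thesis by blast
  qed
qed

theorem corollary13:
  fixes L K :: "complex set"
    and k :: "'r::finite \<Rightarrow> nat"
    and v :: nat
    and \<Gamma> :: "(complex^('n::finite+'n)^('n+'n)) set"
    and F :: "'r \<Rightarrow> complex^'n^'n \<Rightarrow> complex"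
    and Q :: "('r \<times> 'n \<times> 'n) cpoly"
  assumes "totally_imaginary_quadratic_extension L K"
    and "\<And>j. 0 < k j" and "0 < v"
    and "\<And>j. CARD('n) \<le> k j"
    and "(card (unity_roots L) div 2) * unit_index L K dvd v"
    and "congruence_subgroup L \<Gamma>"
    and "\<And>j. hermitian_modular_form \<Gamma> (int (k j)) (F j)"
    and "Q \<in> H_space v k"
  shows "hermitian_modular_form \<Gamma> (int (\<Sum>j\<in>UNIV. k j) + 2 * int v)
           (\<lambda>Z. poly_deriv Q (\<lambda>W. \<Prod>j\<in>UNIV. F j (W $ j)) (\<chi> j. Z))"
proof -
  let ?H = "hermitian_half_space :: (complex^'n^'n) set"
  let ?HH = "{w :: complex^('r \<times> 'n \<times> 'n). \<forall>j. mt w j \<in> ?H}"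
  define g where "g = (\<lambda>w :: complex^('r \<times> 'n \<times> 'n). \<Prod>j\<in>UNIV. F j (mt w j))"
  have \<Phi>: "poly_deriv Q (\<lambda>W. \<Prod>j\<in>UNIV. F j (W $ j)) (\<chi> j. Z) = pdl id Q g (coords (\<lambda>_. Z))" for Z
  proof -
    have "(\<chi> j. Z) = fl (coords (\<lambda>_ :: 'r. Z))" by (simp add: fl_def)
    then show ?thesis by (simp add: poly_deriv_fl g_def) (simp add: fl_def)
  qed
  have openHH: "open ?HH" by (rule open_mt_Collect[OF open_half_space])
  have g_holo: "holo ?HH g"
    unfolding g_def using assms(7) by (intro holo_prod holo_mt) (simp add: hermitian_modular_form_def)
  have holo: "holomorphic_matrix_fun ?H (\<lambda>Z. pdl id Q g (coords (\<lambda>_. Z)))"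
    by (intro holomorphic_diagonal holo_pdl[OF openHH g_holo])
  have "pdl id Q g (coords (\<lambda>_. Z)) = det (block_C \<gamma> ** Z + block_D \<gamma>) powi (- (int (\<Sum>j\<in>UNIV. k j) + 2 * int v)) *
      pdl id Q g (coords (\<lambda>_. moebius \<gamma> Z))" if \<gamma>: "\<gamma> \<in> \<Gamma>" and Z: "Z \<in> ?H" for \<gamma> Z
  proof -
    define A B C D where ABCD: "A = block_A \<gamma>" "B = block_B \<gamma>" "C = block_C \<gamma>" "D = block_D \<gamma>"
    have \<gamma>_blk: "\<gamma> = blk A B C D" by (simp add: ABCD blk_blocks)
    have "\<gamma> \<in> carrier (unitary_nn_integers L)"
      using assms(6) \<gamma> subgroup.subset unfolding congruence_subgroup_def by blast
    then have u: "\<gamma> \<in> unitary_nn" by (simp add: unitary_nn_integers_def)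
    define M where "M = C ** Z + D"
    have moeb: "moebius \<gamma> = (\<lambda>Z. (A ** Z + B) ** matrix_inv (C ** Z + D))"
      by (simp add: fun_eq_iff moebius_def ABCD)
    have dM: "det M \<noteq> 0" unfolding M_def by (rule det_denominator[OF u[unfolded \<gamma>_blk] Z])
    have actH: "moebius \<gamma> Z \<in> ?H" unfolding moeb by (rule action_half_space[OF u[unfolded \<gamma>_blk] Z])
    define N where "N = A - moebius \<gamma> Z ** C"
    have "moebius \<gamma> Z ** M = A ** Z + B"
      unfolding moeb M_def[symmetric] by (simp add: matrix_mul_assoc[symmetric] matrix_inv_mult[OF dM])
    then have detg: "det \<gamma> = det N * det M"
      unfolding \<gamma>_blk N_def M_def by (rule det_block_schur)
    have "det \<gamma> \<noteq> 0" using det_unitary[OF u] by auto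
    then have dN: "det N \<noteq> 0" using detg by auto
    have tr: "F j Z' = inverse (det (C ** Z' + D)) ^ k j * F j (moebius \<gamma> Z')" if "Z' \<in> ?H" for j Z'
      using assms(7)[of j] \<gamma> that
      by (simp add: hermitian_modular_form_def ABCD power_int_minus power_inverse)
    have eq: "pdl id Q g (coords (\<lambda>_. Z)) = inverse (det M) ^ (\<Sum>j\<in>UNIV. k j) *
        (det N * inverse (det M)) ^ v * pdl id Q g (coords (\<lambda>_. moebius \<gamma> Z))"
      unfolding M_def N_def g_def moeb
    proof (rule pdl_covariant[OF open_half_space Z])
      show "Q \<in> Q_space v" using assms(8) by (simp add: H_space_def)
      show "Lap k a b Q = 0" for a b by (rule Lap_H_space[OF assms(4,8)])
    qed (use actH g_holo tr dM dN in \<open>simp_all add: moeb M_def N_def g_def\<close>)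
    consider "det \<gamma> ^ v = 1" | "\<And>j Z. Z \<in> ?H \<Longrightarrow> F j Z = 0"
      using congruence_subgroup_det_or_zero[where F = F and k = k, OF assms(1-3,5-7)] \<gamma> by blast
    then show ?thesis
    proof cases
      case 1
      \<comment> \<open>Since \<open>det N = det \<gamma> / det M\<close>, the affine part
        contributes \<open>- 2 * v\<close> to the exponent of \<open>det M\<close>, and the
        remaining \<open>det \<gamma> ^ v\<close> is 1.\<close>
      have dNM: "det N * inverse (det M) = det \<gamma> * (inverse (det M))\<^sup>2"
        using dM by (simp add: detg power2_eq_square)
      have "(det N * inverse (det M)) ^ v = inverse (det M) ^ (2 * v)"
        unfolding dNM power_mult_distrib 1 by (simp add: power_mult)
      then have "inverse (det M) ^ (\<Sum>j\<in>UNIV. k j) * (det N * inverse (det M)) ^ v =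
          inverse (det M) ^ ((\<Sum>j\<in>UNIV. k j) + 2 * v)"
        by (simp add: power_add)
      also have "\<dots> = det M powi (- int ((\<Sum>j\<in>UNIV. k j) + 2 * v))"
        by (simp only: power_int_minus power_int_of_nat power_inverse)
      also have "- int ((\<Sum>j\<in>UNIV. k j) + 2 * v) = - (int (\<Sum>j\<in>UNIV. k j) + 2 * int v)" by simp
      finally show ?thesis using eq by (simp only: M_def ABCD)
    next
      case 2
      \<comment> \<open>Vanishing of the forms on the open half-space makes the operator vanish at
        \<open>Z\<close> and at its image, so the transformation law reads
        \<open>0 = 0\<close>.\<close>
      have "pdl id Q g (coords (\<lambda>_. Z')) = 0" if "Z' \<in> ?H" for Z'
      proof -
        have m: "coords (\<lambda>_. Z') \<in> ?HH" using that by simp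
        have "pdl id Q g (coords (\<lambda>_. Z')) = pdl id Q (\<lambda>_. 0) (coords (\<lambda>_. Z'))"
          by (rule pdl_cong[OF openHH _ m]) (simp add: g_def 2)
        then show ?thesis using pdl_fun_zero[OF openHH m] by simp
      qed
      then show ?thesis using Z actH by simp
    qed
  qed
  then show ?thesis
    unfolding hermitian_modular_form_def \<Phi> using holo by blast
qed

end
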